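(* Let $R$ be a one-dimensional local Gorenstein ring with residue field of characteristic $0$. Let $I$ be an ideal of $R$ with $\operatorname{ht} I>0$. Then the following are equivalent for a positive integer $n$: (a) the ideal $J^{n+1}:I^{n}$ is independent of $J$, i.e. it is the same ideal for all minimal reductions $J$ of $I$; (b) $\operatorname{core}(I)=J^{n+1}:I^{n}$ for some minimal reduction $J$ of $I$; (c) $n\geq r(I)$.
   Context: Local rings are Noetherian. For ideals $A,B$ of $R$, $A:B=\{x\in R\mid xB\subset A\}$. An ideal $J\subset I$ is a reduction of $I$ if $I^{m+1}=JI^{m}$ for some integer $m\ge 0$; the smallest such $m$ is the reduction number $r_J(I)$ of $I$ with respect to $J$. A minimal reduction of $I$ is a reduction of $I$ that is minimal with respect to inclusion among the reductions of $I$. The reduction number of $I$ is $r(I)=\min\{r_J(I)\mid J \text{ a minimal reduction of } I\}$. The core of $I$, $\operatorname{core}(I)$, is the intersection of all reductions of $I$. *)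

theory Defs
  imports "HOL-Algebra.Algebra" "HOL-Library.Extended_Nat"
begin

section \<open>Dimension and height\<close>

definition prime_chain :: "('a, 'r) ring_scheme \<Rightarrow> (nat \<Rightarrow> 'a set) \<Rightarrow> nat \<Rightarrow> bool" where
  "prime_chain R p n \<longleftrightarrow> (\<forall>i\<le>n. primeideal (p i) R) \<and> (\<forall>i<n. p i \<subset> p (Suc i))"

definition krull_dim :: "('a, 'r) ring_scheme \<Rightarrow> enat" where
  "krull_dim R = Sup {enat n | n. \<exists>p. prime_chain R p n}"

definition prime_height :: "('a, 'r) ring_scheme \<Rightarrow> 'a set \<Rightarrow> enat" where
  "prime_height R P = Sup {enat n | n. \<exists>p. prime_chain R p n \<and> p n = P}"

text \<open>The unit ideal has height \<open>\<infinity>\<close>, being the infimum of the empty set.\<close>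

definition ideal_height :: "('a, 'r) ring_scheme \<Rightarrow> 'a set \<Rightarrow> enat" where
  "ideal_height R I = Inf {prime_height R P | P. primeideal P R \<and> I \<subseteq> P}"


section \<open>Local rings and the residue field\<close>

locale noetherian_local_ring = cring R + noetherian_ring R for R (structure) +
  assumes unique_maximalideal: "\<exists>!M. maximalideal M R"

definition max_ideal :: "('a, 'r) ring_scheme \<Rightarrow> 'a set" where
  "max_ideal R = (THE M. maximalideal M R)"

definition residue_field :: "('a, 'r) ring_scheme \<Rightarrow> 'a set ring" where
  "residue_field R = R Quot (max_ideal R)"

definition char_zero :: "('a, 'r) ring_scheme \<Rightarrow> bool" where
  "char_zero K \<longleftrightarrow> (\<forall>n::nat. n > 0 \<longrightarrow> [n] \<cdot>\<^bsub>K\<^esub> \<one>\<^bsub>K\<^esub> \<noteq> \<zero>\<^bsub>K\<^esub>)"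


section \<open>Injective dimension and Gorenstein rings\<close>

definition module_hom ::
    "('a, 'r) ring_scheme \<Rightarrow> ('a, 'b) module \<Rightarrow> ('a, 'c) module \<Rightarrow> ('b \<Rightarrow> 'c) set" where
  "module_hom R M N = {f \<in> carrier M \<rightarrow> carrier N.
     (\<forall>x\<in>carrier M. \<forall>y\<in>carrier M. f (x \<oplus>\<^bsub>M\<^esub> y) = f x \<oplus>\<^bsub>N\<^esub> f y) \<and>
     (\<forall>a\<in>carrier R. \<forall>x\<in>carrier M. f (a \<odot>\<^bsub>M\<^esub> x) = a \<odot>\<^bsub>N\<^esub> f x)}"

definition module_ker :: "('a, 'b) module \<Rightarrow> ('a, 'c) module \<Rightarrow> ('b \<Rightarrow> 'c) \<Rightarrow> 'b set" where
  "module_ker M N f = {x \<in> carrier M. f x = \<zero>\<^bsub>N\<^esub>}"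

text \<open>The test modules \<open>A\<close>, \<open>B\<close> have their elements in the type of the ring. As this covers
  the inclusions of ideals into the ring, Baer's criterion shows that nothing is lost compared
  to test modules over arbitrary types.\<close>

definition injective_module :: "('a, 'r) ring_scheme \<Rightarrow> ('a, 'm) module \<Rightarrow> bool" where
  "injective_module R E \<longleftrightarrow> module R E \<and>
     (\<forall>(A :: ('a, 'a) module) (B :: ('a, 'a) module) f g.
        module R A \<and> module R B \<and> f \<in> module_hom R A B \<and> inj_on f (carrier A) \<and>
        g \<in> module_hom R A E \<longrightarrow>
        (\<exists>h \<in> module_hom R B E. \<forall>x\<in>carrier A. h (f x) = g x))"

text \<open>Exactness of \<open>0 \<rightarrow> M \<rightarrow> E 0 \<rightarrow> E 1 \<rightarrow> \<dots>\<close>, with first map \<open>e\<close> and further maps \<open>d i\<close>.\<close>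

definition injective_resolution ::
    "('a, 'r) ring_scheme \<Rightarrow> ('a, 'b) module \<Rightarrow> ('b \<Rightarrow> 'm) \<Rightarrow> (nat \<Rightarrow> ('a, 'm) module) \<Rightarrow>
     (nat \<Rightarrow> 'm \<Rightarrow> 'm) \<Rightarrow> bool" where
  "injective_resolution R M e E d \<longleftrightarrow>
     (\<forall>i. injective_module R (E i)) \<and>
     e \<in> module_hom R M (E 0) \<and> inj_on e (carrier M) \<and>
     (\<forall>i. d i \<in> module_hom R (E i) (E (Suc i))) \<and>
     e ` carrier M = module_ker (E 0) (E (Suc 0)) (d 0) \<and>
     (\<forall>i. d i ` carrier (E i) = module_ker (E (Suc i)) (E (Suc (Suc i))) (d (Suc i)))"

text \<open>The type argument \<open>'m\<close> says where the elements of the modules of the resolution live. HOL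
  cannot quantify over it inside the definition; a theorem that assumes the predicate for a
  type variable \<open>'m\<close> covers resolutions over every type.\<close>

definition finite_injective_dim ::
    "'m itself \<Rightarrow> ('a, 'r) ring_scheme \<Rightarrow> ('a, 'b) module \<Rightarrow> bool" where
  "finite_injective_dim _ R M \<longleftrightarrow>
     (\<exists>e (E :: nat \<Rightarrow> ('a, 'm) module) d n.
        injective_resolution R M e E d \<and> (\<forall>i>n. carrier (E i) = {\<zero>\<^bsub>E i\<^esub>}))"

definition regular_module :: "('a, 'r) ring_scheme \<Rightarrow> ('a, 'a) module" where
  "regular_module R = \<lparr>carrier = carrier R, monoid.mult = monoid.mult R, one = one R,
     ring.zero = ring.zero R, add = add R, smult = monoid.mult R\<rparr>"

definition gorenstein_local_ring :: "'m itself \<Rightarrow> ('a, 'r) ring_scheme \<Rightarrow> bool" where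
  "gorenstein_local_ring ty R \<longleftrightarrow>
     noetherian_local_ring R \<and> finite_injective_dim ty R (regular_module R)"


section \<open>Reductions and the core\<close>

definition ideal_power :: "('a, 'r) ring_scheme \<Rightarrow> 'a set \<Rightarrow> nat \<Rightarrow> 'a set" where
  "ideal_power R I n = I [^]\<^bsub>ideals_set R\<^esub> n"

lemma ideal_power_0: "ideal_power R I 0 = carrier R"
  by (simp add: ideal_power_def nat_pow_def ideals_set_def)

lemma ideal_power_Suc: "ideal_power R I (Suc n) = ideal_power R I n \<cdot>\<^bsub>R\<^esub> I"
  by (simp add: ideal_power_def nat_pow_def ideals_set_def)

definition ideal_colon :: "('a, 'r) ring_scheme \<Rightarrow> 'a set \<Rightarrow> 'a set \<Rightarrow> 'a set" where
  "ideal_colon R A B = {x \<in> carrier R. \<forall>b\<in>B. x \<otimes>\<^bsub>R\<^esub> b \<in> A}"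

definition reduction :: "('a, 'r) ring_scheme \<Rightarrow> 'a set \<Rightarrow> 'a set \<Rightarrow> bool" where
  "reduction R J I \<longleftrightarrow> ideal J R \<and> J \<subseteq> I \<and>
     (\<exists>m. ideal_power R I (m + 1) = J \<cdot>\<^bsub>R\<^esub> ideal_power R I m)"

definition minimal_reduction :: "('a, 'r) ring_scheme \<Rightarrow> 'a set \<Rightarrow> 'a set \<Rightarrow> bool" where
  "minimal_reduction R J I \<longleftrightarrow> reduction R J I \<and> (\<forall>K. reduction R K I \<and> K \<subseteq> J \<longrightarrow> K = J)"

definition reduction_number_wrt :: "('a, 'r) ring_scheme \<Rightarrow> 'a set \<Rightarrow> 'a set \<Rightarrow> nat" where
  "reduction_number_wrt R J I =
     (LEAST m. ideal_power R I (m + 1) = J \<cdot>\<^bsub>R\<^esub> ideal_power R I m)"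

definition reduction_number :: "('a, 'r) ring_scheme \<Rightarrow> 'a set \<Rightarrow> nat" where
  "reduction_number R I = Inf {reduction_number_wrt R J I | J. minimal_reduction R J I}"

definition core :: "('a, 'r) ring_scheme \<Rightarrow> 'a set \<Rightarrow> 'a set" where
  "core R I = \<Inter> {J. reduction R J I}"

end

theory Submission
  imports Defs
begin

text \<open>
  Let \<open>I\<close> be a proper ideal; then \<open>I\<close> is primary to the maximal ideal \<open>\<mm>\<close>. In positive depth the
  minimal reductions of \<open>I\<close> are the ideals \<open>(x)\<close> with \<open>x I\<^sup>n = I\<^bsup>n+1\<^esup>\<close> for some \<open>n\<close>, all such
  \<open>x\<close> are nonzerodivisors, and for a given \<open>n\<close> the equation holds for one of them if and only if it
  holds for all, that is, if \<open>n\<close> is at least the reduction number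
  (\<open>minimal_reduction_iff\<close>, \<open>reduction_number_le_iff\<close>). Put \<open>D\<^sub>n(x) = (x\<^bsup>n+1\<^esup>) : I\<^sup>n\<close>.
  The theorem follows from three facts.

  \<^item> \<open>D\<^sub>n(x) \<subseteq> core(I)\<close> if \<open>x I\<^sup>n = I\<^bsup>n+1\<^esup>\<close> (\<open>colon_power_subset_core\<close>). In any case
    \<open>D\<^sub>n(x) \<subseteq> (x)\<close>, so if \<open>D\<^sub>n(x)\<close> is independent of \<open>x\<close>, it is contained in the core.

  \<^item> \<open>core(I) \<subseteq> D\<^sub>n(x)\<close> for all \<open>n\<close> and \<open>x\<close> (\<open>core_subset_colon_power\<close>). Let \<open>a\<close> be in the core and
    \<open>y \<in> I\<close>. Since \<open>x + i y\<close> generates a reduction for infinitely many integers \<open>i\<close>, the quotient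
    \<open>a / x\<close> lies in \<open>(1 + i t) R\<close>, where \<open>t = y / x\<close>. The elements \<open>1 / (1 + i t)\<close>
    for sufficiently many \<open>i\<close> span \<open>R[t]\<close> over \<open>R\<close>, because \<open>t\<close> is integral and the differences of
    the \<open>i\<close> are units. Hence \<open>(a / x) R[t] \<subseteq> R\<close>, that is, \<open>a y\<^sup>k \<in> (x\<^bsup>k+1\<^esup>)\<close> for all \<open>k\<close>. In
    characteristic zero \<open>I\<^sup>n\<close> is generated by \<open>n\<close>-th powers, which gives \<open>a I\<^sup>n \<subseteq> (x\<^bsup>n+1\<^esup>)\<close>.

  \<^item> \<open>D\<^sub>n(x) = core(I)\<close> implies \<open>x I\<^sup>n = I\<^bsup>n+1\<^esup>\<close> (\<open>reduction_if_colon_power_eq_core\<close>). For large \<open>k\<close>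
    one has \<open>D\<^sub>n(x) = D\<^sub>k(x)\<close>, so \<open>x\<^bsup>k-n\<^esup> I\<^sup>n\<close> and \<open>I\<^sup>k\<close> have the same annihilator modulo \<open>x\<^sup>k\<close>.
    In the Artinian Gorenstein ring \<open>R / (x\<^sup>k)\<close> every ideal is the annihilator of its annihilator
    (\<open>colon_duality\<close>), so \<open>x\<^bsup>k-n\<^esup> I\<^sup>n = I\<^sup>k\<close>, and powers of \<open>x\<close> can be cancelled.

  Two ingredients have to be derived from the definitions. The first is the effect of a finite
  injective resolution \<open>E\<close> of \<open>R\<close>. The group \<open>Ext\<close> of \<open>R / A\<close> and \<open>R\<close> is the cohomology of the
  subcomplex of \<open>E\<close> annihilated by \<open>A\<close>. If \<open>Ext\<close> vanishes in all degrees above \<open>i \<ge> 1\<close> and \<open>R / P\<close>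
  embeds into a module whose \<open>Ext\<close> vanishes in degree \<open>i\<close>, then it vanishes for \<open>R / P\<close> in degree
  \<open>i\<close> as well. With \<open>R\<close> as the ambient module this shows that a ring of depth zero would be
  self-injective and hence of dimension zero (\<open>depth_positive\<close>); with \<open>R / (x)\<close> as the ambient
  module, it shows that \<open>Ext\<close> of finite length modules vanishes in degree two
  (\<open>ext_vanish_max_primary\<close>), which is the self-injectivity of \<open>R / (x)\<close>.

  The second is the existence of principal reductions (\<open>ex_principal_reduction\<close>). It rests on a
  pigeonhole argument: the length of \<open>A / a A\<close> is bounded independently of the ideal \<open>A\<close>, so among
  sufficiently many points of the line through \<open>a\<close> in the direction of \<open>b\<close> one generates a
  reduction of \<open>(a, b)\<close> (\<open>ex_line_reduction\<close>).
\<close>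

section \<open>Ideals of a commutative Noetherian ring\<close>

lemma (in ring) ideal_in_carrier: "ideal A R \<Longrightarrow> x \<in> A \<Longrightarrow> x \<in> carrier R"
  by (rule ideal.Icarr)

lemma (in ring) ideal_zero: "ideal A R \<Longrightarrow> \<zero> \<in> A"
  by (simp add: additive_subgroup.zero_closed ideal.axioms(1))

lemma (in ring) ideal_add: "ideal A R \<Longrightarrow> x \<in> A \<Longrightarrow> y \<in> A \<Longrightarrow> x \<oplus> y \<in> A"
  by (simp add: additive_subgroup.a_closed ideal.axioms(1))

lemma (in ring) ideal_minus: "ideal A R \<Longrightarrow> x \<in> A \<Longrightarrow> y \<in> A \<Longrightarrow> x \<ominus> y \<in> A"
  by (simp add: a_minus_def additive_subgroup.a_closed additive_subgroup.a_inv_closed ideal.axioms(1))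

lemma (in ring) ideal_mult_l: "ideal A R \<Longrightarrow> r \<in> carrier R \<Longrightarrow> x \<in> A \<Longrightarrow> r \<otimes> x \<in> A"
  by (rule ideal.I_l_closed)

lemma (in ring) ideal_mult_r: "ideal A R \<Longrightarrow> r \<in> carrier R \<Longrightarrow> x \<in> A \<Longrightarrow> x \<otimes> r \<in> A"
  by (rule ideal.I_r_closed)

lemmas (in ring) ideal_closed =
  ideal_in_carrier ideal_zero ideal_add ideal_minus ideal_mult_l ideal_mult_r

lemma (in ring) ideal_add_cancel:
  assumes "ideal A R" "x \<oplus> y \<in> A" "y \<in> A" "x \<in> carrier R"
  shows "x \<in> A"
proof -
  have y: "y \<in> carrier R"
    using assms ideal_in_carrier by blast
  have "x \<oplus> y \<ominus> y \<in> A"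
    using assms ideal_minus by blast
  moreover have "x \<oplus> y \<ominus> y = x"
    using assms(4) y by algebra
  ultimately show ?thesis by simp
qed

lemma (in cring) idealI_cring:
  assumes "A \<subseteq> carrier R" "\<zero> \<in> A"
    and "\<And>x y. x \<in> A \<Longrightarrow> y \<in> A \<Longrightarrow> x \<oplus> y \<in> A"
    and m: "\<And>r x. r \<in> carrier R \<Longrightarrow> x \<in> A \<Longrightarrow> r \<otimes> x \<in> A"
  shows "ideal A R"
proof (rule idealI)
  show "ring R" by (rule ring_axioms)
  have "\<ominus> x \<in> A" if "x \<in> A" for x
  proof -
    have "(\<ominus> \<one>) \<otimes> x \<in> A" using that m by simp
    moreover have "x \<in> carrier R" using that assms(1) by blast
    ultimately show ?thesis by (simp add: l_minus)
  qed
  then show "subgroup A (add_monoid R)"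
    using assms by (auto intro!: add.subgroupI simp: a_inv_def)
  show "x \<otimes> a \<in> A" if "a \<in> A" "x \<in> carrier R" for a x
    using that m by blast
  show "a \<otimes> x \<in> A" if "a \<in> A" "x \<in> carrier R" for a x
    using that m assms(1) m_comm by (metis subsetD)
qed

lemma (in cring) ideal_eq_carrier_iff: "ideal A R \<Longrightarrow> A = carrier R \<longleftrightarrow> \<one> \<in> A"
  using ideal.one_imp_carrier by fastforce

definition (in ring) adjoin :: "'a set \<Rightarrow> 'a \<Rightarrow> 'a set"
  where "adjoin A s = {u \<oplus> r \<otimes> s | u r. u \<in> A \<and> r \<in> carrier R}"

lemma (in ring) mem_adjoin:
  "v \<in> adjoin A s \<longleftrightarrow> (\<exists>u\<in>A. \<exists>r\<in>carrier R. v = u \<oplus> r \<otimes> s)"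
  by (auto simp: adjoin_def)

lemma (in cring) ideal_adjoin:
  assumes "ideal A R" "s \<in> carrier R" shows "ideal (adjoin A s) R"
proof (rule idealI_cring)
  show "adjoin A s \<subseteq> carrier R"
    using assms ideal_in_carrier by (auto simp: mem_adjoin)
  have "\<zero> = \<zero> \<oplus> \<zero> \<otimes> s" using assms by simp
  then show "\<zero> \<in> adjoin A s"
    using assms ideal_zero unfolding mem_adjoin by blast
  show "x \<oplus> y \<in> adjoin A s" if xy: "x \<in> adjoin A s" "y \<in> adjoin A s" for x y
  proof -
    obtain u r v t where *: "u \<in> A" "r \<in> carrier R" "x = u \<oplus> r \<otimes> s"
      "v \<in> A" "t \<in> carrier R" "y = v \<oplus> t \<otimes> s"
      using xy unfolding mem_adjoin by blast
    have c: "u \<in> carrier R" "v \<in> carrier R" using * assms ideal_in_carrier by blast+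
    have "x \<oplus> y = (u \<oplus> v) \<oplus> (r \<oplus> t) \<otimes> s"
      unfolding *(3,6) using * c assms by algebra
    then show ?thesis using * assms ideal_add unfolding mem_adjoin by blast
  qed
  show "q \<otimes> x \<in> adjoin A s" if q: "q \<in> carrier R" and x: "x \<in> adjoin A s" for q x
  proof -
    obtain u r where *: "u \<in> A" "r \<in> carrier R" "x = u \<oplus> r \<otimes> s"
      using x unfolding mem_adjoin by blast
    have c: "u \<in> carrier R" using * assms ideal_in_carrier by blast
    have "q \<otimes> x = q \<otimes> u \<oplus> (q \<otimes> r) \<otimes> s"
      unfolding *(3) using * c q assms by algebra
    then show ?thesis using * q assms ideal_mult_l unfolding mem_adjoin by blast
  qed
qed

lemma (in cring) subset_adjoin:
  assumes "ideal A R" "s \<in> carrier R" shows "A \<subseteq> adjoin A s"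
proof
  fix u assume u: "u \<in> A"
  then have "u \<in> carrier R" using assms ideal_in_carrier by blast
  then have "u = u \<oplus> \<zero> \<otimes> s" using assms by simp
  then show "u \<in> adjoin A s" using u unfolding mem_adjoin by blast
qed

lemma (in cring) self_mem_adjoin:
  assumes "ideal A R" "s \<in> carrier R" shows "s \<in> adjoin A s"
proof -
  have "s = \<zero> \<oplus> \<one> \<otimes> s" using assms by simp
  then show ?thesis using assms ideal_zero unfolding mem_adjoin by blast
qed

lemma (in cring) adjoin_minimal:
  assumes "ideal B R" "A \<subseteq> B" "s \<in> B" shows "adjoin A s \<subseteq> B"
  using assms by (auto simp: mem_adjoin intro!: ideal_add ideal_mult_l)

definition (in ring) elem_colon :: "'a set \<Rightarrow> 'a \<Rightarrow> 'a set"
  where "elem_colon A c = {r \<in> carrier R. r \<otimes> c \<in> A}"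

lemma (in cring) ideal_elem_colon:
  assumes "ideal A R" "c \<in> carrier R" shows "ideal (elem_colon A c) R"
  using assms
  by (intro idealI_cring) (auto simp: elem_colon_def l_distr m_assoc ideal_closed)

lemma (in cring) subset_elem_colon:
  assumes "ideal A R" "c \<in> carrier R" shows "A \<subseteq> elem_colon A c"
  using assms by (auto simp: elem_colon_def ideal_closed)

locale noetherian_cring = cring + noetherian_ring
begin

lemma ex_maximal_ideal_in:
  assumes "A \<in> F" "\<And>B. B \<in> F \<Longrightarrow> ideal B R"
  obtains M where "M \<in> F" "A \<subseteq> M" "\<And>B. B \<in> F \<Longrightarrow> M \<subseteq> B \<Longrightarrow> B = M"
proof -
  let ?G = "{B\<in>F. A \<subseteq> B}"
  have "\<exists>M\<in>?G. \<forall>B\<in>?G. M \<subseteq> B \<longrightarrow> B = M"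
  proof (rule subset_Zorn)
    fix C assume C: "subset.chain ?G C"
    show "\<exists>V\<in>?G. \<forall>Z\<in>C. Z \<subseteq> V"
    proof (cases "C = {}")
      case True then show ?thesis using assms by blast
    next
      case False
      have "subset.chain {I. ideal I R} C"
        using C assms(2) unfolding pred_on.chain_def by blast
      then have "\<Union>C \<in> C" using ideal_chain_is_trivial False by blast
      then show ?thesis using C by (intro bexI[of _ "\<Union>C"]) (auto simp: pred_on.chain_def)
    qed
  qed
  then obtain M where "M \<in> ?G" "\<forall>B\<in>?G. M \<subseteq> B \<longrightarrow> B = M" by blast
  then show ?thesis using that[of M] by auto
qed

lemma ideal_noetherian_induct [consumes 1, case_names step]:
  assumes "ideal A R"
    and step: "\<And>A. ideal A R \<Longrightarrow> (\<And>B. ideal B R \<Longrightarrow> A \<subset> B \<Longrightarrow> Q B) \<Longrightarrow> Q A"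
  shows "Q A"
proof (rule ccontr)
  assume "\<not> Q A"
  then have A: "A \<in> {B. ideal B R \<and> \<not> Q B}" using assms by simp
  obtain M where M: "M \<in> {B. ideal B R \<and> \<not> Q B}"
    "\<And>B. B \<in> {B. ideal B R \<and> \<not> Q B} \<Longrightarrow> M \<subseteq> B \<Longrightarrow> B = M"
    by (rule ex_maximal_ideal_in[OF A]) auto
  have "Q M"
  proof (rule step)
    show "ideal M R" using M(1) by simp
    show "Q B" if "ideal B R" "M \<subset> B" for B using M(2)[of B] that by auto
  qed
  then show False using M by blast
qed

text \<open>The associated primes of \<open>R / B\<close> are the prime ideals of the form \<open>B : c\<close>; a maximal
  member among all \<open>B : c\<close> with \<open>c \<notin> B\<close> is such a prime.\<close>

lemma ex_prime_elem_colon: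
  assumes B: "ideal B R" "B \<noteq> carrier R"
  obtains c where "c \<in> carrier R" "c \<notin> B" "primeideal (elem_colon B c) R"
proof -
  let ?F = "{elem_colon B c | c. c \<in> carrier R \<and> c \<notin> B}"
  have "\<one> \<notin> B" using B ideal_eq_carrier_iff by blast
  then have "elem_colon B \<one> \<in> ?F" by blast
  then obtain M where M: "M \<in> ?F" "\<And>C. C \<in> ?F \<Longrightarrow> M \<subseteq> C \<Longrightarrow> C = M"
    by (rule ex_maximal_ideal_in) (use B ideal_elem_colon in auto)
  then obtain c where c: "c \<in> carrier R" "c \<notin> B" "M = elem_colon B c" by blast
  have "primeideal M R"
  proof (rule primeidealI)
    show "ideal M R" using c B ideal_elem_colon by simp
    show "cring R" by (rule is_cring)
    have "\<one> \<notin> M" using c by (simp add: elem_colon_def)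
    then show "carrier R \<noteq> M" by blast
    fix a b assume ab: "a \<in> carrier R" "b \<in> carrier R" "a \<otimes> b \<in> M"
    show "a \<in> M \<or> b \<in> M"
    proof (cases "b \<in> M")
      case False
      then have bc: "b \<otimes> c \<notin> B" using ab c by (simp add: elem_colon_def)
      have "M \<subseteq> elem_colon B (b \<otimes> c)"
      proof
        fix r assume "r \<in> M"
        then have r: "r \<in> carrier R" "r \<otimes> c \<in> B" using c by (auto simp: elem_colon_def)
        then have "b \<otimes> (r \<otimes> c) \<in> B" using ab B ideal_mult_l by blast
        then show "r \<in> elem_colon B (b \<otimes> c)"
          using r ab c by (simp add: elem_colon_def m_lcomm)
      qed
      moreover have "elem_colon B (b \<otimes> c) \<in> ?F" using bc ab c by blast
      ultimately have "elem_colon B (b \<otimes> c) = M" using M by blast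
      moreover have "a \<otimes> (b \<otimes> c) \<in> B" using ab c by (simp add: elem_colon_def m_assoc)
      ultimately show ?thesis using ab by (auto simp: elem_colon_def)
    qed simp
  qed
  then show ?thesis using that c by blast
qed

lemma ex_prime_avoiding:
  assumes B: "ideal B R" and S: "S \<subseteq> carrier R" "\<one> \<in> S" "\<And>s t. s \<in> S \<Longrightarrow> t \<in> S \<Longrightarrow> s \<otimes> t \<in> S"
    and dis: "B \<inter> S = {}"
  obtains P where "primeideal P R" "B \<subseteq> P" "P \<inter> S = {}"
proof -
  let ?F = "{C. ideal C R \<and> C \<inter> S = {}}"
  obtain M where M: "M \<in> ?F" "B \<subseteq> M" "\<And>C. C \<in> ?F \<Longrightarrow> M \<subseteq> C \<Longrightarrow> C = M"
    by (rule ex_maximal_ideal_in[of B ?F]) (use B dis in auto)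
  have MI: "ideal M R" using M by simp
  have meet: "\<exists>m\<in>M. \<exists>r\<in>carrier R. m \<oplus> r \<otimes> a \<in> S" if "a \<in> carrier R" "a \<notin> M" for a
  proof -
    have "ideal (adjoin M a) R" "M \<subseteq> adjoin M a" "a \<in> adjoin M a"
      using MI that ideal_adjoin subset_adjoin self_mem_adjoin by auto
    then have "(adjoin M a) \<inter> S \<noteq> {}" using M(3)[of "adjoin M a"] that by auto
    then obtain v where "v \<in> adjoin M a" "v \<in> S" by blast
    then show ?thesis unfolding mem_adjoin by blast
  qed
  have "primeideal M R"
  proof (rule primeidealI)
    show "ideal M R" "cring R" using MI is_cring by auto
    show "carrier R \<noteq> M" using M S by blast
    fix a b assume ab: "a \<in> carrier R" "b \<in> carrier R" "a \<otimes> b \<in> M"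
    show "a \<in> M \<or> b \<in> M"
    proof (rule ccontr)
      assume "\<not> (a \<in> M \<or> b \<in> M)"
      then obtain m r m' r' where *: "m \<in> M" "r \<in> carrier R" "m \<oplus> r \<otimes> a \<in> S"
        "m' \<in> M" "r' \<in> carrier R" "m' \<oplus> r' \<otimes> b \<in> S"
        using meet[of a] meet[of b] ab by blast
      have mc: "m \<in> carrier R" "m' \<in> carrier R" using * MI ideal_in_carrier by blast+
      have "(m \<oplus> r \<otimes> a) \<otimes> (m' \<oplus> r' \<otimes> b) = (m' \<oplus> r' \<otimes> b) \<otimes> m \<oplus> (r \<otimes> a) \<otimes> m' \<oplus> (r \<otimes> r') \<otimes> (a \<otimes> b)"
        using ab * mc by algebra
      also have "\<dots> \<in> M"
        by (rule ideal_add[OF MI ideal_add[OF MI ideal_mult_l[OF MI _ *(1)] ideal_mult_l[OF MI _ *(4)]]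
              ideal_mult_l[OF MI _ ab(3)]]) (use ab * mc in auto)
      finally show False using S(3) * M by blast
    qed
  qed
  then show ?thesis using that M by blast
qed

definition minimal_prime :: "'a set \<Rightarrow> bool"
  where "minimal_prime P \<longleftrightarrow> primeideal P R \<and> (\<forall>Q. primeideal Q R \<and> Q \<subseteq> P \<longrightarrow> Q = P)"

text \<open>A minimal prime \<open>P\<close> is associated: among the annihilators contained in \<open>P\<close> a maximal one,
  \<open>0 : c\<close>, agrees with \<open>0 : s c\<close> for all \<open>s \<notin> P\<close>, and this makes it prime.\<close>

lemma minimal_prime_is_annihilator:
  assumes P: "minimal_prime P"
  obtains c where "c \<in> carrier R" "P = elem_colon {\<zero>} c"
proof -
  let ?F = "{elem_colon {\<zero>} c | c. c \<in> carrier R \<and> elem_colon {\<zero>} c \<subseteq> P}"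
  have Pp: "primeideal P R" using P minimal_prime_def by blast
  have Pi: "ideal P R" using Pp primeideal.axioms by blast
  have "elem_colon {\<zero>} \<one> = {\<zero>}" by (auto simp: elem_colon_def)
  then have "elem_colon {\<zero>} \<one> \<subseteq> P" using ideal_zero[OF Pi] by simp
  then have "elem_colon {\<zero>} \<one> \<in> ?F" using one_closed by blast
  then obtain M where M: "M \<in> ?F" "\<And>C. C \<in> ?F \<Longrightarrow> M \<subseteq> C \<Longrightarrow> C = M"
    by (rule ex_maximal_ideal_in) (use zeroideal ideal_elem_colon in auto)
  then obtain c where c: "c \<in> carrier R" "M = elem_colon {\<zero>} c" "M \<subseteq> P" by blast
  have sub: "M \<subseteq> elem_colon {\<zero>} (s \<otimes> c)" if "s \<in> carrier R" for s
  proof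
    fix x assume "x \<in> M"
    then have "x \<in> carrier R" "x \<otimes> c = \<zero>" using c by (auto simp: elem_colon_def)
    then show "x \<in> elem_colon {\<zero>} (s \<otimes> c)"
      using that c m_lcomm[of x s c] by (simp add: elem_colon_def)
  qed
  have absorb: "b \<in> M" if "s \<in> carrier R" "s \<notin> P" "b \<in> carrier R" "b \<otimes> (s \<otimes> c) = \<zero>" for s b
  proof -
    have "elem_colon {\<zero>} (s \<otimes> c) \<subseteq> P"
    proof
      fix r assume "r \<in> elem_colon {\<zero>} (s \<otimes> c)"
      then have r: "r \<in> carrier R" "(r \<otimes> s) \<otimes> c = \<zero>" using that c by (auto simp: elem_colon_def m_assoc)
      then have "r \<otimes> s \<in> M" using c that by (simp add: elem_colon_def)
      then show "r \<in> P" using c(3) primeideal.I_prime[OF Pp r(1) that(1)] that(2) by blast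
    qed
    then have "elem_colon {\<zero>} (s \<otimes> c) \<in> ?F" using that c by blast
    then have "elem_colon {\<zero>} (s \<otimes> c) = M" using M(2) sub that by blast
    then show ?thesis using that by (auto simp: elem_colon_def)
  qed
  have "primeideal M R"
  proof (rule primeidealI)
    show "ideal M R" using c zeroideal ideal_elem_colon by simp
    show "cring R" by (rule is_cring)
    show "carrier R \<noteq> M" using c primeideal.I_notcarr[OF Pp] ideal_in_carrier[OF Pi] by blast
    fix a b assume ab: "a \<in> carrier R" "b \<in> carrier R" "a \<otimes> b \<in> M"
    then have abc: "a \<otimes> (b \<otimes> c) = \<zero>" using c by (simp add: elem_colon_def m_assoc)
    show "a \<in> M \<or> b \<in> M"
    proof (cases "elem_colon {\<zero>} (b \<otimes> c) \<subseteq> P")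
      case True
      then have "elem_colon {\<zero>} (b \<otimes> c) \<in> ?F" using ab c by blast
      then have "elem_colon {\<zero>} (b \<otimes> c) = M" using M(2) sub ab by blast
      then show ?thesis using abc ab by (auto simp: elem_colon_def)
    next
      case False
      then obtain s where "s \<in> carrier R" "s \<notin> P" "s \<otimes> (b \<otimes> c) = \<zero>" by (auto simp: elem_colon_def)
      then show ?thesis using absorb[of s b] ab c by (simp add: m_lcomm)
    qed
  qed
  then have "M = P" using P c(3) minimal_prime_def by blast
  then show ?thesis using that c by blast
qed

text \<open>In the localization at a minimal prime the only prime is the maximal ideal, so its
  elements are nilpotent there.\<close>

lemma minimal_prime_nilpotent:
  assumes P: "minimal_prime P" and x: "x \<in> P"
  obtains s n where "s \<in> carrier R" "s \<notin> P" "s \<otimes> x [^] (n::nat) = \<zero>"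
proof -
  let ?S = "{s \<otimes> x [^] (n::nat) | s n. s \<in> carrier R \<and> s \<notin> P}"
  have Pp: "primeideal P R" using P minimal_prime_def by blast
  have Pi: "ideal P R" using Pp primeideal.axioms by blast
  have xc: "x \<in> carrier R" using x Pi ideal_in_carrier by blast
  have oneP: "\<one> \<notin> P" using primeideal.I_notcarr[OF Pp] ideal_eq_carrier_iff[OF Pi] by blast
  have "\<zero> \<in> ?S"
  proof (rule ccontr)
    assume *: "\<zero> \<notin> ?S"
    have "\<one> = \<one> \<otimes> x [^] (0::nat)" by simp
    then have one: "\<one> \<in> ?S" using oneP by blast
    have cl: "u \<otimes> v \<in> ?S" if uv: "u \<in> ?S" "v \<in> ?S" for u v
    proof -
      obtain s n t k where st: "s \<in> carrier R" "s \<notin> P" "t \<in> carrier R" "t \<notin> P"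
        "u = s \<otimes> x [^] (n::nat)" "v = t \<otimes> x [^] (k::nat)" using uv by blast
      then have "s \<otimes> t \<notin> P" using primeideal.I_prime[OF Pp] by blast
      moreover have "u \<otimes> v = (s \<otimes> t) \<otimes> x [^] (n + k)"
        using st xc by (simp add: nat_pow_mult[symmetric] m_ac)
      ultimately show ?thesis using st m_closed by blast
    qed
    obtain Q where Q: "primeideal Q R" "Q \<inter> ?S = {}"
      by (rule ex_prime_avoiding[OF zeroideal _ one cl]) (use * xc in auto)
    have "Q \<subseteq> P"
    proof
      fix q assume q: "q \<in> Q"
      then have qc: "q \<in> carrier R" using Q primeideal.axioms(1) ideal_in_carrier by blast
      show "q \<in> P"
      proof (rule ccontr)
        assume "q \<notin> P"
        moreover have "q = q \<otimes> x [^] (0::nat)" using qc by simp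
        ultimately have "q \<in> ?S" using qc by blast
        then show False using Q q by blast
      qed
    qed
    then have "x \<in> Q" using P Q x minimal_prime_def by blast
    moreover have "x = \<one> \<otimes> x [^] (1::nat)" using xc by simp
    then have "x \<in> ?S" using oneP by blast
    ultimately show False using Q by blast
  qed
  then show ?thesis using that by fastforce
qed

end

section \<open>One-dimensional local rings\<close>

lemma (in cring) prime_pow_mem:
  assumes P: "primeideal P R" and x: "x \<in> carrier R" and "x [^] (k::nat) \<in> P"
  shows "x \<in> P"
  using assms(3)
proof (induction k)
  case 0
  have "ideal P R" using P primeideal.axioms(1) by blast
  then show ?case using 0 primeideal.I_notcarr[OF P] ideal_eq_carrier_iff[of P] by auto
next
  case (Suc k)
  then show ?case using primeideal.I_prime[OF P, of "x [^] k" x] x by auto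
qed

sublocale noetherian_local_ring \<subseteq> noetherian_cring ..

context noetherian_local_ring
begin

abbreviation max_id :: "'a set" (\<open>\<mm>\<close>) where "\<mm> \<equiv> max_ideal R"

lemma maximalideal_max: "maximalideal \<mm> R"
  unfolding max_ideal_def by (rule theI'[OF unique_maximalideal])

lemma ideal_max: "ideal \<mm> R"
  using maximalideal_max maximalideal.axioms(1) by blast

lemma prime_max: "primeideal \<mm> R"
  using maximalideal_max maximalideal_prime by blast

lemma one_notin_max: "\<one> \<notin> \<mm>"
  using maximalideal.I_notcarr[OF maximalideal_max] ideal_eq_carrier_iff[OF ideal_max] by blast

lemma proper_ideal_subset_max:
  assumes A: "ideal A R" "\<one> \<notin> A" shows "A \<subseteq> \<mm>"
proof -
  let ?F = "{B. ideal B R \<and> \<one> \<notin> B}"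
  have AF: "A \<in> ?F" using A by simp
  obtain M where M: "M \<in> ?F" "A \<subseteq> M" "\<And>B. B \<in> ?F \<Longrightarrow> M \<subseteq> B \<Longrightarrow> B = M"
    by (rule ex_maximal_ideal_in[OF AF]) auto
  have "maximalideal M R"
  proof (rule maximalidealI)
    show "ideal M R" using M by simp
    show "carrier R \<noteq> M" using M by auto
    show "J = M \<or> J = carrier R" if "ideal J R" "M \<subseteq> J" "J \<subseteq> carrier R" for J
      using that M(3)[of J] ideal_eq_carrier_iff by auto
  qed
  then have "M = \<mm>" using maximalideal_max unique_maximalideal by blast
  then show ?thesis using M by simp
qed

lemma prime_subset_max:
  assumes "primeideal P R" shows "P \<subseteq> \<mm>"
proof -
  have P: "ideal P R" using assms primeideal.axioms(1) by blast
  have "\<one> \<notin> P" using primeideal.I_notcarr[OF assms] ideal_eq_carrier_iff[OF P] by blast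
  then show ?thesis using proper_ideal_subset_max P by blast
qed

lemma Units_iff_notin_max: "r \<in> carrier R \<Longrightarrow> r \<in> Units R \<longleftrightarrow> r \<notin> \<mm>"
proof
  assume r: "r \<in> carrier R" "r \<in> Units R"
  show "r \<notin> \<mm>"
  proof
    assume "r \<in> \<mm>"
    then have "inv r \<otimes> r \<in> \<mm>" using r ideal_max ideal_mult_l Units_inv_closed by blast
    then show False using r one_notin_max by simp
  qed
next
  assume r: "r \<in> carrier R" "r \<notin> \<mm>"
  have "\<one> \<in> PIdl r"
    using r proper_ideal_subset_max[OF cgenideal_ideal] cgenideal_self by blast
  then obtain t where "t \<in> carrier R" "\<one> = t \<otimes> r" unfolding cgenideal_def by blast
  then show "r \<in> Units R" using r m_comm[of t r] unfolding Units_def by auto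
qed

lemma one_minus_Unit:
  assumes "r \<in> \<mm>" shows "\<one> \<ominus> r \<in> Units R"
proof -
  have r: "r \<in> carrier R" using assms ideal_max ideal_in_carrier by blast
  have "\<one> \<ominus> r \<notin> \<mm>"
  proof
    assume "\<one> \<ominus> r \<in> \<mm>"
    then have "\<one> \<ominus> r \<oplus> r \<in> \<mm>" using assms ideal_max ideal_add by blast
    moreover have "\<one> \<ominus> r \<oplus> r = \<one>" using r by algebra
    ultimately show False using one_notin_max by simp
  qed
  then show ?thesis using r Units_iff_notin_max by simp
qed

lemma (in cring) Unit_mult_mem_cancel:
  assumes "ideal A R" "u \<in> Units R" "u \<otimes> x \<in> A" "x \<in> carrier R" shows "x \<in> A"
proof -
  have "inv u \<otimes> (u \<otimes> x) \<in> A" using assms ideal_mult_l Units_inv_closed by blast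
  then show ?thesis using assms by (simp add: m_assoc[symmetric] Units_closed)
qed

lemma eq_zero_if_fixed:
  assumes "x \<in> carrier R" "r \<in> \<mm>" "x = r \<otimes> x" shows "x = \<zero>"
proof -
  have r: "r \<in> carrier R" using assms ideal_max ideal_in_carrier by blast
  have "(\<one> \<ominus> r) \<otimes> x = x \<ominus> r \<otimes> x" using r assms(1) by algebra
  also have "\<dots> = \<zero>" using assms by (simp add: a_minus_def r_neg)
  finally have "(\<one> \<ominus> r) \<otimes> x \<in> {\<zero>}" by simp
  then show ?thesis using Unit_mult_mem_cancel[OF zeroideal one_minus_Unit] assms by blast
qed

definition max_primary :: "'a set \<Rightarrow> bool"
  where "max_primary B \<longleftrightarrow> ideal B R \<and> (\<forall>P. primeideal P R \<and> B \<subseteq> P \<longrightarrow> P = \<mm>)"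

lemma max_primary_ideal: "max_primary B \<Longrightarrow> ideal B R"
  by (simp add: max_primary_def)

lemma max_primary_mono: "max_primary A \<Longrightarrow> A \<subseteq> B \<Longrightarrow> ideal B R \<Longrightarrow> max_primary B"
  unfolding max_primary_def by (meson subset_trans)

lemma max_primary_colon:
  assumes "max_primary B" "\<one> \<notin> B"
  obtains s where "s \<in> carrier R" "s \<notin> B" "elem_colon B s = \<mm>"
proof -
  have B: "ideal B R" using assms max_primary_ideal by blast
  have "B \<noteq> carrier R" using assms(2) by auto
  then obtain s where s: "s \<in> carrier R" "s \<notin> B" "primeideal (elem_colon B s) R"
    using ex_prime_elem_colon[OF B] by metis
  then have "elem_colon B s = \<mm>"
    using assms subset_elem_colon[OF B] unfolding max_primary_def by blast
  then show ?thesis using that s by blast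
qed

end

locale one_dim_local_ring = noetherian_local_ring +
  assumes krull_dim_one: "krull_dim R = 1"
begin

lemma non_max_prime_minimal:
  assumes P: "primeideal P R" "P \<noteq> \<mm>" shows "minimal_prime P"
  unfolding minimal_prime_def
proof (intro conjI allI impI)
  fix Q assume Q: "primeideal Q R \<and> Q \<subseteq> P"
  show "Q = P"
  proof (rule ccontr)
    assume ne: "Q \<noteq> P"
    have Pm: "P \<subseteq> \<mm>" using prime_subset_max P by blast
    define p where "p i = (if i = 0 then Q else if i = 1 then P else \<mm>)" for i :: nat
    have "prime_chain R p 2"
      unfolding prime_chain_def p_def using P Q ne Pm prime_max by (auto simp: less_Suc_eq numeral_2_eq_2)
    then have "enat 2 \<le> krull_dim R"
      unfolding krull_dim_def by (intro Sup_upper) blast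
    then show False by (simp add: krull_dim_one one_enat_def)
  qed
qed (rule P)

lemma ex_non_max_prime: "\<exists>P. primeideal P R \<and> P \<noteq> \<mm>"
proof (rule ccontr)
  assume *: "\<nexists>P. primeideal P R \<and> P \<noteq> \<mm>"
  have "n = 0" if "prime_chain R p n" for p n
  proof (rule ccontr)
    assume "n \<noteq> 0"
    then have "primeideal (p 0) R" "primeideal (p 1) R" "p 0 \<subset> p 1"
      using that by (auto simp: prime_chain_def)
    then show False using * by blast
  qed
  then have "krull_dim R \<le> 0"
    unfolding krull_dim_def by (intro Sup_least) (auto simp: zero_enat_def)
  then show False by (simp add: krull_dim_one)
qed

lemma max_primary_if_height_pos:
  assumes I: "ideal I R" "ideal_height R I > 0"
  shows "max_primary I"
  unfolding max_primary_def
proof (intro conjI allI impI I)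
  fix P assume P: "primeideal P R \<and> I \<subseteq> P"
  have "ideal_height R I \<le> prime_height R P"
    unfolding ideal_height_def using P by (intro Inf_lower) blast
  then have "prime_height R P > 0" by (rule less_le_trans[OF I(2)])
  then obtain e where e: "e \<in> {enat n | n. \<exists>p. prime_chain R p n \<and> p n = P}" "0 < e"
    unfolding prime_height_def less_Sup_iff by blast
  then obtain n p where n: "prime_chain R p n" "p n = P" "n > 0"
    by (auto simp: zero_enat_def)
  then obtain k where k: "n = Suc k" by (cases n) auto
  have "primeideal (p k) R" "p k \<subset> P"
    using n(1,2) unfolding prime_chain_def k by auto
  then have "\<not> minimal_prime P" unfolding minimal_prime_def by blast
  then show "P = \<mm>" using non_max_prime_minimal P by blast
qed

text \<open>If \<open>x\<close> lies in a prime \<open>P \<noteq> \<mm>\<close>, some \<open>t \<in> I - P\<close> kills a power of \<open>x\<close>, and every prime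
  containing \<open>x\<^sup>k + t\<close> contains both \<open>t\<close> and \<open>x\<close>. So \<open>x\<close> can be improved until its
  radical is as large as possible.\<close>

lemma ex_parameter:
  assumes I: "max_primary I" "\<one> \<notin> I"
  obtains x where "x \<in> I" "max_primary (PIdl x)"
proof -
  have II: "ideal I R" using I max_primary_ideal by blast
  have Im: "I \<subseteq> \<mm>" using II I proper_ideal_subset_max by blast
  define rad where "rad x = \<Inter>{P. primeideal P R \<and> x \<in> P}" for x
  have rad_ideal: "ideal (rad x) R" if "x \<in> I" for x
    unfolding rad_def
    by (rule i_Intersect) (use that Im prime_max primeideal.axioms(1) in blast)+
  have in_F: "rad \<zero> \<in> {rad x | x. x \<in> I}" using ideal_zero[OF II] by blast
  obtain M where M: "M \<in> {rad x | x. x \<in> I}"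
    "\<And>B. B \<in> {rad x | x. x \<in> I} \<Longrightarrow> M \<subseteq> B \<Longrightarrow> B = M"
    by (rule ex_maximal_ideal_in[OF in_F]) (use rad_ideal in auto)
  then obtain x where x: "x \<in> I" "M = rad x" by blast
  have xc: "x \<in> carrier R" using x II ideal_in_carrier by blast
  have "P = \<mm>" if P: "primeideal P R" "PIdl x \<subseteq> P" for P
  proof (rule ccontr)
    assume "P \<noteq> \<mm>"
    then have mp: "minimal_prime P" using P non_max_prime_minimal by blast
    have Pi: "ideal P R" using P primeideal.axioms(1) by blast
    have xP: "x \<in> P" using P cgenideal_self xc by blast
    obtain s n where s: "s \<in> carrier R" "s \<notin> P" "s \<otimes> x [^] (n::nat) = \<zero>"
      by (rule minimal_prime_nilpotent[OF mp xP])
    obtain s' where s': "s' \<in> I" "s' \<notin> P"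
      using I \<open>P \<noteq> \<mm>\<close> P unfolding max_primary_def by blast
    have s'c: "s' \<in> carrier R" using s' II ideal_in_carrier by blast
    define t where "t = s \<otimes> s'"
    define x' where "x' = x [^] Suc n \<oplus> t"
    have tP: "t \<notin> P"
      using s s' s'c primeideal.I_prime[OF P(1), of s s'] unfolding t_def by blast
    have tI: "t \<in> I" unfolding t_def by (rule ideal_mult_l[OF II s(1) s'(1)])
    note t = ideal_in_carrier[OF II tI] tI tP
    have "t \<otimes> x [^] Suc n = (s \<otimes> x [^] n) \<otimes> (s' \<otimes> x)"
      unfolding t_def nat_pow_Suc using s(1) s'c xc nat_pow_closed[OF xc, of n] by algebra
    also have "\<dots> = \<zero>" unfolding s(3) using s'c xc by simp
    finally have tx: "t \<otimes> x [^] Suc n = \<zero>" .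
    have x'I: "x' \<in> I"
      unfolding x'_def using t x II xc by (auto intro!: ideal_add ideal_mult_l)
    have key: "x \<in> Q \<and> t \<in> Q" if Q: "primeideal Q R" "x' \<in> Q" for Q
    proof -
      have Qi: "ideal Q R" using Q primeideal.axioms(1) by blast
      have "t \<otimes> x' = t \<otimes> t"
        unfolding x'_def using t xc tx by (simp add: r_distr)
      moreover have "t \<otimes> x' \<in> Q" using Q Qi t ideal_mult_l by blast
      ultimately have tQ: "t \<in> Q" using primeideal.I_prime[OF Q(1)] t by auto
      then have xQ: "x [^] Suc n \<in> Q"
        using ideal_add_cancel[OF Qi _ tQ] Q xc unfolding x'_def by blast
      then have "x \<in> Q" using prime_pow_mem[OF Q(1) xc] by blast
      then show ?thesis using tQ by blast
    qed
    have "M \<subseteq> rad x'" unfolding x(2) rad_def using key by blast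
    then have "rad x' = M" using M(2) x'I by blast
    moreover have "t \<in> rad x'" using key t unfolding rad_def by blast
    moreover have "rad x \<subseteq> P" using P xP unfolding rad_def by blast
    ultimately show False using x t by blast
  qed
  then have "max_primary (PIdl x)"
    using cgenideal_ideal xc unfolding max_primary_def by blast
  then show ?thesis using that x by blast
qed

end

definition (in ring) nonzerodivisor :: "'a \<Rightarrow> bool"
  where "nonzerodivisor x \<longleftrightarrow> x \<in> carrier R \<and> (\<forall>z\<in>carrier R. x \<otimes> z = \<zero> \<longrightarrow> z = \<zero>)"

lemma (in ring) nonzerodivisor_closed: "nonzerodivisor x \<Longrightarrow> x \<in> carrier R"
  by (simp add: nonzerodivisor_def)

lemma (in cring) nonzerodivisor_cancel:
  assumes "nonzerodivisor x" "x \<otimes> a = x \<otimes> b" "a \<in> carrier R" "b \<in> carrier R"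
  shows "a = b"
proof -
  have x: "x \<in> carrier R" using assms nonzerodivisor_def by blast
  have "x \<otimes> (a \<ominus> b) = x \<otimes> a \<ominus> x \<otimes> b" using x assms(3,4) by algebra
  also have "\<dots> = \<zero>" using x assms by (simp add: r_right_minus_eq)
  finally have "a \<ominus> b = \<zero>" using assms nonzerodivisor_def by simp
  then show ?thesis using assms by simp
qed

lemma (in cring) nonzerodivisor_mult:
  assumes "nonzerodivisor x" "nonzerodivisor y" shows "nonzerodivisor (x \<otimes> y)"
  unfolding nonzerodivisor_def
proof (intro conjI ballI impI)
  have c: "x \<in> carrier R" "y \<in> carrier R" using assms nonzerodivisor_closed by auto
  then show "x \<otimes> y \<in> carrier R" by simp
  fix z assume z: "z \<in> carrier R" "x \<otimes> y \<otimes> z = \<zero>"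
  then have "x \<otimes> (y \<otimes> z) = \<zero>" using c by (simp add: m_assoc)
  then have "y \<otimes> z = \<zero>" using assms(1) c z unfolding nonzerodivisor_def by blast
  then show "z = \<zero>" using assms(2) z unfolding nonzerodivisor_def by blast
qed

lemma (in cring) nonzerodivisor_pow:
  "nonzerodivisor x \<Longrightarrow> nonzerodivisor (x [^] (n::nat))"
proof (induction n)
  case 0
  show ?case by (simp add: nonzerodivisor_def)
next
  case (Suc n)
  then show ?case using nonzerodivisor_mult by simp
qed

lemma (in cring) nonzerodivisor_dvd:
  assumes "nonzerodivisor (x \<otimes> y)" "x \<in> carrier R" "y \<in> carrier R"
  shows "nonzerodivisor y"
  unfolding nonzerodivisor_def
proof (intro conjI ballI impI)
  fix z assume z: "z \<in> carrier R" "y \<otimes> z = \<zero>"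
  then have "x \<otimes> y \<otimes> z = \<zero>" using assms by (simp add: m_assoc)
  then show "z = \<zero>" using assms z unfolding nonzerodivisor_def by blast
qed (rule assms)

text \<open>Positive depth is stated as the absence of nonzero elements annihilated by \<open>\<mm>\<close>; in dimension one
  this is the Cohen--Macaulay property.\<close>

locale one_dim_local_CM_ring = one_dim_local_ring +
  assumes depth_pos: "z \<in> carrier R \<Longrightarrow> (\<And>r. r \<in> max_ideal R \<Longrightarrow> r \<otimes> z = \<zero>) \<Longrightarrow> z = \<zero>"
begin

text \<open>If \<open>x z = 0\<close>, the annihilator of \<open>z\<close> contains a parameter, so some multiple of \<open>z\<close> is
  annihilated by \<open>\<mm>\<close>.\<close>

lemma parameter_nonzerodivisor:
  assumes x: "x \<in> carrier R" and p: "max_primary (PIdl x)"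
  shows "nonzerodivisor x"
  unfolding nonzerodivisor_def
proof (intro conjI ballI impI x)
  fix z assume z: "z \<in> carrier R" "x \<otimes> z = \<zero>"
  show "z = \<zero>"
  proof (rule ccontr)
    assume nz: "z \<noteq> \<zero>"
    let ?B = "elem_colon {\<zero>} z"
    have B: "ideal ?B R" using zeroideal z ideal_elem_colon by blast
    have "PIdl x \<subseteq> ?B"
      using cgenideal_minimal[OF B] x z by (simp add: elem_colon_def)
    then have "max_primary ?B" using p B max_primary_mono by blast
    moreover have "\<one> \<notin> ?B" using nz z by (simp add: elem_colon_def)
    ultimately obtain s where s: "s \<in> carrier R" "s \<notin> ?B" "elem_colon ?B s = \<mm>"
      by (rule max_primary_colon)
    have "r \<otimes> (s \<otimes> z) = \<zero>" if "r \<in> \<mm>" for r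
    proof -
      have "r \<in> elem_colon ?B s" using that s(3) by simp
      then show ?thesis using s z by (auto simp: elem_colon_def m_assoc)
    qed
    then have "s \<otimes> z = \<zero>" using depth_pos s z by blast
    then show False using s by (simp add: elem_colon_def)
  qed
qed

end

section \<open>Vanishing of Ext along an injective resolution\<close>

lemma (in module) smult_minus_distr:
  assumes "a \<in> carrier R" "x \<in> carrier M" "y \<in> carrier M"
  shows "a \<odot>\<^bsub>M\<^esub> (x \<ominus>\<^bsub>M\<^esub> y) = a \<odot>\<^bsub>M\<^esub> x \<ominus>\<^bsub>M\<^esub> a \<odot>\<^bsub>M\<^esub> y"
  using assms by (simp add: a_minus_def smult_r_distr smult_r_minus)

lemma (in module) smult_minus_ldistr:
  assumes "a \<in> carrier R" "b \<in> carrier R" "x \<in> carrier M"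
  shows "(a \<ominus> b) \<odot>\<^bsub>M\<^esub> x = a \<odot>\<^bsub>M\<^esub> x \<ominus>\<^bsub>M\<^esub> b \<odot>\<^bsub>M\<^esub> x"
  using assms by (simp add: a_minus_def smult_l_distr smult_l_minus)

lemma (in module) smult_commute:
  assumes "a \<in> carrier R" "b \<in> carrier R" "x \<in> carrier M"
  shows "a \<odot>\<^bsub>M\<^esub> (b \<odot>\<^bsub>M\<^esub> x) = b \<odot>\<^bsub>M\<^esub> (a \<odot>\<^bsub>M\<^esub> x)"
  using assms by (simp add: smult_assoc1[symmetric] R.m_comm)

lemma (in abelian_group) minus_self [simp]: "x \<in> carrier G \<Longrightarrow> x \<ominus> x = \<zero>"
  by (simp add: minus_eq r_neg)

lemma (in abelian_group) minus_eq_zeroD: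
  assumes "x \<ominus> y = \<zero>" "x \<in> carrier G" "y \<in> carrier G" shows "x = y"
proof -
  have "x = (x \<ominus> y) \<oplus> y" using assms(2,3) by (simp add: minus_eq a_assoc l_neg)
  then show ?thesis using assms by simp
qed

lemma (in abelian_group) minus_zero_right [simp]: "x \<in> carrier G \<Longrightarrow> x \<ominus> \<zero> = x"
  by (simp add: minus_eq)

lemma module_homD:
  assumes "f \<in> module_hom R M N"
  shows module_hom_closed: "x \<in> carrier M \<Longrightarrow> f x \<in> carrier N"
    and module_hom_add: "x \<in> carrier M \<Longrightarrow> y \<in> carrier M \<Longrightarrow> f (x \<oplus>\<^bsub>M\<^esub> y) = f x \<oplus>\<^bsub>N\<^esub> f y"
    and module_hom_smult: "a \<in> carrier R \<Longrightarrow> x \<in> carrier M \<Longrightarrow> f (a \<odot>\<^bsub>M\<^esub> x) = a \<odot>\<^bsub>N\<^esub> f x"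
  using assms by (auto simp: module_hom_def)

lemma module_hom_zero:
  assumes "f \<in> module_hom R M N" "module R M" "module R N"
  shows "f \<zero>\<^bsub>M\<^esub> = \<zero>\<^bsub>N\<^esub>"
proof -
  interpret M: module R M by fact
  interpret N: module R N by fact
  have "f (\<zero>\<^bsub>R\<^esub> \<odot>\<^bsub>M\<^esub> \<zero>\<^bsub>M\<^esub>) = \<zero>\<^bsub>R\<^esub> \<odot>\<^bsub>N\<^esub> f \<zero>\<^bsub>M\<^esub>"
    using assms(1) by (intro module_hom_smult) auto
  then show ?thesis using module_hom_closed[OF assms(1)] by simp
qed

lemma module_hom_minus:
  assumes "f \<in> module_hom R M N" "module R M" "module R N" "x \<in> carrier M" "y \<in> carrier M"
  shows "f (x \<ominus>\<^bsub>M\<^esub> y) = f x \<ominus>\<^bsub>N\<^esub> f y"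
proof -
  interpret M: module R M by fact
  interpret N: module R N by fact
  have c: "f x \<in> carrier N" "f y \<in> carrier N" using assms module_hom_closed by metis+
  have "f (\<ominus>\<^bsub>R\<^esub> \<one>\<^bsub>R\<^esub> \<odot>\<^bsub>M\<^esub> y) = \<ominus>\<^bsub>R\<^esub> \<one>\<^bsub>R\<^esub> \<odot>\<^bsub>N\<^esub> f y"
    using assms by (intro module_hom_smult) auto
  then have "f (\<ominus>\<^bsub>M\<^esub> y) = \<ominus>\<^bsub>N\<^esub> f y"
    using assms c by (simp add: M.smult_l_minus N.smult_l_minus)
  then show ?thesis
    using assms c module_hom_add[OF assms(1), of x "\<ominus>\<^bsub>M\<^esub> y"] by (simp add: a_minus_def)
qed

lemma (in cring) regular_module: "module R (regular_module R)"
proof (rule moduleI)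
  show "cring R" by (rule is_cring)
  show "abelian_group (regular_module R)"
    by (rule abelian_groupI)
      (auto simp: regular_module_def a_ac intro!: bexI[of _ "\<ominus> _"] l_neg)
qed (auto simp: regular_module_def l_distr r_distr m_assoc)

lemma (in cring) submodule_regular:
  assumes J: "ideal J R" shows "submodule J R (regular_module R)"
proof (rule module.submoduleI[OF regular_module])
  show "J \<subseteq> carrier (regular_module R)"
    using ideal_in_carrier[OF J] by (auto simp: regular_module_def)
  show "\<zero>\<^bsub>regular_module R\<^esub> \<in> J" using ideal_zero[OF J] by (simp add: regular_module_def)
  have inv_eq: "\<ominus>\<^bsub>regular_module R\<^esub> a = \<ominus> a" for a
    by (simp add: regular_module_def a_inv_def m_inv_def)
  show "\<ominus>\<^bsub>regular_module R\<^esub> a \<in> J" if "a \<in> J" for a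
    unfolding inv_eq using J that
    by (simp add: additive_subgroup.a_inv_closed ideal.axioms(1))
  show "a \<oplus>\<^bsub>regular_module R\<^esub> b \<in> J" if "a \<in> J" "b \<in> J" for a b
    using ideal_add[OF J that] by (simp add: regular_module_def)
  show "a \<odot>\<^bsub>regular_module R\<^esub> x \<in> J" if "a \<in> carrier R" "x \<in> J" for a x
    using ideal_mult_l[OF J that] by (simp add: regular_module_def)
qed

text \<open>The only use of injectivity: a homomorphism defined on \<open>J + (s)\<close> that vanishes on \<open>J\<close> is
  given by an element annihilated by \<open>J\<close>.\<close>

lemma (in cring) injective_module_extend:
  assumes M: "injective_module R M" and J: "ideal J R" and s: "s \<in> carrier R"
    and v: "v \<in> carrier M"
    and wd: "\<And>r. r \<in> carrier R \<Longrightarrow> r \<otimes> s \<in> J \<Longrightarrow> r \<odot>\<^bsub>M\<^esub> v = \<zero>\<^bsub>M\<^esub>"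
  obtains f where "f \<in> carrier M" "\<And>u. u \<in> J \<Longrightarrow> u \<odot>\<^bsub>M\<^esub> f = \<zero>\<^bsub>M\<^esub>" "s \<odot>\<^bsub>M\<^esub> f = v"
proof -
  interpret M: module R M using M by (simp add: injective_module_def)
  let ?A = "(regular_module R)\<lparr>carrier := adjoin J s\<rparr>"
  have modA: "module R ?A"
    by (rule submodule.submodule_is_module[OF submodule_regular[OF ideal_adjoin[OF J s]] regular_module])
  have id_hom: "id \<in> module_hom R ?A (regular_module R)"
    using ideal_in_carrier[OF ideal_adjoin[OF J s]]
    by (auto simp: module_hom_def regular_module_def)
  have Jc: "u \<in> carrier R" if "u \<in> J" for u using ideal_in_carrier[OF J that] .
  define g where "g w = (THE z. \<exists>u\<in>J. \<exists>r\<in>carrier R. w = u \<oplus> r \<otimes> s \<and> z = r \<odot>\<^bsub>M\<^esub> v)" for w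
  have g: "g (u \<oplus> r \<otimes> s) = r \<odot>\<^bsub>M\<^esub> v" if u: "u \<in> J" and r: "r \<in> carrier R" for u r
    unfolding g_def
  proof (rule the_equality)
    show "\<exists>u'\<in>J. \<exists>r'\<in>carrier R. u \<oplus> r \<otimes> s = u' \<oplus> r' \<otimes> s \<and> r \<odot>\<^bsub>M\<^esub> v = r' \<odot>\<^bsub>M\<^esub> v"
      using u r by blast
    fix z assume "\<exists>u'\<in>J. \<exists>r'\<in>carrier R. u \<oplus> r \<otimes> s = u' \<oplus> r' \<otimes> s \<and> z = r' \<odot>\<^bsub>M\<^esub> v"
    then obtain u' r' where *: "u' \<in> J" "r' \<in> carrier R" "u \<oplus> r \<otimes> s = u' \<oplus> r' \<otimes> s" "z = r' \<odot>\<^bsub>M\<^esub> v"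
      by blast
    have "(r \<ominus> r') \<otimes> s = (u \<oplus> r \<otimes> s) \<ominus> (u \<oplus> r' \<otimes> s)"
      using u r *(1,2) s Jc by algebra
    also have "\<dots> = (u' \<oplus> r' \<otimes> s) \<ominus> (u \<oplus> r' \<otimes> s)" using *(3) by simp
    also have "\<dots> = u' \<ominus> u"
      using u r *(1,2) s Jc by algebra
    finally have "(r \<ominus> r') \<otimes> s \<in> J" using ideal_minus[OF J *(1) u] by simp
    then have "(r \<ominus> r') \<odot>\<^bsub>M\<^esub> v = \<zero>\<^bsub>M\<^esub>" using wd r * by simp
    then show "z = r \<odot>\<^bsub>M\<^esub> v"
      using * r v M.minus_eq_zeroD[of "r \<odot>\<^bsub>M\<^esub> v" "r' \<odot>\<^bsub>M\<^esub> v"] by (simp add: M.smult_minus_ldistr)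
  qed
  have g_hom: "g \<in> module_hom R ?A M"
    unfolding module_hom_def
  proof (intro CollectI conjI ballI Pi_I)
    fix x assume "x \<in> carrier ?A"
    then obtain u r where x: "u \<in> J" "r \<in> carrier R" "x = u \<oplus> r \<otimes> s" by (auto simp: mem_adjoin)
    show "g x \<in> carrier M" using x g v by simp
    show "g (a \<odot>\<^bsub>?A\<^esub> x) = a \<odot>\<^bsub>M\<^esub> g x" if a: "a \<in> carrier R" for a
    proof -
      have "a \<otimes> x = a \<otimes> u \<oplus> (a \<otimes> r) \<otimes> s"
        unfolding x(3) using x(1,2) a s Jc by algebra
      then have "g (a \<otimes> x) = (a \<otimes> r) \<odot>\<^bsub>M\<^esub> v" using g ideal_mult_l[OF J a x(1)] a x by simp
      then show ?thesis using g x a v by (simp add: regular_module_def M.smult_assoc1)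
    qed
    fix y assume "y \<in> carrier ?A"
    then obtain u' r' where y: "u' \<in> J" "r' \<in> carrier R" "y = u' \<oplus> r' \<otimes> s" by (auto simp: mem_adjoin)
    have "x \<oplus> y = (u \<oplus> u') \<oplus> (r \<oplus> r') \<otimes> s"
      unfolding x(3) y(3) using x(1,2) y(1,2) s Jc by algebra
    then have "g (x \<oplus> y) = (r \<oplus> r') \<odot>\<^bsub>M\<^esub> v" using g ideal_add[OF J x(1) y(1)] x y by simp
    then show "g (x \<oplus>\<^bsub>?A\<^esub> y) = g x \<oplus>\<^bsub>M\<^esub> g y"
      using g x y v by (simp add: regular_module_def M.smult_l_distr)
  qed
  have "\<exists>h\<in>module_hom R (regular_module R) M. \<forall>x\<in>carrier ?A. h (id x) = g x"
  proof -
    have "\<forall>(A :: ('a, 'a) module) (B :: ('a, 'a) module) f g.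
        module R A \<and> module R B \<and> f \<in> module_hom R A B \<and> inj_on f (carrier A) \<and>
        g \<in> module_hom R A M \<longrightarrow> (\<exists>h \<in> module_hom R B M. \<forall>x\<in>carrier A. h (f x) = g x)"
      using M unfolding injective_module_def by (rule conjunct2)
    from this[rule_format, of ?A "regular_module R" id g] show ?thesis
      using modA regular_module id_hom g_hom by simp
  qed
  then obtain h where h: "h \<in> module_hom R (regular_module R) M" "\<And>x. x \<in> adjoin J s \<Longrightarrow> h x = g x"
    by auto
  have h1: "h \<one> \<in> carrier M" using module_hom_closed[OF h(1), of \<one>] by (simp add: regular_module_def)
  have act: "r \<odot>\<^bsub>M\<^esub> h \<one> = h r" if "r \<in> carrier R" for r
    using module_hom_smult[OF h(1) that, of \<one>] that by (simp add: regular_module_def)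
  show ?thesis
  proof (rule that[OF h1])
    fix u assume u: "u \<in> J"
    then have "u = u \<oplus> \<zero> \<otimes> s" using s Jc by simp
    then have "g u = \<zero> \<odot>\<^bsub>M\<^esub> v" using g[OF u zero_closed] by simp
    then show "u \<odot>\<^bsub>M\<^esub> h \<one> = \<zero>\<^bsub>M\<^esub>"
      using act Jc u h(2) subset_adjoin[OF J s] v by auto
  next
    have "s = \<zero> \<oplus> \<one> \<otimes> s" using s by simp
    then have "g s = \<one> \<odot>\<^bsub>M\<^esub> v" using g[OF ideal_zero[OF J] one_closed] by simp
    then show "s \<odot>\<^bsub>M\<^esub> h \<one> = v"
      using act s h(2) self_mem_adjoin[OF J s] v by auto
  qed
qed

locale bounded_injective_resolution = noetherian_cring +
  fixes e :: "'a \<Rightarrow> 'm" and E :: "nat \<Rightarrow> ('a, 'm) module" and d :: "nat \<Rightarrow> 'm \<Rightarrow> 'm" and N :: nat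
  assumes resolution: "injective_resolution R (regular_module R) e E d"
    and bounded: "i > N \<Longrightarrow> carrier (E i) = {\<zero>\<^bsub>E i\<^esub>}"
begin

lemma E_injective: "injective_module R (E i)"
  using resolution by (simp add: injective_resolution_def)

sublocale E: module R "E i" for i
  using E_injective by (simp add: injective_module_def)

lemma d_hom: "d i \<in> module_hom R (E i) (E (Suc i))"
  using resolution by (simp add: injective_resolution_def)

lemma d_closed [simp]: "v \<in> carrier (E i) \<Longrightarrow> d i v \<in> carrier (E (Suc i))"
  by (rule module_hom_closed[OF d_hom])

lemma d_smult: "a \<in> carrier R \<Longrightarrow> v \<in> carrier (E i) \<Longrightarrow> d i (a \<odot>\<^bsub>E i\<^esub> v) = a \<odot>\<^bsub>E (Suc i)\<^esub> d i v"
  by (rule module_hom_smult[OF d_hom])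

lemma d_zero [simp]: "d i \<zero>\<^bsub>E i\<^esub> = \<zero>\<^bsub>E (Suc i)\<^esub>"
  by (rule module_hom_zero[OF d_hom]) (rule E.module_axioms)+

lemma d_minus:
  "v \<in> carrier (E i) \<Longrightarrow> w \<in> carrier (E i) \<Longrightarrow> d i (v \<ominus>\<^bsub>E i\<^esub> w) = d i v \<ominus>\<^bsub>E (Suc i)\<^esub> d i w"
  by (rule module_hom_minus[OF d_hom]) (rule E.module_axioms | assumption)+

lemma d_add:
  "v \<in> carrier (E i) \<Longrightarrow> w \<in> carrier (E i) \<Longrightarrow> d i (v \<oplus>\<^bsub>E i\<^esub> w) = d i v \<oplus>\<^bsub>E (Suc i)\<^esub> d i w"
  by (rule module_hom_add[OF d_hom])

lemma exact:
  assumes "v \<in> carrier (E (Suc i))" "d (Suc i) v = \<zero>\<^bsub>E (Suc (Suc i))\<^esub>"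
  obtains w where "w \<in> carrier (E i)" "d i w = v"
proof -
  have "d i ` carrier (E i) = module_ker (E (Suc i)) (E (Suc (Suc i))) (d (Suc i))"
    using resolution by (simp add: injective_resolution_def)
  moreover have "v \<in> module_ker (E (Suc i)) (E (Suc (Suc i))) (d (Suc i))"
    using assms by (simp add: module_ker_def)
  ultimately have "v \<in> d i ` carrier (E i)" by simp
  then show ?thesis using that by blast
qed

lemma d_d [simp]:
  assumes "v \<in> carrier (E i)" shows "d (Suc i) (d i v) = \<zero>\<^bsub>E (Suc (Suc i))\<^esub>"
proof -
  have "d i ` carrier (E i) = module_ker (E (Suc i)) (E (Suc (Suc i))) (d (Suc i))"
    using resolution by (simp add: injective_resolution_def)
  then show ?thesis using assms unfolding module_ker_def by blast
qed

lemma e_hom: "e \<in> module_hom R (regular_module R) (E 0)"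
  using resolution by (simp add: injective_resolution_def)

lemma e_closed [simp]: "r \<in> carrier R \<Longrightarrow> e r \<in> carrier (E 0)"
  using module_hom_closed[OF e_hom] by (simp add: regular_module_def)

lemma e_mult: "a \<in> carrier R \<Longrightarrow> r \<in> carrier R \<Longrightarrow> e (a \<otimes> r) = a \<odot>\<^bsub>E 0\<^esub> e r"
  using module_hom_smult[OF e_hom] by (simp add: regular_module_def)

lemma e_zero [simp]: "e \<zero> = \<zero>\<^bsub>E 0\<^esub>"
  using module_hom_zero[OF e_hom regular_module E.module_axioms] by (simp add: regular_module_def)

lemma e_inj: "e r = e t \<Longrightarrow> r \<in> carrier R \<Longrightarrow> t \<in> carrier R \<Longrightarrow> r = t"
  using resolution by (auto simp: injective_resolution_def regular_module_def inj_on_def)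

lemma e_image: "e ` carrier R = module_ker (E 0) (E (Suc 0)) (d 0)"
  using resolution by (simp add: injective_resolution_def regular_module_def)

lemma exact_0:
  assumes "v \<in> carrier (E 0)" "d 0 v = \<zero>\<^bsub>E (Suc 0)\<^esub>" obtains r where "r \<in> carrier R" "v = e r"
  using e_image assms unfolding module_ker_def by blast

lemma d_e [simp]: "r \<in> carrier R \<Longrightarrow> d 0 (e r) = \<zero>\<^bsub>E (Suc 0)\<^esub>"
  using e_image unfolding module_ker_def by blast

definition annihilated :: "nat \<Rightarrow> 'a set \<Rightarrow> 'm set"
  where "annihilated i A = {v \<in> carrier (E i). \<forall>a\<in>A. a \<odot>\<^bsub>E i\<^esub> v = \<zero>\<^bsub>E i\<^esub>}"

lemma annihilatedI:
  "v \<in> carrier (E i) \<Longrightarrow> (\<And>a. a \<in> A \<Longrightarrow> a \<odot>\<^bsub>E i\<^esub> v = \<zero>\<^bsub>E i\<^esub>) \<Longrightarrow> v \<in> annihilated i A"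
  by (simp add: annihilated_def)

lemma annihilated_closed: "v \<in> annihilated i A \<Longrightarrow> v \<in> carrier (E i)"
  by (simp add: annihilated_def)

lemma annihilatedD: "v \<in> annihilated i A \<Longrightarrow> a \<in> A \<Longrightarrow> a \<odot>\<^bsub>E i\<^esub> v = \<zero>\<^bsub>E i\<^esub>"
  by (simp add: annihilated_def)

lemma annihilated_minus:
  assumes "A \<subseteq> carrier R" "v \<in> annihilated i A" "w \<in> annihilated i A"
  shows "v \<ominus>\<^bsub>E i\<^esub> w \<in> annihilated i A"
proof (rule annihilatedI)
  have c: "v \<in> carrier (E i)" "w \<in> carrier (E i)" using assms annihilated_closed by auto
  then show "v \<ominus>\<^bsub>E i\<^esub> w \<in> carrier (E i)" by simp
  show "a \<odot>\<^bsub>E i\<^esub> (v \<ominus>\<^bsub>E i\<^esub> w) = \<zero>\<^bsub>E i\<^esub>" if "a \<in> A" for a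
    using that assms c annihilatedD by (simp add: E.smult_minus_distr subset_iff)
qed

lemma annihilated_add:
  assumes "A \<subseteq> carrier R" "v \<in> annihilated i A" "w \<in> annihilated i A"
  shows "v \<oplus>\<^bsub>E i\<^esub> w \<in> annihilated i A"
proof (rule annihilatedI)
  have c: "v \<in> carrier (E i)" "w \<in> carrier (E i)" using assms annihilated_closed by auto
  then show "v \<oplus>\<^bsub>E i\<^esub> w \<in> carrier (E i)" by simp
  show "a \<odot>\<^bsub>E i\<^esub> (v \<oplus>\<^bsub>E i\<^esub> w) = \<zero>\<^bsub>E i\<^esub>" if "a \<in> A" for a
    using that assms c annihilatedD by (simp add: E.smult_r_distr subset_iff)
qed

lemma annihilated_d:
  assumes "A \<subseteq> carrier R" "v \<in> annihilated i A" shows "d i v \<in> annihilated (Suc i) A"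
proof (rule annihilatedI)
  have c: "v \<in> carrier (E i)" using assms annihilated_closed by auto
  then show "d i v \<in> carrier (E (Suc i))" by simp
  show "a \<odot>\<^bsub>E (Suc i)\<^esub> d i v = \<zero>\<^bsub>E (Suc i)\<^esub>" if "a \<in> A" for a
    using that assms c annihilatedD d_smult[of a v i] by (simp add: subset_iff)
qed

lemma annihilated_adjoin:
  assumes A: "ideal A R" and c: "c \<in> carrier R"
    and v: "v \<in> annihilated i A" "c \<odot>\<^bsub>E i\<^esub> v = \<zero>\<^bsub>E i\<^esub>"
  shows "v \<in> annihilated i (adjoin A c)"
proof (rule annihilatedI)
  show vc: "v \<in> carrier (E i)" using v annihilated_closed by auto
  fix a assume "a \<in> adjoin A c"
  then obtain u r where a: "u \<in> A" "r \<in> carrier R" "a = u \<oplus> r \<otimes> c" by (auto simp: mem_adjoin)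
  have u: "u \<in> carrier R" using a A ideal_in_carrier by blast
  show "a \<odot>\<^bsub>E i\<^esub> v = \<zero>\<^bsub>E i\<^esub>"
    using a(2,3) u c v vc annihilatedD[OF v(1) a(1)] by (simp add: E.smult_l_distr E.smult_assoc1)
qed

lemma annihilated_antimono: "A \<subseteq> B \<Longrightarrow> v \<in> annihilated i B \<Longrightarrow> v \<in> annihilated i A"
  by (auto simp: annihilated_def)

lemma annihilated_PIdl:
  assumes "x \<in> carrier R" "v \<in> carrier (E i)" "x \<odot>\<^bsub>E i\<^esub> v = \<zero>\<^bsub>E i\<^esub>"
  shows "v \<in> annihilated i (PIdl x)"
  using assms by (auto simp: annihilated_def cgenideal_def E.smult_assoc1)

text \<open>\<open>Hom (R / A) (E i)\<close> consists of the elements of \<open>E i\<close> annihilated by \<open>A\<close>, so this says that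
  \<open>Ext\<close> of \<open>R / A\<close> and \<open>R\<close> vanishes in degree \<open>i + 1\<close>.\<close>

definition ext_vanish :: "nat \<Rightarrow> 'a set \<Rightarrow> bool"
  where "ext_vanish i A \<longleftrightarrow> (\<forall>v\<in>annihilated (Suc i) A.
    d (Suc i) v = \<zero>\<^bsub>E (Suc (Suc i))\<^esub> \<longrightarrow> (\<exists>g\<in>annihilated i A. d i g = v))"

lemma ext_vanishD:
  assumes "ext_vanish i A" "v \<in> annihilated (Suc i) A" "d (Suc i) v = \<zero>\<^bsub>E (Suc (Suc i))\<^esub>"
  obtains g where "g \<in> annihilated i A" "d i g = v"
  using assms unfolding ext_vanish_def by blast

lemma ext_vanish_zero: "ext_vanish i {\<zero>}"
  unfolding ext_vanish_def
proof (intro ballI impI)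
  fix v assume v: "v \<in> annihilated (Suc i) {\<zero>}" "d (Suc i) v = \<zero>\<^bsub>E (Suc (Suc i))\<^esub>"
  obtain g where "g \<in> carrier (E i)" "d i g = v" by (rule exact[OF annihilated_closed[OF v(1)] v(2)])
  moreover from this have "g \<in> annihilated i {\<zero>}" by (intro annihilatedI) auto
  ultimately show "\<exists>g\<in>annihilated i {\<zero>}. d i g = v" by blast
qed

lemma ext_vanish_above:
  assumes "A \<subseteq> carrier R" "i \<ge> N" shows "ext_vanish i A"
  unfolding ext_vanish_def
proof (intro ballI impI)
  fix v assume "v \<in> annihilated (Suc i) A"
  then have "v \<in> carrier (E (Suc i))" "carrier (E (Suc i)) = {\<zero>\<^bsub>E (Suc i)\<^esub>}"
    using assms annihilated_closed bounded[of "Suc i"] by auto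
  then have "d i \<zero>\<^bsub>E i\<^esub> = v" by simp
  moreover have "\<zero>\<^bsub>E i\<^esub> \<in> annihilated i A" using assms by (intro annihilatedI) auto
  ultimately show "\<exists>g\<in>annihilated i A. d i g = v" by blast
qed

text \<open>The exact sequence \<open>R / (B : c) \<rightarrow> R / B \<rightarrow> R / (B + (c))\<close>, the first map being multiplication
  by \<open>c\<close>.\<close>

lemma ext_vanish_extension:
  assumes B: "ideal B R" and c: "c \<in> carrier R"
    and colon: "ext_vanish i (elem_colon B c)" and sum: "ext_vanish i (adjoin B c)"
  shows "ext_vanish i B"
  unfolding ext_vanish_def
proof (intro ballI impI)
  fix v assume v: "v \<in> annihilated (Suc i) B" "d (Suc i) v = \<zero>\<^bsub>E (Suc (Suc i))\<^esub>"
  have Bc: "B \<subseteq> carrier R" using B ideal_in_carrier by blast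
  have vc: "v \<in> carrier (E (Suc i))" using v annihilated_closed by blast
  have "c \<odot>\<^bsub>E (Suc i)\<^esub> v \<in> annihilated (Suc i) (elem_colon B c)"
    using c vc annihilatedD[OF v(1)]
    by (intro annihilatedI) (auto simp: elem_colon_def E.smult_assoc1[symmetric])
  moreover have "d (Suc i) (c \<odot>\<^bsub>E (Suc i)\<^esub> v) = \<zero>\<^bsub>E (Suc (Suc i))\<^esub>"
    using c vc v by (simp add: d_smult)
  ultimately obtain g where g: "g \<in> annihilated i (elem_colon B c)" "d i g = c \<odot>\<^bsub>E (Suc i)\<^esub> v"
    using ext_vanishD[OF colon] by metis
  have gc: "g \<in> carrier (E i)" using g annihilated_closed by blast
  obtain f where f: "f \<in> carrier (E i)" "\<And>u. u \<in> B \<Longrightarrow> u \<odot>\<^bsub>E i\<^esub> f = \<zero>\<^bsub>E i\<^esub>" "c \<odot>\<^bsub>E i\<^esub> f = g"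
    by (rule injective_module_extend[OF E_injective B c gc])
      (use annihilatedD[OF g(1)] in \<open>auto simp: elem_colon_def\<close>)
  have fB: "f \<in> annihilated i B" using f by (intro annihilatedI)
  let ?w = "v \<ominus>\<^bsub>E (Suc i)\<^esub> d i f"
  have w: "?w \<in> annihilated (Suc i) B"
    by (rule annihilated_minus[OF Bc v(1) annihilated_d[OF Bc fB]])
  have "c \<odot>\<^bsub>E (Suc i)\<^esub> ?w = \<zero>\<^bsub>E (Suc i)\<^esub>"
    using c vc f g by (simp add: E.smult_minus_distr d_smult[symmetric])
  then have "?w \<in> annihilated (Suc i) (adjoin B c)"
    using annihilated_adjoin[OF B c w] by blast
  moreover have "d (Suc i) ?w = \<zero>\<^bsub>E (Suc (Suc i))\<^esub>"
    using vc f v by (simp add: d_minus)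
  ultimately obtain h where h: "h \<in> annihilated i (adjoin B c)" "d i h = ?w"
    using ext_vanishD[OF sum] by metis
  have hB: "h \<in> annihilated i B" using h annihilated_antimono subset_adjoin[OF B c] by blast
  have "f \<oplus>\<^bsub>E i\<^esub> h \<in> annihilated i B" by (rule annihilated_add[OF Bc fB hB])
  moreover have "d i (f \<oplus>\<^bsub>E i\<^esub> h) = v"
  proof -
    have "d i (f \<oplus>\<^bsub>E i\<^esub> h) = d i f \<oplus>\<^bsub>E (Suc i)\<^esub> ?w"
      using f annihilated_closed[OF hB] h by (simp add: d_add)
    also have "\<dots> = v"
      using vc f by (simp add: a_minus_def E.M.a_lcomm E.M.r_neg)
    finally show ?thesis .
  qed
  ultimately show "\<exists>g\<in>annihilated i B. d i g = v" by blast
qed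

lemma ext_vanish_carrier: "ext_vanish i (carrier R)"
  unfolding ext_vanish_def
proof (intro ballI impI)
  fix v assume v: "v \<in> annihilated (Suc i) (carrier R)"
  then have "\<one> \<odot>\<^bsub>E (Suc i)\<^esub> v = \<zero>\<^bsub>E (Suc i)\<^esub>" using annihilatedD by blast
  then have "d i \<zero>\<^bsub>E i\<^esub> = v" using annihilated_closed[OF v] by simp
  moreover have "\<zero>\<^bsub>E i\<^esub> \<in> annihilated i (carrier R)" by (rule annihilatedI) auto
  ultimately show "\<exists>g\<in>annihilated i (carrier R). d i g = v" by blast
qed

lemma ext_vanish_if_primes:
  assumes "ideal B R" and "\<And>P. primeideal P R \<Longrightarrow> B \<subseteq> P \<Longrightarrow> ext_vanish i P"
  shows "ext_vanish i B"
  using assms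
proof (induction B rule: ideal_noetherian_induct)
  case (step B)
  show ?case
  proof (cases "B = carrier R")
    case False
    obtain c where c: "c \<in> carrier R" "c \<notin> B" "primeideal (elem_colon B c) R"
      by (rule ex_prime_elem_colon[OF step(1) False])
    have "ext_vanish i (elem_colon B c)"
      using step.prems c subset_elem_colon[OF step(1)] by blast
    moreover have "ext_vanish i (adjoin B c)"
    proof (rule step.IH)
      show "ideal (adjoin B c) R" using ideal_adjoin step c by blast
      show "B \<subset> adjoin B c"
        using subset_adjoin[OF step(1) c(1)] self_mem_adjoin[OF step(1) c(1)] c(2) by blast
      then show "ext_vanish i P" if "primeideal P R" "adjoin B c \<subseteq> P" for P
        using step.prems that by blast
    qed
    ultimately show ?thesis using ext_vanish_extension step c by blast
  qed (simp add: ext_vanish_carrier)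
qed

text \<open>Multiplication by \<open>s\<close> embeds \<open>R / (J : s)\<close> into \<open>R / J\<close> with cokernel \<open>R / (J + (s))\<close>.\<close>

lemma ext_vanish_submodule:
  assumes J: "ideal J R" and s: "s \<in> carrier R"
    and van: "ext_vanish i J" "ext_vanish (Suc i) (adjoin J s)"
  shows "ext_vanish i (elem_colon J s)"
  unfolding ext_vanish_def
proof (intro ballI impI)
  fix v assume v: "v \<in> annihilated (Suc i) (elem_colon J s)" "d (Suc i) v = \<zero>\<^bsub>E (Suc (Suc i))\<^esub>"
  have Jc: "J \<subseteq> carrier R" using J ideal_in_carrier by blast
  have vc: "v \<in> carrier (E (Suc i))" using v annihilated_closed by blast
  obtain f where f: "f \<in> carrier (E (Suc i))" "\<And>u. u \<in> J \<Longrightarrow> u \<odot>\<^bsub>E (Suc i)\<^esub> f = \<zero>\<^bsub>E (Suc i)\<^esub>"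
    "s \<odot>\<^bsub>E (Suc i)\<^esub> f = v"
    by (rule injective_module_extend[OF E_injective J s vc])
      (use annihilatedD[OF v(1)] in \<open>auto simp: elem_colon_def\<close>)
  have fJ: "f \<in> annihilated (Suc i) J" using f by (intro annihilatedI)
  have "s \<odot>\<^bsub>E (Suc (Suc i))\<^esub> d (Suc i) f = \<zero>\<^bsub>E (Suc (Suc i))\<^esub>"
    using s f v by (simp add: d_smult[symmetric])
  then have "d (Suc i) f \<in> annihilated (Suc (Suc i)) (adjoin J s)"
    using annihilated_adjoin[OF J s annihilated_d[OF Jc fJ]] by blast
  then obtain g where g: "g \<in> annihilated (Suc i) (adjoin J s)" "d (Suc i) g = d (Suc i) f"
    using ext_vanishD[OF van(2)] f d_d by metis
  have gJ: "g \<in> annihilated (Suc i) J" using g annihilated_antimono subset_adjoin[OF J s] by blast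
  have gc: "g \<in> carrier (E (Suc i))" using g annihilated_closed by blast
  have "f \<ominus>\<^bsub>E (Suc i)\<^esub> g \<in> annihilated (Suc i) J" by (rule annihilated_minus[OF Jc fJ gJ])
  moreover have "d (Suc i) (f \<ominus>\<^bsub>E (Suc i)\<^esub> g) = \<zero>\<^bsub>E (Suc (Suc i))\<^esub>"
    using f gc g by (simp add: d_minus)
  ultimately obtain h where h: "h \<in> annihilated i J" "d i h = f \<ominus>\<^bsub>E (Suc i)\<^esub> g"
    using ext_vanishD[OF van(1)] by metis
  have hc: "h \<in> carrier (E i)" using h annihilated_closed by blast
  have "s \<odot>\<^bsub>E i\<^esub> h \<in> annihilated i (elem_colon J s)"
    using s hc annihilatedD[OF h(1)]
    by (intro annihilatedI) (auto simp: elem_colon_def E.smult_assoc1[symmetric])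
  moreover have "d i (s \<odot>\<^bsub>E i\<^esub> h) = v"
  proof -
    have "s \<odot>\<^bsub>E (Suc i)\<^esub> g = \<zero>\<^bsub>E (Suc i)\<^esub>"
      using annihilatedD[OF g(1)] self_mem_adjoin[OF J s] by blast
    then show ?thesis using s f gc hc h vc by (simp add: d_smult E.smult_minus_distr)
  qed
  ultimately show "\<exists>g\<in>annihilated i (elem_colon J s). d i g = v" by blast
qed

lemma divisible_by_nonzerodivisor:
  assumes x: "nonzerodivisor x" and g: "g \<in> carrier (E i)"
  obtains f where "f \<in> carrier (E i)" "x \<odot>\<^bsub>E i\<^esub> f = g"
proof (rule injective_module_extend[OF E_injective zeroideal nonzerodivisor_closed[OF x] g])
  fix r assume r: "r \<in> carrier R" "r \<otimes> x \<in> {\<zero>}"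
  then have "x \<otimes> r = x \<otimes> \<zero>" using nonzerodivisor_closed[OF x] m_comm[of r x] by simp
  then have "r = \<zero>" using nonzerodivisor_cancel[OF x _ r(1) zero_closed] by blast
  then show "r \<odot>\<^bsub>E i\<^esub> g = \<zero>\<^bsub>E i\<^esub>" using g by simp
next
  fix f assume "f \<in> carrier (E i)" "x \<odot>\<^bsub>E i\<^esub> f = g"
  then show thesis by (rule that)
qed

lemma ext_vanish_nonzerodivisor:
  assumes x: "nonzerodivisor x" shows "ext_vanish (Suc i) (PIdl x)"
  unfolding ext_vanish_def
proof (intro ballI impI)
  fix v assume v: "v \<in> annihilated (Suc (Suc i)) (PIdl x)" "d (Suc (Suc i)) v = \<zero>\<^bsub>E (Suc (Suc (Suc i)))\<^esub>"
  have xc: "x \<in> carrier R" using x nonzerodivisor_closed by blast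
  have vc: "v \<in> carrier (E (Suc (Suc i)))" using v annihilated_closed by blast
  have xv: "x \<odot>\<^bsub>E (Suc (Suc i))\<^esub> v = \<zero>\<^bsub>E (Suc (Suc i))\<^esub>"
    using annihilatedD[OF v(1)] cgenideal_self[OF xc] by blast
  obtain h where h: "h \<in> carrier (E (Suc i))" "d (Suc i) h = v" by (rule exact[OF vc v(2)])
  have "d (Suc i) (x \<odot>\<^bsub>E (Suc i)\<^esub> h) = \<zero>\<^bsub>E (Suc (Suc i))\<^esub>" using h xc xv by (simp add: d_smult)
  then obtain g where g: "g \<in> carrier (E i)" "d i g = x \<odot>\<^bsub>E (Suc i)\<^esub> h"
    using exact[of "x \<odot>\<^bsub>E (Suc i)\<^esub> h" i] h xc by auto
  obtain f where f: "f \<in> carrier (E i)" "x \<odot>\<^bsub>E i\<^esub> f = g"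
    by (rule divisible_by_nonzerodivisor[OF x g(1)])
  let ?w = "h \<ominus>\<^bsub>E (Suc i)\<^esub> d i f"
  have "x \<odot>\<^bsub>E (Suc i)\<^esub> ?w = \<zero>\<^bsub>E (Suc i)\<^esub>"
    using xc h f g by (simp add: E.smult_minus_distr d_smult[symmetric])
  then have "?w \<in> annihilated (Suc i) (PIdl x)" using annihilated_PIdl xc h f by simp
  moreover have "d (Suc i) ?w = v" using h f vc by (simp add: d_minus)
  ultimately show "\<exists>g\<in>annihilated (Suc i) (PIdl x). d (Suc i) g = v" by blast
qed

end

section \<open>One-dimensional Gorenstein rings\<close>

locale gorenstein_one_dim_local_ring =
  one_dim_local_ring R + bounded_injective_resolution R e E d N
  for R :: "('a, 'r) ring_scheme" (structure) and e :: "'a \<Rightarrow> 'm" and E d N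
begin

lemma prime_is_annihilator:
  assumes z: "z \<in> carrier R" "z \<noteq> \<zero>" "\<And>r. r \<in> \<mm> \<Longrightarrow> r \<otimes> z = \<zero>"
    and P: "primeideal P R"
  obtains c where "c \<in> carrier R" "P = elem_colon {\<zero>} c"
proof (cases "P = \<mm>")
  case False
  then show ?thesis using minimal_prime_is_annihilator non_max_prime_minimal P that by metis
next
  case True
  have "\<one> \<notin> elem_colon {\<zero>} z" using z by (simp add: elem_colon_def)
  then have "elem_colon {\<zero>} z \<subseteq> \<mm>"
    using proper_ideal_subset_max ideal_elem_colon zeroideal z by blast
  moreover have "\<mm> \<subseteq> elem_colon {\<zero>} z"
    using z ideal_in_carrier[OF ideal_max] by (auto simp: elem_colon_def)
  ultimately show ?thesis using that z(1) True by blast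
qed

text \<open>If \<open>\<mm>\<close> is associated, then so is every prime, because in dimension one the others are
  minimal. Thus every \<open>R / P\<close> embeds into \<open>R\<close>, whose higher Ext vanish, and descending induction
  from the length of the resolution makes \<open>R\<close> self-injective.\<close>

lemma ext_vanish_if_depth_zero:
  assumes z: "z \<in> carrier R" "z \<noteq> \<zero>" "\<And>r. r \<in> \<mm> \<Longrightarrow> r \<otimes> z = \<zero>"
    and A: "ideal A R"
  shows "ext_vanish 0 A"
proof -
  have "\<forall>A. ideal A R \<longrightarrow> ext_vanish 0 A"
  proof (rule inc_induct[of 0 N "\<lambda>i. \<forall>A. ideal A R \<longrightarrow> ext_vanish i A"])
    show "\<forall>A. ideal A R \<longrightarrow> ext_vanish N A"
      using ext_vanish_above ideal_in_carrier by blast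
  next
    fix i assume IH: "\<forall>A. ideal A R \<longrightarrow> ext_vanish (Suc i) A"
    show "\<forall>A. ideal A R \<longrightarrow> ext_vanish i A"
    proof (intro allI impI)
      fix B assume B: "ideal B R"
      show "ext_vanish i B"
      proof (rule ext_vanish_if_primes[OF B])
        fix P assume P: "primeideal P R"
        obtain c where c: "c \<in> carrier R" "P = elem_colon {\<zero>} c"
          by (rule prime_is_annihilator[OF z P])
        have "ext_vanish (Suc i) (adjoin {\<zero>} c)" using IH ideal_adjoin[OF zeroideal c(1)] by blast
        then show "ext_vanish i P"
          unfolding c(2) by (rule ext_vanish_submodule[OF zeroideal c(1) ext_vanish_zero])
      qed
    qed
  qed simp
  then show ?thesis using A by blast
qed

lemma self_injective:
  assumes van: "ext_vanish 0 (PIdl s)" and s: "s \<in> carrier R" and v: "v \<in> carrier R"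
    and wd: "\<And>r. r \<in> carrier R \<Longrightarrow> r \<otimes> s = \<zero> \<Longrightarrow> r \<otimes> v = \<zero>"
  obtains w where "w \<in> carrier R" "v = w \<otimes> s"
proof -
  obtain f where f: "f \<in> carrier (E 0)" "s \<odot>\<^bsub>E 0\<^esub> f = e v"
  proof (rule injective_module_extend[OF E_injective zeroideal s e_closed[OF v]])
    fix r assume "r \<in> carrier R" "r \<otimes> s \<in> {\<zero>}"
    then show "r \<odot>\<^bsub>E 0\<^esub> e v = \<zero>\<^bsub>E 0\<^esub>" using wd[of r] e_mult[of r v] v by simp
  next
    fix f assume "f \<in> carrier (E 0)" "s \<odot>\<^bsub>E 0\<^esub> f = e v"
    then show thesis by (rule that)
  qed
  have "s \<odot>\<^bsub>E (Suc 0)\<^esub> d 0 f = \<zero>\<^bsub>E (Suc 0)\<^esub>" using s f v by (simp add: d_smult[symmetric])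
  then have "d 0 f \<in> annihilated (Suc 0) (PIdl s)" using annihilated_PIdl s f by simp
  then obtain g where g: "g \<in> annihilated 0 (PIdl s)" "d 0 g = d 0 f"
    using ext_vanishD[OF van] d_d[OF f(1)] by metis
  have gc: "g \<in> carrier (E 0)" using g annihilated_closed by blast
  have "d 0 (f \<ominus>\<^bsub>E 0\<^esub> g) = \<zero>\<^bsub>E (Suc 0)\<^esub>" using f g gc by (simp add: d_minus)
  then obtain w where w: "w \<in> carrier R" "f \<ominus>\<^bsub>E 0\<^esub> g = e w"
    using exact_0[of "f \<ominus>\<^bsub>E 0\<^esub> g"] f gc by auto
  have "s \<odot>\<^bsub>E 0\<^esub> g = \<zero>\<^bsub>E 0\<^esub>" using annihilatedD[OF g(1)] cgenideal_self[OF s] by blast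
  then have "s \<odot>\<^bsub>E 0\<^esub> (f \<ominus>\<^bsub>E 0\<^esub> g) = e v" using s f gc v by (simp add: E.smult_minus_distr)
  then have "e (s \<otimes> w) = e v" using w s by (simp add: e_mult)
  then have "v = w \<otimes> s" using e_inj[of "s \<otimes> w" v] s w v by (simp add: m_comm)
  then show ?thesis using that w by blast
qed

text \<open>A self-injective Noetherian ring is Artinian: the annihilators of the powers of \<open>y\<close> become
  stationary, and then \<open>y\<^bsup>n+1\<^esup> \<mapsto> y\<^sup>n\<close> defines a homomorphism, which is multiplication by some
  \<open>w\<close>. So \<open>y\<^sup>n = w y\<^bsup>n+1\<^esup>\<close>, and \<open>y \<in> \<mm>\<close> is nilpotent.\<close>

lemma depth_positive:
  assumes z: "z \<in> carrier R" "\<And>r. r \<in> \<mm> \<Longrightarrow> r \<otimes> z = \<zero>"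
  shows "z = \<zero>"
proof (rule ccontr)
  assume nz: "z \<noteq> \<zero>"
  have nilpotent: "\<exists>n::nat. y [^] n = \<zero>" if y: "y \<in> \<mm>" for y
  proof -
    have yc: "y \<in> carrier R" using y ideal_max ideal_in_carrier by blast
    let ?F = "{elem_colon {\<zero>} (y [^] n) | n::nat. True}"
    have "elem_colon {\<zero>} (y [^] (0::nat)) \<in> ?F" by blast
    then obtain M where M: "M \<in> ?F" "\<And>B. B \<in> ?F \<Longrightarrow> M \<subseteq> B \<Longrightarrow> B = M"
      by (rule ex_maximal_ideal_in) (use ideal_elem_colon[OF zeroideal] yc in auto)
    then obtain n :: nat where n: "M = elem_colon {\<zero>} (y [^] n)" by blast
    have pc: "y [^] n \<in> carrier R" using yc by simp
    have "M \<subseteq> elem_colon {\<zero>} (y [^] Suc n)"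
    proof
      fix r assume "r \<in> M"
      then have r: "r \<in> carrier R" "r \<otimes> y [^] n = \<zero>" unfolding n by (auto simp: elem_colon_def)
      have "r \<otimes> y [^] Suc n = (r \<otimes> y [^] n) \<otimes> y" using r(1) yc by (simp add: m_assoc)
      then show "r \<in> elem_colon {\<zero>} (y [^] Suc n)" using r yc by (simp add: elem_colon_def)
    qed
    then have eq: "elem_colon {\<zero>} (y [^] Suc n) = M" using M(2) by blast
    have ann: "r \<otimes> y [^] n = \<zero>" if "r \<in> carrier R" "r \<otimes> y [^] Suc n = \<zero>" for r
    proof -
      have "r \<in> elem_colon {\<zero>} (y [^] Suc n)" using that by (simp add: elem_colon_def)
      then show ?thesis using eq n by (auto simp: elem_colon_def)
    qed
    have sc: "y [^] Suc n \<in> carrier R" using yc by (rule nat_pow_closed)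
    obtain w where w: "w \<in> carrier R" "y [^] n = w \<otimes> y [^] Suc n"
      by (rule self_injective[OF ext_vanish_if_depth_zero[OF z(1) nz z(2) cgenideal_ideal[OF sc]] sc pc ann])
    have "y [^] n = (w \<otimes> y) \<otimes> y [^] n"
      by (rule trans[OF w(2)]) (use w(1) yc in \<open>simp add: m_ac\<close>)
    moreover have "w \<otimes> y \<in> \<mm>" using w y ideal_max ideal_mult_l by blast
    ultimately have "y [^] n = \<zero>" using eq_zero_if_fixed[OF pc] by blast
    then show ?thesis by blast
  qed
  have nil: "\<mm> \<subseteq> P" if P: "primeideal P R" for P
  proof
    fix y assume y: "y \<in> \<mm>"
    then obtain n :: nat where "y [^] n = \<zero>" using nilpotent by blast
    then have "y [^] n \<in> P" using P primeideal.axioms(1) ideal_zero by metis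
    then show "y \<in> P" by (rule prime_pow_mem[OF P ideal_in_carrier[OF ideal_max y]])
  qed
  obtain P where "primeideal P R" "P \<noteq> \<mm>" using ex_non_max_prime by blast
  then show False using nil[of P] prime_subset_max[of P] by blast
qed

sublocale one_dim_local_CM_ring
proof
  show "z = \<zero>" if "z \<in> carrier R" "\<And>r. r \<in> \<mm> \<Longrightarrow> r \<otimes> z = \<zero>" for z
    by (rule depth_positive[OF that])
qed

text \<open>Modules of finite length behave as if the resolution had length one: the residue field embeds
  into \<open>R / (x)\<close>, whose Ext vanish above degree one, so its own vanishing descends from each degree
  to the next lower one as long as that is at least two.\<close>

lemma ext_vanish_max_primary:
  assumes x: "x \<in> \<mm>" "max_primary (PIdl x)"
  shows "max_primary B \<Longrightarrow> ext_vanish 1 B"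
proof -
  have xc: "x \<in> carrier R" using x ideal_max ideal_in_carrier by blast
  have xI: "ideal (PIdl x) R" by (rule cgenideal_ideal[OF xc])
  have "PIdl x \<subseteq> \<mm>" by (rule cgenideal_minimal[OF ideal_max x(1)])
  then have "\<one> \<notin> PIdl x" using one_notin_max by blast
  then obtain s where s: "s \<in> carrier R" "s \<notin> PIdl x" "elem_colon (PIdl x) s = \<mm>"
    using max_primary_colon[OF x(2)] by metis
  have "\<forall>B. max_primary B \<longrightarrow> ext_vanish 1 B"
  proof (rule inc_induct[of 1 "Suc N" "\<lambda>i. \<forall>B. max_primary B \<longrightarrow> ext_vanish i B"])
    show "\<forall>B. max_primary B \<longrightarrow> ext_vanish (Suc N) B"
    proof (intro allI impI)
      fix B assume "max_primary B"
      then have "B \<subseteq> carrier R" using max_primary_ideal ideal_in_carrier by blast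
      then show "ext_vanish (Suc N) B" by (rule ext_vanish_above) simp
    qed
  next
    fix i assume i: "1 \<le> i" "\<forall>B. max_primary B \<longrightarrow> ext_vanish (Suc i) B"
    then obtain k where k: "i = Suc k" by (cases i) auto
    have "max_primary (adjoin (PIdl x) s)"
      using max_primary_mono[OF x(2) subset_adjoin[OF xI s(1)] ideal_adjoin[OF xI s(1)]] .
    then have "ext_vanish (Suc i) (adjoin (PIdl x) s)" using i by blast
    moreover have "ext_vanish i (PIdl x)"
      unfolding k by (rule ext_vanish_nonzerodivisor[OF parameter_nonzerodivisor[OF xc x(2)]])
    ultimately have "ext_vanish i \<mm>" using ext_vanish_submodule[OF xI s(1)] s(3) by metis
    then show "\<forall>B. max_primary B \<longrightarrow> ext_vanish i B"
      using ext_vanish_if_primes unfolding max_primary_def by blast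
  qed simp
  then show "max_primary B \<Longrightarrow> ext_vanish 1 B" by blast
qed

text \<open>The ring \<open>R / (x)\<close> is self-injective and contains a copy of the residue field, so every ideal
  \<open>A\<close> of it is the annihilator of its annihilator: a homomorphism from \<open>A + (b)\<close> that kills
  \<open>A\<close> but not \<open>b\<close> is multiplication by some \<open>w\<close>.\<close>

lemma colon_duality:
  assumes x: "x \<in> \<mm>" "max_primary (PIdl x)"
    and A: "ideal A R" "x \<in> A" and b: "b \<in> carrier R" "b \<notin> A"
  obtains w where "w \<in> carrier R" "\<And>a. a \<in> A \<Longrightarrow> a \<otimes> w \<in> PIdl x" "b \<otimes> w \<notin> PIdl x"
proof -
  have xc: "x \<in> carrier R" using x ideal_max ideal_in_carrier by blast
  have Ac: "\<And>a. a \<in> A \<Longrightarrow> a \<in> carrier R" using A ideal_in_carrier by blast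
  have xI: "ideal (PIdl x) R" by (rule cgenideal_ideal[OF xc])
  have nzd: "nonzerodivisor x" by (rule parameter_nonzerodivisor[OF xc x(2)])
  have "PIdl x \<subseteq> \<mm>" by (rule cgenideal_minimal[OF ideal_max x(1)])
  then have "\<one> \<notin> PIdl x" using one_notin_max by blast
  then obtain s where s: "s \<in> carrier R" "s \<notin> PIdl x" "elem_colon (PIdl x) s = \<mm>"
    using max_primary_colon[OF x(2)] by metis
  \<comment> \<open>\<open>f0\<close> plays the role of \<open>1 / x\<close>, so that its image \<open>\<sigma>\<close> generates a copy of \<open>R / (x)\<close>.\<close>
  obtain f0 where f0: "f0 \<in> carrier (E 0)" "x \<odot>\<^bsub>E 0\<^esub> f0 = e \<one>"
    by (rule divisible_by_nonzerodivisor[OF nzd e_closed[OF one_closed]])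
  define \<sigma> where "\<sigma> = d 0 f0"
  have \<sigma>: "\<sigma> \<in> carrier (E (Suc 0))" using f0 by (simp add: \<sigma>_def)
  have x\<sigma>: "x \<odot>\<^bsub>E (Suc 0)\<^esub> \<sigma> = \<zero>\<^bsub>E (Suc 0)\<^esub>"
    using f0 xc by (simp add: \<sigma>_def d_smult[symmetric])
  have PIdl_\<sigma>: "r \<odot>\<^bsub>E (Suc 0)\<^esub> \<sigma> = \<zero>\<^bsub>E (Suc 0)\<^esub>" if "r \<in> PIdl x" for r
    using annihilatedD[OF annihilated_PIdl[OF xc \<sigma> x\<sigma>] that] .
  have faithful: "r \<in> PIdl x"
    if r: "r \<in> carrier R" and \<zeta>: "\<zeta> \<in> carrier (E 0)" "x \<odot>\<^bsub>E 0\<^esub> \<zeta> = \<zero>\<^bsub>E 0\<^esub>" "d 0 \<zeta> = r \<odot>\<^bsub>E (Suc 0)\<^esub> \<sigma>"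
    for r \<zeta>
  proof -
    let ?v = "r \<odot>\<^bsub>E 0\<^esub> f0 \<ominus>\<^bsub>E 0\<^esub> \<zeta>"
    have "d 0 ?v = \<zero>\<^bsub>E (Suc 0)\<^esub>"
      using r \<zeta> f0 \<sigma> by (simp add: d_minus d_smult \<sigma>_def)
    then obtain u where u: "u \<in> carrier R" "?v = e u" using exact_0[of ?v] r \<zeta> f0 by auto
    have "e (x \<otimes> u) = x \<odot>\<^bsub>E 0\<^esub> ?v" by (simp only: e_mult[OF xc u(1)] u(2))
    also have "\<dots> = r \<odot>\<^bsub>E 0\<^esub> (x \<odot>\<^bsub>E 0\<^esub> f0)"
      using r \<zeta> f0(1) xc E.smult_commute[OF xc r f0(1)] by (simp add: E.smult_minus_distr)
    also have "\<dots> = e (r \<otimes> \<one>)" by (simp only: f0(2) e_mult[OF r one_closed])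
    finally have "e (x \<otimes> u) = e (r \<otimes> \<one>)" .
    then have "r = u \<otimes> x" using e_inj[of "x \<otimes> u" r] u r xc by (simp add: m_comm)
    then show ?thesis using u unfolding cgenideal_def by blast
  qed
  obtain \<tau> where \<tau>: "\<tau> \<in> carrier (E (Suc 0))" "\<And>u. u \<in> A \<Longrightarrow> u \<odot>\<^bsub>E (Suc 0)\<^esub> \<tau> = \<zero>\<^bsub>E (Suc 0)\<^esub>"
    "b \<odot>\<^bsub>E (Suc 0)\<^esub> \<tau> = s \<odot>\<^bsub>E (Suc 0)\<^esub> \<sigma>"
  proof (rule injective_module_extend[OF E_injective A(1) b(1) E.smult_closed[OF s(1) \<sigma>]])
    fix r assume r: "r \<in> carrier R" "r \<otimes> b \<in> A"
    have "r \<notin> Units R" using Unit_mult_mem_cancel[OF A(1)] r b by blast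
    then have "r \<in> elem_colon (PIdl x) s" using r Units_iff_notin_max s by blast
    then have "(r \<otimes> s) \<odot>\<^bsub>E (Suc 0)\<^esub> \<sigma> = \<zero>\<^bsub>E (Suc 0)\<^esub>" using PIdl_\<sigma> by (simp add: elem_colon_def)
    then show "r \<odot>\<^bsub>E (Suc 0)\<^esub> (s \<odot>\<^bsub>E (Suc 0)\<^esub> \<sigma>) = \<zero>\<^bsub>E (Suc 0)\<^esub>"
      using r s \<sigma> by (simp add: E.smult_assoc1)
  qed (use that in blast)
  have AI: "A \<subseteq> carrier R" using Ac by blast
  have \<tau>A: "\<tau> \<in> annihilated (Suc 0) A" using \<tau> by (intro annihilatedI)
  have "b \<odot>\<^bsub>E (Suc (Suc 0))\<^esub> d (Suc 0) \<tau> = \<zero>\<^bsub>E (Suc (Suc 0))\<^esub>"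
    using b(1) \<tau>(1,3) s(1) \<sigma> f0(1) by (simp add: d_smult[symmetric]) (simp add: d_smult \<sigma>_def)
  then have "d (Suc 0) \<tau> \<in> annihilated (Suc (Suc 0)) (adjoin A b)"
    using annihilated_adjoin[OF A(1) b(1) annihilated_d[OF AI \<tau>A]] by blast
  moreover have "ext_vanish (Suc 0) (adjoin A b)"
  proof -
    have "PIdl x \<subseteq> adjoin A b"
      using cgenideal_minimal[OF A] subset_adjoin[OF A(1) b(1)] by blast
    then show ?thesis
      using ext_vanish_max_primary[OF x] max_primary_mono[OF x(2) _ ideal_adjoin[OF A(1) b(1)]] by simp
  qed
  ultimately obtain \<tau>' where \<tau>': "\<tau>' \<in> annihilated (Suc 0) (adjoin A b)" "d (Suc 0) \<tau>' = d (Suc 0) \<tau>"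
    using ext_vanishD[of "Suc 0" "adjoin A b" "d (Suc 0) \<tau>"] d_d[OF \<tau>(1)] by metis
  have \<tau>'c: "\<tau>' \<in> carrier (E (Suc 0))" using \<tau>' annihilated_closed by blast
  define \<rho> where "\<rho> = \<tau> \<ominus>\<^bsub>E (Suc 0)\<^esub> \<tau>'"
  have \<rho>: "\<rho> \<in> carrier (E (Suc 0))" using \<tau> \<tau>'c by (simp add: \<rho>_def)
  have A\<rho>: "a \<odot>\<^bsub>E (Suc 0)\<^esub> \<rho> = \<zero>\<^bsub>E (Suc 0)\<^esub>" if "a \<in> A" for a
    using that \<tau> \<tau>'c annihilatedD[OF \<tau>'(1)] subset_adjoin[OF A(1) b(1)] Ac
    by (auto simp: \<rho>_def E.smult_minus_distr)
  have b\<rho>: "b \<odot>\<^bsub>E (Suc 0)\<^esub> \<rho> = s \<odot>\<^bsub>E (Suc 0)\<^esub> \<sigma>"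
    using b \<tau> \<tau>'c annihilatedD[OF \<tau>'(1)] self_mem_adjoin[OF A(1) b(1)] s \<sigma>
    by (simp add: \<rho>_def E.smult_minus_distr)
  have d\<rho>: "d (Suc 0) \<rho> = \<zero>\<^bsub>E (Suc (Suc 0))\<^esub>"
    using \<tau>(1) \<tau>'c \<tau>'(2) by (simp add: \<rho>_def d_minus)
  obtain \<eta> where \<eta>: "\<eta> \<in> carrier (E 0)" "d 0 \<eta> = \<rho>" by (rule exact[OF \<rho> d\<rho>])
  have "d 0 (x \<odot>\<^bsub>E 0\<^esub> \<eta>) = \<zero>\<^bsub>E (Suc 0)\<^esub>" using \<eta> xc A\<rho>[OF A(2)] by (simp add: d_smult)
  then obtain w where w: "w \<in> carrier R" "x \<odot>\<^bsub>E 0\<^esub> \<eta> = e w"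
    using exact_0[of "x \<odot>\<^bsub>E 0\<^esub> \<eta>"] \<eta> xc by auto
  \<comment> \<open>Up to an element annihilated by \<open>x\<close>, the lift \<open>\<eta>\<close> is \<open>w / x\<close>.\<close>
  have key: "c \<otimes> w \<ominus> r \<in> PIdl x"
    if c: "c \<in> carrier R" and r: "r \<in> carrier R" "c \<odot>\<^bsub>E (Suc 0)\<^esub> \<rho> = r \<odot>\<^bsub>E (Suc 0)\<^esub> \<sigma>" for c r
  proof (rule faithful)
    let ?\<zeta> = "c \<odot>\<^bsub>E 0\<^esub> (w \<odot>\<^bsub>E 0\<^esub> f0 \<ominus>\<^bsub>E 0\<^esub> \<eta>)"
    show "c \<otimes> w \<ominus> r \<in> carrier R" "?\<zeta> \<in> carrier (E 0)" using c r w f0 \<eta> by auto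
    have "x \<odot>\<^bsub>E 0\<^esub> (w \<odot>\<^bsub>E 0\<^esub> f0) = e w"
      using E.smult_commute[OF xc w(1) f0(1)] f0(2) w(1) e_mult[OF w(1) one_closed] by simp
    then have "x \<odot>\<^bsub>E 0\<^esub> (w \<odot>\<^bsub>E 0\<^esub> f0 \<ominus>\<^bsub>E 0\<^esub> \<eta>) = \<zero>\<^bsub>E 0\<^esub>"
      using xc w f0(1) \<eta>(1) by (simp add: E.smult_minus_distr)
    then show "x \<odot>\<^bsub>E 0\<^esub> ?\<zeta> = \<zero>\<^bsub>E 0\<^esub>"
      using E.smult_commute[OF xc c, of "w \<odot>\<^bsub>E 0\<^esub> f0 \<ominus>\<^bsub>E 0\<^esub> \<eta>" 0] c w f0(1) \<eta>(1) by simp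
    show "d 0 ?\<zeta> = (c \<otimes> w \<ominus> r) \<odot>\<^bsub>E (Suc 0)\<^esub> \<sigma>"
      using c r w f0(1) \<eta> \<sigma>
      by (simp add: d_smult d_minus E.smult_minus_distr E.smult_minus_ldistr E.smult_assoc1 flip: \<sigma>_def)
  qed
  show ?thesis
  proof (rule that[OF w(1)])
    fix a assume a: "a \<in> A"
    then have "a \<otimes> w \<ominus> \<zero> \<in> PIdl x" using key[of a \<zero>] Ac A\<rho> \<sigma> by simp
    then show "a \<otimes> w \<in> PIdl x" using Ac[OF a] w by (simp add: minus_zero_right)
  next
    have diff: "b \<otimes> w \<ominus> s \<in> PIdl x" using key b b\<rho> s by blast
    show "b \<otimes> w \<notin> PIdl x"
    proof
      assume "b \<otimes> w \<in> PIdl x"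
      then have "b \<otimes> w \<ominus> (b \<otimes> w \<ominus> s) \<in> PIdl x" using diff ideal_minus[OF xI] by blast
      moreover have "b \<otimes> w \<ominus> (b \<otimes> w \<ominus> s) = s" using b(1) w(1) s(1) by algebra
      ultimately show False using s by simp
    qed
  qed
qed

end

section \<open>Powers and multiples of ideals\<close>

context cring
begin

lemma ideal_prod_subset:
  assumes "ideal K R" "\<And>u v. u \<in> A \<Longrightarrow> v \<in> B \<Longrightarrow> u \<otimes> v \<in> K"
  shows "ideal_prod R A B \<subseteq> K"
proof
  fix w assume "w \<in> ideal_prod R A B"
  then show "w \<in> K"
    by (induction rule: ideal_prod.induct) (use assms ideal_add in auto)
qed

lemma ideal_power_ideal: "ideal A R \<Longrightarrow> ideal (ideal_power R A n) R"
  by (induction n) (simp_all add: ideal_power_0 ideal_power_Suc oneideal ideal_prod_is_ideal)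

lemma ideal_power_add:
  assumes A: "ideal A R"
  shows "ideal_power R A (m + n) = ideal_prod R (ideal_power R A m) (ideal_power R A n)"
proof (induction n)
  case 0
  then show ?case using ideal_prod_one[OF ideal_power_ideal[OF A]] by (simp add: ideal_power_0)
next
  case (Suc n)
  then show ?case
    using ideal_prod_assoc[OF ideal_power_ideal[OF A] ideal_power_ideal[OF A] A]
    by (simp add: ideal_power_Suc)
qed

lemma ideal_power_mult_mem:
  assumes "ideal A R" "u \<in> ideal_power R A m" "v \<in> ideal_power R A n"
  shows "u \<otimes> v \<in> ideal_power R A (m + n)"
  unfolding ideal_power_add[OF assms(1)] using assms(2,3) by (rule ideal_prod.prod)

lemma ideal_power_1: "ideal A R \<Longrightarrow> ideal_power R A 1 = A"
  using ideal_prod_one ideal_prod_commute[OF oneideal]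
  by (simp add: ideal_power_0 ideal_power_Suc)

lemma ideal_power_mult_mem_Suc:
  assumes "ideal A R" "u \<in> A" "v \<in> ideal_power R A n"
  shows "u \<otimes> v \<in> ideal_power R A (Suc n)"
  using ideal_power_mult_mem[OF assms(1), of u 1 v n] assms ideal_power_1 by simp

lemma elem_power_mem:
  assumes "ideal A R" "a \<in> ideal_power R A k" shows "a [^] (n::nat) \<in> ideal_power R A (k * n)"
proof (induction n)
  case 0
  then show ?case by (simp add: ideal_power_0)
next
  case (Suc n)
  have "a [^] n \<otimes> a \<in> ideal_power R A (k * n + k)"
    by (rule ideal_power_mult_mem[OF assms(1) Suc assms(2)])
  then show ?case by (simp add: add.commute)
qed

lemma elem_power_mem_1: "ideal A R \<Longrightarrow> a \<in> A \<Longrightarrow> a [^] (n::nat) \<in> ideal_power R A n"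
  using elem_power_mem[of A a 1 n] ideal_power_1 by simp

lemma ideal_power_mono:
  assumes "ideal A R" "ideal B R" "A \<subseteq> B"
  shows "ideal_power R A n \<subseteq> ideal_power R B n"
proof (induction n)
  case 0
  then show ?case by (simp add: ideal_power_0)
next
  case (Suc n)
  have "u \<otimes> v \<in> ideal_power R B (Suc n)" if "u \<in> ideal_power R A n" "v \<in> A" for u v
    unfolding ideal_power_Suc using that Suc assms(3) by (intro ideal_prod.prod) auto
  then show ?case
    unfolding ideal_power_Suc[of R A] by (intro ideal_prod_subset ideal_power_ideal assms)
qed

definition mult_ideal :: "'a \<Rightarrow> 'a set \<Rightarrow> 'a set"
  where "mult_ideal a A = (\<lambda>u. a \<otimes> u) ` A"

lemma mult_idealI: "u \<in> A \<Longrightarrow> a \<otimes> u \<in> mult_ideal a A"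
  by (simp add: mult_ideal_def)

lemma mult_idealE:
  assumes "v \<in> mult_ideal a A" obtains u where "u \<in> A" "v = a \<otimes> u"
  using assms by (auto simp: mult_ideal_def)

lemma ideal_mult_ideal:
  assumes A: "ideal A R" and a: "a \<in> carrier R" shows "ideal (mult_ideal a A) R"
proof (rule idealI_cring)
  have Ac: "u \<in> carrier R" if "u \<in> A" for u using ideal_in_carrier[OF A that] .
  show "mult_ideal a A \<subseteq> carrier R" using a Ac by (auto simp: mult_ideal_def)
  have "a \<otimes> \<zero> \<in> mult_ideal a A" by (rule mult_idealI[OF ideal_zero[OF A]])
  then show "\<zero> \<in> mult_ideal a A" using a by simp
  show "x \<oplus> y \<in> mult_ideal a A" if xy: "x \<in> mult_ideal a A" "y \<in> mult_ideal a A" for x y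
  proof -
    obtain u v where *: "u \<in> A" "v \<in> A" "x = a \<otimes> u" "y = a \<otimes> v" using xy by (auto elim!: mult_idealE)
    then have "x \<oplus> y = a \<otimes> (u \<oplus> v)" using a Ac by (simp add: r_distr)
    then show ?thesis using mult_idealI[OF ideal_add[OF A *(1,2)]] by simp
  qed
  show "r \<otimes> x \<in> mult_ideal a A" if r: "r \<in> carrier R" and x: "x \<in> mult_ideal a A" for r x
  proof -
    obtain u where *: "u \<in> A" "x = a \<otimes> u" using x by (auto elim!: mult_idealE)
    then have "r \<otimes> x = a \<otimes> (r \<otimes> u)" using a r Ac by (simp add: m_lcomm)
    then show ?thesis using mult_idealI[OF ideal_mult_l[OF A r *(1)]] by simp
  qed
qed

lemma mult_ideal_mono: "A \<subseteq> B \<Longrightarrow> mult_ideal a A \<subseteq> mult_ideal a B"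
  by (auto simp: mult_ideal_def)

lemma mult_ideal_subset: "ideal A R \<Longrightarrow> a \<in> carrier R \<Longrightarrow> mult_ideal a A \<subseteq> A"
  by (auto simp: mult_ideal_def ideal_mult_l)

lemma mult_ideal_power_subset:
  "ideal A R \<Longrightarrow> a \<in> A \<Longrightarrow> mult_ideal a (ideal_power R A n) \<subseteq> ideal_power R A (Suc n)"
  by (auto simp: mult_ideal_def ideal_power_mult_mem_Suc)

lemma PIdl_prod_eq_mult_ideal:
  assumes A: "ideal A R" and a: "a \<in> carrier R"
  shows "ideal_prod R (PIdl a) A = mult_ideal a A"
proof
  show "ideal_prod R (PIdl a) A \<subseteq> mult_ideal a A"
  proof (rule ideal_prod_subset[OF ideal_mult_ideal[OF A a]])
    fix u v assume uv: "u \<in> PIdl a" "v \<in> A"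
    then obtain r where r: "r \<in> carrier R" "u = r \<otimes> a" unfolding cgenideal_def by blast
    have "u \<otimes> v = a \<otimes> (r \<otimes> v)" using r a ideal_in_carrier[OF A uv(2)] by (simp add: m_ac)
    then show "u \<otimes> v \<in> mult_ideal a A" using mult_idealI ideal_mult_l[OF A r(1) uv(2)] by simp
  qed
  show "mult_ideal a A \<subseteq> ideal_prod R (PIdl a) A"
    using cgenideal_self[OF a] by (auto simp: mult_ideal_def intro: ideal_prod.prod)
qed

lemma ideal_power_PIdl:
  assumes a: "a \<in> carrier R"
  shows "ideal_power R (PIdl a) n = PIdl (a [^] n)"
proof (induction n)
  case 0
  then show ?case using cgenideal_ideal[OF one_closed] ideal_eq_carrier_iff cgenideal_self by (simp add: ideal_power_0) blast
next
  case (Suc n)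
  have "ideal_power R (PIdl a) (Suc n) = ideal_prod R (PIdl a) (PIdl (a [^] n))"
    unfolding ideal_power_Suc Suc
    using a by (intro ideal_prod_commute cgenideal_ideal) auto
  also have "\<dots> = mult_ideal a (PIdl (a [^] n))"
    using a by (intro PIdl_prod_eq_mult_ideal cgenideal_ideal) auto
  also have "\<dots> = PIdl (a [^] Suc n)"
  proof -
    have "a \<otimes> (x \<otimes> a [^] n) = x \<otimes> (a [^] n \<otimes> a)" if "x \<in> carrier R" for x
      using that a by (simp add: m_ac)
    then show ?thesis by (force simp: mult_ideal_def cgenideal_def image_iff)
  qed
  finally show ?case .
qed

lemma ideal_power_absorb:
  assumes A: "ideal A R" and x: "x \<in> carrier R"
    and red: "ideal_power R A (Suc n) \<subseteq> mult_ideal x (ideal_power R A n)"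
  shows "ideal_power R A (Suc (n + k)) \<subseteq> mult_ideal x (ideal_power R A (n + k))"
proof (induction k)
  case 0
  then show ?case using red by simp
next
  case (Suc k)
  have "u \<otimes> v \<in> mult_ideal x (ideal_power R A (n + Suc k))"
    if u: "u \<in> ideal_power R A (Suc (n + k))" and v: "v \<in> A" for u v
  proof -
    obtain w where w: "w \<in> ideal_power R A (n + k)" "u = x \<otimes> w"
      using Suc u by (auto elim!: mult_idealE)
    have "w \<in> carrier R" "v \<in> carrier R"
      using ideal_in_carrier[OF ideal_power_ideal[OF A] w(1)] ideal_in_carrier[OF A v] by auto
    then have "u \<otimes> v = x \<otimes> (v \<otimes> w)" using w x by (simp add: m_ac)
    then show ?thesis using mult_idealI ideal_power_mult_mem_Suc[OF A v w(1)] by simp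
  qed
  then have "ideal_prod R (ideal_power R A (Suc (n + k))) A \<subseteq> mult_ideal x (ideal_power R A (n + Suc k))"
    by (intro ideal_prod_subset ideal_mult_ideal ideal_power_ideal A x)
  then show ?case by (simp add: ideal_power_Suc)
qed

end

section \<open>Colength\<close>

context cring
begin

text \<open>\<open>colength_le k B\<close> means that every chain of ideals starting in \<open>B\<close> has length at most \<open>k\<close>,
  that is, \<open>R / B\<close> has length at most \<open>k\<close>.\<close>

primrec colength_le :: "nat \<Rightarrow> 'a set \<Rightarrow> bool"
  where "colength_le 0 B \<longleftrightarrow> B = carrier R"
  | "colength_le (Suc k) B \<longleftrightarrow> (\<forall>C. ideal C R \<and> B \<subset> C \<longrightarrow> colength_le k C)"

lemma colength_le_mono:
  assumes "colength_le k B" "B \<subseteq> C" "ideal C R" shows "colength_le k C"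
proof (cases k)
  case 0
  then show ?thesis using assms ideal_in_carrier by auto
next
  case (Suc j)
  then show ?thesis using assms by auto
qed

lemma colength_le_psubset:
  assumes "colength_le k B" "B \<subset> C" "ideal C R"
  obtains j where "k = Suc j" "colength_le j C"
proof (cases k)
  case 0
  then have "C \<subseteq> B" using assms ideal_in_carrier by auto
  then show ?thesis using assms by blast
next
  case (Suc j)
  then show ?thesis using assms that by auto
qed

text \<open>Additivity of length in \<open>0 \<rightarrow> R / (D : x) \<rightarrow> R / D \<rightarrow> R / (D + (x)) \<rightarrow> 0\<close>: a proper
  enlargement of \<open>D\<close> properly enlarges \<open>D : x\<close> or \<open>D + (x)\<close>.\<close>

lemma colength_le_add:
  assumes "ideal D R" "x \<in> carrier R"
    and "colength_le k (elem_colon D x)" "colength_le l (adjoin D x)"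
  shows "colength_le (k + l) D"
  using assms(1,3,4)
proof (induction "k + l" arbitrary: k l D)
  case 0
  then have *: "elem_colon D x = carrier R" "adjoin D x = carrier R" by auto
  then have "\<one> \<in> elem_colon D x" by simp
  then have "x \<in> D" using assms(2) by (simp add: elem_colon_def)
  then have "adjoin D x \<subseteq> D" by (intro adjoin_minimal) (use 0 in auto)
  then have "D = carrier R" using * ideal_in_carrier[OF 0(2)] by auto
  then show ?case using 0 by simp
next
  case (Suc n)
  have "colength_le n D'" if D': "ideal D' R" "D \<subset> D'" for D'
  proof -
    have c: "ideal (elem_colon D' x) R" "ideal (adjoin D' x) R"
      using ideal_elem_colon ideal_adjoin D' assms(2) by auto
    have sub: "elem_colon D x \<subseteq> elem_colon D' x" "adjoin D x \<subseteq> adjoin D' x"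
      using D' by (auto simp: elem_colon_def adjoin_def)
    show ?thesis
    proof (cases "elem_colon D x = elem_colon D' x")
      case False
      then have "elem_colon D x \<subset> elem_colon D' x" using sub by blast
      then obtain j where j: "k = Suc j" "colength_le j (elem_colon D' x)"
        by (rule colength_le_psubset[OF Suc.prems(2) _ c(1)])
      have "n = j + l" using Suc.hyps(2) j by simp
      then show ?thesis
        using Suc.hyps(1)[of j l D'] D' j colength_le_mono[OF Suc.prems(3) sub(2) c(2)] by blast
    next
      case True
      have "adjoin D x \<noteq> adjoin D' x"
      proof
        assume eq: "adjoin D x = adjoin D' x"
        obtain v where v: "v \<in> D'" "v \<notin> D" using D' by blast
        have vc: "v \<in> carrier R" using v D' ideal_in_carrier by blast
        have "v \<in> adjoin D x" using eq v subset_adjoin[OF D'(1) assms(2)] by blast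
        then obtain u r where u: "u \<in> D" "r \<in> carrier R" "v = u \<oplus> r \<otimes> x" by (auto simp: mem_adjoin)
        have uc: "u \<in> carrier R" using u Suc.prems ideal_in_carrier by blast
        have "r \<otimes> x = v \<ominus> u" unfolding u(3) using u(2) uc assms(2) by algebra
        moreover have "v \<ominus> u \<in> D'" using ideal_minus[OF D'(1) v(1), of u] u(1) D'(2) by blast
        ultimately have "r \<otimes> x \<in> D'" by simp
        then have "r \<in> elem_colon D x" using u True by (simp add: elem_colon_def)
        then have "r \<otimes> x \<in> D" by (simp add: elem_colon_def)
        then show False using u v ideal_add[OF Suc.prems(1)] by blast
      qed
      then have "adjoin D x \<subset> adjoin D' x" using sub by blast
      then obtain j where j: "l = Suc j" "colength_le j (adjoin D' x)"
        by (rule colength_le_psubset[OF Suc.prems(3) _ c(2)])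
      have "n = k + j" using Suc.hyps(2) j by simp
      then show ?thesis
        using Suc.hyps(1)[of k j D'] D' j Suc.prems(2) True by simp
    qed
  qed
  then show ?case unfolding Suc.hyps(2)[symmetric] by simp
qed

text \<open>Multiplication by \<open>x\<close> maps \<open>R / A\<close> onto \<open>(x) / x A\<close>. Together with additivity on
  \<open>x A \<subseteq> A\<close> this bounds the length of \<open>A / x A\<close> by that of \<open>R / (x)\<close>, uniformly in \<open>A\<close>.\<close>

lemma colength_le_mult_ideal:
  assumes A: "ideal A R" and x: "x \<in> carrier R"
    and "colength_le k A" "colength_le l (PIdl x)"
  shows "colength_le (k + l) (mult_ideal x A)"
proof (rule colength_le_add[OF ideal_mult_ideal[OF A x] x])
  have "A \<subseteq> elem_colon (mult_ideal x A) x"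
    using ideal_in_carrier[OF A] x by (auto simp: elem_colon_def mult_ideal_def m_comm)
  then show "colength_le k (elem_colon (mult_ideal x A) x)"
    using colength_le_mono assms ideal_elem_colon ideal_mult_ideal by blast
  have "PIdl x \<subseteq> adjoin (mult_ideal x A) x"
    using cgenideal_minimal ideal_adjoin[OF ideal_mult_ideal[OF A x] x]
      self_mem_adjoin[OF ideal_mult_ideal[OF A x] x] by blast
  then show "colength_le l (adjoin (mult_ideal x A) x)"
    using colength_le_mono assms ideal_adjoin[OF ideal_mult_ideal[OF A x] x] by blast
qed

end

lemma (in noetherian_local_ring) max_primary_colength:
  assumes "max_primary B" shows "\<exists>k. colength_le k B"
proof -
  have "ideal B R" using assms max_primary_ideal by blast
  then show ?thesis using assms
  proof (induction B rule: ideal_noetherian_induct)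
    case (step B)
    show ?case
    proof (cases "B = carrier R")
      case True
      then have "colength_le 0 B" by simp
      then show ?thesis by blast
    next
      case False
      then have "\<one> \<notin> B" using ideal_eq_carrier_iff step by blast
      then obtain c where c: "c \<in> carrier R" "c \<notin> B" "elem_colon B c = \<mm>"
        using max_primary_colon step.prems by metis
      have cI: "ideal (adjoin B c) R" using ideal_adjoin step c by blast
      have sub: "B \<subset> adjoin B c"
        using subset_adjoin[OF step(1) c(1)] self_mem_adjoin[OF step(1) c(1)] c(2) by blast
      have "max_primary (adjoin B c)" using max_primary_mono[OF step.prems _ cI] sub by blast
      then obtain l where l: "colength_le l (adjoin B c)" using step.IH[OF cI sub] by blast
      have "colength_le (Suc 0) \<mm>"
        using proper_ideal_subset_max ideal_eq_carrier_iff by (auto simp: psubset_eq)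
      then have "colength_le (Suc 0) (elem_colon B c)" unfolding c(3) .
      then have "colength_le (Suc 0 + l) B" by (rule colength_le_add[OF step(1) c(1) _ l])
      then show ?thesis by blast
    qed
  qed
qed

section \<open>Principal reductions\<close>

context cring
begin

definition nat_embed :: "nat \<Rightarrow> 'a"
  where "nat_embed n = add_pow R n \<one>"

lemma nat_embed_closed [simp]: "nat_embed n \<in> carrier R"
  by (simp add: nat_embed_def)

lemma nat_embed_0 [simp]: "nat_embed 0 = \<zero>"
  by (simp add: nat_embed_def)

lemma nat_embed_add: "nat_embed (m + n) = nat_embed m \<oplus> nat_embed n"
  by (simp add: nat_embed_def add.nat_pow_mult)

lemma nat_embed_1 [simp]: "nat_embed (Suc 0) = \<one>"
  by (simp add: nat_embed_def)

lemma nat_embed_Suc: "nat_embed (Suc n) = \<one> \<oplus> nat_embed n"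
  using nat_embed_add[of 1 n] by simp

definition line :: "'a \<Rightarrow> 'a \<Rightarrow> nat \<Rightarrow> 'a"
  where "line a b i = a \<oplus> nat_embed i \<otimes> b"

lemma line_closed [simp]: "a \<in> carrier R \<Longrightarrow> b \<in> carrier R \<Longrightarrow> line a b i \<in> carrier R"
  by (simp add: line_def)

lemma line_mem: "ideal A R \<Longrightarrow> a \<in> A \<Longrightarrow> b \<in> A \<Longrightarrow> line a b i \<in> A"
  by (simp add: line_def ideal_add ideal_mult_l)

lemma line_add:
  assumes "a \<in> carrier R" "b \<in> carrier R"
  shows "line a b (i + k) = line a b i \<oplus> nat_embed k \<otimes> b"
  using assms by (simp add: line_def nat_embed_add l_distr a_assoc)

abbreviation pair_ideal :: "'a \<Rightarrow> 'a \<Rightarrow> 'a set"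
  where "pair_ideal a b \<equiv> adjoin (PIdl a) b"

lemma pair_ideal:
  assumes "a \<in> carrier R" "b \<in> carrier R"
  shows "ideal (pair_ideal a b) R" "a \<in> pair_ideal a b" "b \<in> pair_ideal a b"
  using ideal_adjoin[OF cgenideal_ideal[OF assms(1)] assms(2)]
    self_mem_adjoin[OF cgenideal_ideal[OF assms(1)] assms(2)]
    subsetD[OF subset_adjoin[OF cgenideal_ideal[OF assms(1)] assms(2)] cgenideal_self[OF assms(1)]]
  by simp_all

lemma pair_ideal_minimal:
  assumes "ideal B R" "a \<in> B" "b \<in> B" shows "pair_ideal a b \<subseteq> B"
  by (rule adjoin_minimal[OF assms(1) cgenideal_minimal[OF assms(1,2)] assms(3)])

lemma pair_ideal_line:
  assumes a: "a \<in> carrier R" and b: "b \<in> carrier R"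
  shows "pair_ideal (line a b i) b = pair_ideal a b"
proof
  show "pair_ideal (line a b i) b \<subseteq> pair_ideal a b"
    using pair_ideal[OF a b] by (intro pair_ideal_minimal line_mem)
  note P = pair_ideal[OF line_closed[OF a b] b, of i]
  have "line a b i \<ominus> nat_embed i \<otimes> b \<in> pair_ideal (line a b i) b"
    by (intro ideal_minus ideal_mult_l P nat_embed_closed)
  moreover have "line a b i \<ominus> nat_embed i \<otimes> b = a"
    unfolding line_def using a b nat_embed_closed[of i] by algebra
  ultimately have "a \<in> pair_ideal (line a b i) b" by simp
  then show "pair_ideal a b \<subseteq> pair_ideal (line a b i) b"
    by (intro pair_ideal_minimal P)
qed

text \<open>The power is generated by monomials in \<open>c\<close> and \<open>b\<close>, and all of them but the last are
  divisible by \<open>c\<close>.\<close>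

lemma pair_ideal_power_subset:
  assumes c: "c \<in> carrier R" and b: "b \<in> carrier R"
  shows "ideal_power R (pair_ideal c b) (Suc n)
    \<subseteq> adjoin (mult_ideal c (ideal_power R (pair_ideal c b) n)) (b [^] Suc n)"
proof -
  let ?P = "pair_ideal c b"
  note P = pair_ideal[OF c b]
  have PI: "ideal (ideal_power R ?P k) R" for k by (rule ideal_power_ideal[OF P(1)])
  have bc: "b [^] k \<in> carrier R" for k :: nat using b by simp
  have cI: "ideal (mult_ideal c (ideal_power R ?P k)) R" for k by (rule ideal_mult_ideal[OF PI c])
  have ad: "ideal (adjoin (mult_ideal c (ideal_power R ?P n)) (b [^] Suc n)) R" for n
    by (rule ideal_adjoin[OF cI bc])
  show ?thesis
  proof (induction n)
    case 0
    have "c \<otimes> \<one> \<in> mult_ideal c (ideal_power R ?P 0)"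
      by (rule mult_idealI) (simp add: ideal_power_0)
    then have "c \<in> adjoin (mult_ideal c (ideal_power R ?P 0)) (b [^] Suc 0)"
      using subset_adjoin[OF cI bc, of 0 "Suc 0"] c by auto
    moreover have "b \<in> adjoin (mult_ideal c (ideal_power R ?P 0)) (b [^] Suc 0)"
      using self_mem_adjoin[OF cI bc, of "Suc 0" 0] b by simp
    ultimately show ?case
      using pair_ideal_minimal[OF ad, of c 0] ideal_power_1[OF P(1)] by simp
  next
    case (Suc n)
    let ?K = "adjoin (mult_ideal c (ideal_power R ?P (Suc n))) (b [^] Suc (Suc n))"
    have "u \<otimes> p \<in> ?K" if u: "u \<in> ideal_power R ?P (Suc n)" and p: "p \<in> ?P" for u p
    proof -
      obtain v t where v: "v \<in> ideal_power R ?P n" "t \<in> carrier R" "u = c \<otimes> v \<oplus> t \<otimes> b [^] Suc n"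
      proof -
        have "u \<in> adjoin (mult_ideal c (ideal_power R ?P n)) (b [^] Suc n)" using Suc u by blast
        then obtain y t where "y \<in> mult_ideal c (ideal_power R ?P n)" "t \<in> carrier R"
          "u = y \<oplus> t \<otimes> b [^] Suc n" unfolding mem_adjoin by blast
        then show ?thesis using that by (auto elim!: mult_idealE)
      qed
      obtain r q where p': "r \<in> carrier R" "q \<in> carrier R" "p = r \<otimes> c \<oplus> q \<otimes> b"
        using p by (auto simp: mem_adjoin cgenideal_def)
      have vc: "v \<in> carrier R" using v PI ideal_in_carrier by blast
      have pc: "p \<in> carrier R" using p P ideal_in_carrier by blast
      define w where "w = p \<otimes> v \<oplus> (t \<otimes> r) \<otimes> b [^] Suc n"
      have w: "w \<in> ideal_power R ?P (Suc n)"
        unfolding w_def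
        using v(2) p'(1)
        by (intro ideal_add[OF PI ideal_power_mult_mem_Suc[OF P(1) p v(1)]
              ideal_mult_l[OF PI _ elem_power_mem_1[OF P(1,3)]]]) simp
      have "u \<otimes> p = c \<otimes> (p \<otimes> v) \<oplus> (t \<otimes> b [^] Suc n) \<otimes> p"
        unfolding v(3) using v(2) vc pc c bc[of "Suc n"] by algebra
      also have "(t \<otimes> b [^] Suc n) \<otimes> p = c \<otimes> ((t \<otimes> r) \<otimes> b [^] Suc n) \<oplus> (t \<otimes> q) \<otimes> (b [^] Suc n \<otimes> b)"
        unfolding p'(3) using p'(1,2) v(2) c b bc[of "Suc n"] by algebra
      also have "c \<otimes> (p \<otimes> v) \<oplus> (c \<otimes> ((t \<otimes> r) \<otimes> b [^] Suc n) \<oplus> (t \<otimes> q) \<otimes> (b [^] Suc n \<otimes> b))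
          = c \<otimes> w \<oplus> (t \<otimes> q) \<otimes> (b [^] Suc n \<otimes> b)"
        unfolding w_def using p'(1,2) v(2) vc pc c b bc[of "Suc n"] by algebra
      finally have "u \<otimes> p = c \<otimes> w \<oplus> (t \<otimes> q) \<otimes> b [^] Suc (Suc n)"
        by (simp only: nat_pow_Suc[of b "Suc n"])
      then show ?thesis
        unfolding mem_adjoin using mult_idealI[OF w] p'(2) v(2) by blast
    qed
    then show ?case
      unfolding ideal_power_Suc[of R ?P "Suc n"] by (intro ideal_prod_subset ad)
  qed
qed

lemma Units_minus: "u \<in> Units R \<Longrightarrow> \<ominus> u \<in> Units R"
  by (metis Units_closed Units_minus_one_closed Units_m_closed l_minus l_one one_closed)

text \<open>Applied to all chosen points of a line but \<open>c\<close>, this says that their product generates the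
  corresponding power of \<open>(c, b)\<close> modulo \<open>c\<close>.\<close>

lemma finprod_unit_shift:
  assumes "finite F" and c: "c \<in> carrier R" and b: "b \<in> carrier R"
    and f: "\<And>i. i \<in> F \<Longrightarrow> \<exists>u\<in>Units R. f i = c \<oplus> u \<otimes> b"
  shows "\<exists>u\<in>Units R. \<exists>v\<in>ideal_power R (pair_ideal c b) (card F - 1).
    finprod R f F = u \<otimes> b [^] card F \<oplus> c \<otimes> v"
  using assms(1) f
proof (induction F)
  case empty
  have "finprod R f {} = \<one> \<otimes> b [^] card {} \<oplus> c \<otimes> \<zero>" using c by simp
  moreover have "\<zero> \<in> ideal_power R (pair_ideal c b) (card {} - 1)" by (simp add: ideal_power_0)
  ultimately show ?case using Units_one_closed by blast
next
  case (insert k F)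
  let ?P = "pair_ideal c b"
  note P = pair_ideal[OF c b]
  have PI: "ideal (ideal_power R ?P k) R" for k by (rule ideal_power_ideal[OF P(1)])
  obtain u v where uv: "u \<in> Units R" "v \<in> ideal_power R ?P (card F - 1)"
    "finprod R f F = u \<otimes> b [^] card F \<oplus> c \<otimes> v"
    using insert by auto
  obtain t where t: "t \<in> Units R" "f k = c \<oplus> t \<otimes> b" using insert by auto
  have vc: "v \<in> carrier R" using uv PI ideal_in_carrier by blast
  have uc: "u \<in> carrier R" and tc: "t \<in> carrier R" using uv t Units_closed by auto
  have fc: "f \<in> F \<rightarrow> carrier R" "f k \<in> carrier R"
  proof -
    show "f \<in> F \<rightarrow> carrier R"
    proof
      fix i assume "i \<in> F"
      then obtain s where "s \<in> Units R" "f i = c \<oplus> s \<otimes> b" using insert.prems by auto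
      then show "f i \<in> carrier R" using c b Units_closed by auto
    qed
    show "f k \<in> carrier R" using t tc c b by simp
  qed
  define w where "w = u \<otimes> b [^] card F \<oplus> (c \<oplus> t \<otimes> b) \<otimes> v"
  have bF: "b [^] card F \<in> carrier R" using b by simp
  have "(c \<oplus> t \<otimes> b) \<otimes> v \<in> ideal_power R ?P (card F)"
  proof (cases "card F")
    case 0
    then show ?thesis using vc c b tc by (simp add: ideal_power_0)
  next
    case (Suc m)
    have "c \<oplus> t \<otimes> b \<in> ?P" using P tc by (intro ideal_add ideal_mult_l)
    then show ?thesis using ideal_power_mult_mem_Suc[OF P(1)] uv(2) Suc by simp
  qed
  then have w: "w \<in> ideal_power R ?P (card F)"
    unfolding w_def
    by (rule ideal_add[OF PI ideal_mult_l[OF PI uc elem_power_mem_1[OF P(1,3)]]])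
  have "finprod R f (insert k F) = (c \<oplus> t \<otimes> b) \<otimes> (u \<otimes> b [^] card F \<oplus> c \<otimes> v)"
    using insert.hyps fc uv t by simp
  also have "\<dots> = (t \<otimes> u) \<otimes> (b [^] card F \<otimes> b) \<oplus> c \<otimes> w"
    unfolding w_def using tc uc vc c b bF by algebra
  finally have "finprod R f (insert k F) = (t \<otimes> u) \<otimes> b [^] card (insert k F) \<oplus> c \<otimes> w"
    using insert.hyps by simp
  moreover have "t \<otimes> u \<in> Units R" using t uv by simp
  moreover have "w \<in> ideal_power R ?P (card (insert k F) - 1)" using w insert.hyps by simp
  ultimately show ?case by blast
qed

lemma finprod_mem_ideal_power:
  assumes A: "ideal A R" and "finite F" "\<And>i. i \<in> F \<Longrightarrow> f i \<in> A"
  shows "finprod R f F \<in> ideal_power R A (card F)"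
  using assms(2,3)
proof (induction F)
  case empty
  then show ?case by (simp add: ideal_power_0)
next
  case (insert k F)
  have "f \<in> F \<rightarrow> carrier R" "f k \<in> carrier R" using insert.prems ideal_in_carrier[OF A] by auto
  then have "finprod R f (insert k F) = f k \<otimes> finprod R f F" using insert.hyps by simp
  then show ?case using ideal_power_mult_mem_Suc[OF A] insert by simp
qed

end

locale one_dim_local_CM_Q_algebra = one_dim_local_CM_ring +
  assumes nat_embed_Unit: "n > 0 \<Longrightarrow> nat_embed n \<in> Units R"
begin

lemma line_shift:
  assumes "a \<in> carrier R" "b \<in> carrier R" "i \<noteq> j"
  shows "\<exists>u\<in>Units R. line a b j = line a b i \<oplus> u \<otimes> b"
proof (cases "i < j")
  case True
  then show ?thesis using line_add[OF assms(1,2), of i "j - i"] nat_embed_Unit[of "j - i"] by auto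
next
  case False
  then have ji: "j < i" using assms(3) by simp
  let ?u = "nat_embed (i - j)"
  have u: "?u \<in> Units R" using nat_embed_Unit ji by simp
  have eq: "line a b i = line a b j \<oplus> ?u \<otimes> b" using line_add[OF assms(1,2), of j "i - j"] ji by simp
  have "line a b j = line a b i \<oplus> (\<ominus> ?u) \<otimes> b"
    unfolding eq using assms(1,2) line_closed[OF assms(1,2), of j] nat_embed_closed[of "i - j"] by algebra
  then show ?thesis using Units_minus[OF u] by blast
qed

lemma max_primary_if_power_dvd:
  assumes x: "x \<in> carrier R" "max_primary (PIdl x)" and B: "ideal B R" "x [^] (n::nat) \<in> B"
  shows "max_primary B"
  unfolding max_primary_def
proof (intro conjI allI impI B)
  fix Q assume Q: "primeideal Q R \<and> B \<subseteq> Q"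
  then have "x \<in> Q" using B prime_pow_mem x by blast
  then have "PIdl x \<subseteq> Q" using cgenideal_minimal Q primeideal.axioms(1) by blast
  then show "Q = \<mm>" using x Q unfolding max_primary_def by blast
qed

text \<open>Let \<open>k = l + 1\<close> bound the length of \<open>R / (a)\<close>, and hence the length of \<open>P\<^sup>k / a P\<^sup>k\<close> for
  \<open>P = (a, b)\<close>. Take \<open>k + 1\<close> points of the line through \<open>a\<close> in the direction of \<open>b\<close>, and the
  \<open>k + 1\<close> products of all of them but one. Adding these products to \<open>a P\<^sup>k\<close> one after the other
  cannot give a strictly increasing chain, and all products but the one missing \<open>c\<close> lie in
  \<open>c P\<^bsup>k-1\<^esup>\<close>; so for some \<open>c\<close> the product missing \<open>c\<close> lies in \<open>a P\<^sup>k + c P\<^bsup>k-1\<^esup>\<close>. As this product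
  generates \<open>P\<^sup>k\<close> modulo \<open>c P\<^bsup>k-1\<^esup>\<close> and \<open>a \<in> \<mm>\<close>, the whole of \<open>P\<^sup>k\<close> is \<open>c P\<^bsup>k-1\<^esup>\<close>.\<close>

lemma ex_line_reduction:
  assumes a: "a \<in> \<mm>" "max_primary (PIdl a)" and b: "b \<in> carrier R"
    and len: "colength_le (Suc l) (PIdl a)" and S: "finite S" "card S = Suc (Suc l)"
  shows "\<exists>i\<in>S. ideal_power R (pair_ideal a b) (Suc l)
    \<subseteq> mult_ideal (line a b i) (ideal_power R (pair_ideal a b) l)"
proof -
  define P where "P = pair_ideal a b"
  define c where "c = line a b"
  have ac: "a \<in> carrier R" using a ideal_max ideal_in_carrier by blast
  have P: "ideal P R" "a \<in> P" "b \<in> P" using pair_ideal[OF ac b] by (auto simp: P_def)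
  have PI: "ideal (ideal_power R P k) R" for k by (rule ideal_power_ideal[OF P(1)])
  have cc: "c i \<in> carrier R" for i using ac b by (simp add: c_def)
  have cP: "c i \<in> P" for i unfolding c_def by (rule line_mem[OF P])
  have Pc: "pair_ideal (c i) b = P" for i unfolding c_def P_def by (rule pair_ideal_line[OF ac b])
  define p where "p i = finprod R c (S - {i})" for i
  have card: "card (S - {i}) = Suc l" if "i \<in> S" for i using that S by simp
  have pP: "p i \<in> ideal_power R P (Suc l)" if "i \<in> S" for i
    unfolding p_def card[OF that, symmetric]
    by (rule finprod_mem_ideal_power[OF P(1)]) (use S cP in auto)
  have pc: "p i \<in> carrier R" if "i \<in> S" for i using pP[OF that] PI ideal_in_carrier by blast
  define K0 where "K0 = mult_ideal a (ideal_power R P (Suc l))"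
  have K0: "ideal K0 R" unfolding K0_def by (rule ideal_mult_ideal[OF PI ac])
  define W where "W i = set_add R K0 (mult_ideal (c i) (ideal_power R P l))" for i
  have cI: "ideal (mult_ideal (c i) (ideal_power R P l)) R" for i by (rule ideal_mult_ideal[OF PI cc])
  have W: "ideal (W i) R" for i unfolding W_def by (rule add_ideals[OF K0 cI])
  have K0W: "K0 \<subseteq> W i" for i
  proof
    fix u assume u: "u \<in> K0"
    then have "u = u \<oplus> \<zero>" using ideal_in_carrier[OF K0 u] by simp
    then show "u \<in> W i" unfolding W_def set_add_def' using u ideal_zero[OF cI] by blast
  qed
  have cW: "mult_ideal (c i) (ideal_power R P l) \<subseteq> W i" for i
  proof
    fix u assume u: "u \<in> mult_ideal (c i) (ideal_power R P l)"
    then have "u = \<zero> \<oplus> u" using ideal_in_carrier[OF cI u] by simp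
    then show "u \<in> W i" unfolding W_def set_add_def' using u ideal_zero[OF K0] by blast
  qed
  have pW: "p i \<in> W j" if ij: "i \<in> S" "j \<in> S" "i \<noteq> j" for i j
  proof -
    have eq: "S - {i} = insert j (S - {i,j})" using ij by blast
    have "p i = c j \<otimes> finprod R c (S - {i,j})"
      unfolding p_def eq using S cc by (subst finprod_insert) auto
    moreover have "finprod R c (S - {i,j}) \<in> ideal_power R P (card (S - {i,j}))"
      by (rule finprod_mem_ideal_power[OF P(1)]) (use S cP in auto)
    moreover have "card (S - {i,j}) = l"
      using card[OF ij(1)] eq S by (metis Diff_iff card_insert_disjoint diff_Suc_1 finite_Diff insertCI)
    ultimately have "p i \<in> mult_ideal (c j) (ideal_power R P l)" using mult_idealI by simp
    then show ?thesis using cW by blast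
  qed
  have "a [^] Suc l \<in> ideal_power R P (Suc l)" by (rule elem_power_mem_1[OF P(1,2)])
  then have "max_primary (ideal_power R P (Suc l))" by (rule max_primary_if_power_dvd[OF ac a(2) PI])
  then obtain k0 where "colength_le k0 (ideal_power R P (Suc l))" using max_primary_colength by blast
  then obtain k where k: "colength_le k (ideal_power R P (Suc l))"
    "\<And>j. colength_le j (ideal_power R P (Suc l)) \<Longrightarrow> k \<le> j"
    using LeastI[of "\<lambda>k. colength_le k (ideal_power R P (Suc l))"]
      Least_le[of "\<lambda>k. colength_le k (ideal_power R P (Suc l))"] by blast
  have "\<exists>i\<in>S. p i \<in> W i"
  proof (rule ccontr)
    assume "\<not> (\<exists>i\<in>S. p i \<in> W i)"
    then have np: "p i \<notin> W i" if "i \<in> S" for i using that by blast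
    have "\<exists>K m. ideal K R \<and> K \<subseteq> ideal_power R P (Suc l) \<and> (\<forall>j\<in>S - F. K \<subseteq> W j) \<and>
      k + Suc l = card F + m \<and> colength_le m K" if "F \<subseteq> S" for F
      using finite_subset[OF that S(1)] that
    proof (induction F)
      case empty
      have "K0 \<subseteq> ideal_power R P (Suc l)" unfolding K0_def by (rule mult_ideal_subset[OF PI ac])
      moreover have "colength_le (k + Suc l) K0"
        unfolding K0_def by (rule colength_le_mult_ideal[OF PI ac k(1) len])
      ultimately show ?case using K0 K0W by (intro exI[of _ K0] exI[of _ "k + Suc l"]) auto
    next
      case (insert i F)
      then obtain K m where K: "ideal K R" "K \<subseteq> ideal_power R P (Suc l)" "\<forall>j\<in>S - F. K \<subseteq> W j"
        "k + Suc l = card F + m" "colength_le m K" by auto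
      have i: "i \<in> S" "i \<notin> F" using insert by auto
      let ?K = "adjoin K (p i)"
      have KI: "ideal ?K R" by (rule ideal_adjoin[OF K(1) pc[OF i(1)]])
      have "p i \<notin> K" using np i K(3) by blast
      then have "K \<subset> ?K"
        using subset_adjoin[OF K(1) pc[OF i(1)]] self_mem_adjoin[OF K(1) pc[OF i(1)]] by blast
      then obtain m' where m': "m = Suc m'" "colength_le m' ?K"
        by (rule colength_le_psubset[OF K(5) _ KI])
      have "?K \<subseteq> ideal_power R P (Suc l)" by (rule adjoin_minimal[OF PI K(2) pP[OF i(1)]])
      moreover have "?K \<subseteq> W j" if "j \<in> S - insert i F" for j
        using that K(3) pW[of i j] i by (intro adjoin_minimal[OF W]) auto
      moreover have "k + Suc l = card (insert i F) + m'" using K(4) m' i insert.hyps by simp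
      ultimately show ?case using KI m' by blast
    qed
    from this[of S] obtain K m where K: "ideal K R" "K \<subseteq> ideal_power R P (Suc l)"
      "k + Suc l = card S + m" "colength_le m K" by blast
    then have "k \<le> m" using k(2) colength_le_mono PI by blast
    then show False using K(3) S(2) by simp
  qed
  then obtain i where i: "i \<in> S" "p i \<in> W i" by blast
  let ?cP = "mult_ideal (c i) (ideal_power R P l)"
  obtain v w where vw: "v \<in> ideal_power R P (Suc l)" "w \<in> ideal_power R P l"
    "p i = a \<otimes> v \<oplus> c i \<otimes> w"
  proof -
    obtain y z where "y \<in> K0" "z \<in> ?cP" "p i = y \<oplus> z"
      using i(2) unfolding W_def set_add_def' by blast
    then show ?thesis using that unfolding K0_def by (auto elim!: mult_idealE)
  qed
  obtain v' t where v': "v' \<in> ideal_power R P l" "t \<in> carrier R" "v = c i \<otimes> v' \<oplus> t \<otimes> b [^] Suc l"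
  proof -
    have "v \<in> adjoin ?cP (b [^] Suc l)"
      using pair_ideal_power_subset[OF cc b, of i l] vw(1) unfolding Pc by blast
    then obtain y t where "y \<in> ?cP" "t \<in> carrier R" "v = y \<oplus> t \<otimes> b [^] Suc l"
      unfolding mem_adjoin by blast
    then show ?thesis using that by (auto elim!: mult_idealE)
  qed
  have "\<exists>u\<in>Units R. \<exists>v\<in>ideal_power R (pair_ideal (c i) b) (card (S - {i}) - 1).
    finprod R c (S - {i}) = u \<otimes> b [^] card (S - {i}) \<oplus> c i \<otimes> v"
    using S line_shift[OF ac b] by (intro finprod_unit_shift cc b) (auto simp: c_def)
  then obtain u w' where u: "u \<in> Units R" "w' \<in> ideal_power R P l"
    "p i = u \<otimes> b [^] Suc l \<oplus> c i \<otimes> w'"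
    using card[OF i(1)] unfolding Pc p_def by auto
  have cl: "v' \<in> carrier R" "w \<in> carrier R" "w' \<in> carrier R"
    using v' vw u PI ideal_in_carrier by blast+
  have uc: "u \<in> carrier R" using u Units_closed by blast
  have bl: "b [^] Suc l \<in> carrier R" using b by (rule nat_pow_closed)
  have "(u \<ominus> a \<otimes> t) \<otimes> b [^] Suc l = p i \<ominus> c i \<otimes> w' \<ominus> a \<otimes> t \<otimes> b [^] Suc l"
    unfolding u(3) using uc ac v'(2) bl cc[of i] cl(3) by algebra
  also have "\<dots> = c i \<otimes> (a \<otimes> v' \<oplus> w \<ominus> w')"
    unfolding vw(3) v'(3) using ac v'(2) bl cc[of i] cl by algebra
  also have "\<dots> \<in> ?cP"
    using v' vw u ac by (intro mult_idealI ideal_minus[OF PI] ideal_add[OF PI] ideal_mult_l[OF PI])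
  finally have mem: "(u \<ominus> a \<otimes> t) \<otimes> b [^] Suc l \<in> ?cP" .
  have "u \<ominus> a \<otimes> t \<in> Units R"
  proof -
    have at: "a \<otimes> t \<in> \<mm>" using a v' ideal_max ideal_mult_r by blast
    have "u \<ominus> a \<otimes> t \<notin> \<mm>"
    proof
      assume "u \<ominus> a \<otimes> t \<in> \<mm>"
      then have "u \<ominus> a \<otimes> t \<oplus> a \<otimes> t \<in> \<mm>" using at ideal_max ideal_add by blast
      moreover have "u \<ominus> a \<otimes> t \<oplus> a \<otimes> t = u" using uc ac v'(2) by algebra
      ultimately show False using u(1) Units_iff_notin_max uc by simp
    qed
    then show ?thesis using Units_iff_notin_max uc ac v'(2) by simp
  qed
  then have "b [^] Suc l \<in> ?cP" using Unit_mult_mem_cancel[OF cI _ mem bl] by blast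
  then have "adjoin ?cP (b [^] Suc l) \<subseteq> ?cP" by (intro adjoin_minimal cI subset_refl)
  then have "ideal_power R P (Suc l) \<subseteq> ?cP"
    using pair_ideal_power_subset[OF cc b, of i l] unfolding Pc by blast
  then show ?thesis using i(1) unfolding P_def c_def by blast
qed

end

context cring
begin

definition principal_reduction :: "'a \<Rightarrow> 'a set \<Rightarrow> bool"
  where "principal_reduction x A \<longleftrightarrow> x \<in> A \<and>
    (\<exists>n. ideal_power R A (Suc n) \<subseteq> mult_ideal x (ideal_power R A n))"

lemma mem_PIdl: "v \<in> PIdl x \<longleftrightarrow> (\<exists>r\<in>carrier R. v = r \<otimes> x)"
  by (auto simp: cgenideal_def)

lemma PIdl_cancel:
  assumes s: "nonzerodivisor s" and t: "t \<in> carrier R" and v: "v \<in> carrier R"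
    and mem: "s \<otimes> v \<in> PIdl (s \<otimes> t)"
  shows "v \<in> PIdl t"
proof -
  obtain r where r: "r \<in> carrier R" "s \<otimes> v = r \<otimes> (s \<otimes> t)" using mem mem_PIdl by blast
  have sc: "s \<in> carrier R" using s nonzerodivisor_closed by blast
  have "s \<otimes> v = s \<otimes> (r \<otimes> t)" unfolding r(2) using r(1) sc t by (simp add: m_lcomm)
  then have "v = r \<otimes> t" using nonzerodivisor_cancel[OF s] v r(1) t by simp
  then show ?thesis using r mem_PIdl by blast
qed

lemma ideal_power_factor:
  assumes A: "ideal A R" and x: "x \<in> carrier R"
    and red: "ideal_power R A (Suc n) \<subseteq> mult_ideal x (ideal_power R A n)"
  shows "ideal_power R A (n + k) \<subseteq> mult_ideal (x [^] k) (ideal_power R A n)"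
proof (induction k)
  case 0
  have "v \<in> mult_ideal \<one> (ideal_power R A n)" if "v \<in> ideal_power R A n" for v
    using mult_idealI[OF that, of \<one>] ideal_in_carrier[OF ideal_power_ideal[OF A] that] by simp
  then show ?case by auto
next
  case (Suc k)
  show ?case
  proof
    fix v assume "v \<in> ideal_power R A (n + Suc k)"
    then have "v \<in> mult_ideal x (ideal_power R A (n + k))"
      using ideal_power_absorb[OF A x red, of k] by auto
    then obtain u where u: "u \<in> ideal_power R A (n + k)" "v = x \<otimes> u" by (rule mult_idealE)
    obtain w where w: "w \<in> ideal_power R A n" "u = x [^] k \<otimes> w"
      using Suc u(1) by (auto elim!: mult_idealE)
    have "w \<in> carrier R" using ideal_in_carrier[OF ideal_power_ideal[OF A] w(1)] .
    then have "v = x [^] Suc k \<otimes> w" unfolding u(2) w(2) using x by (simp add: m_ac)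
    then show "v \<in> mult_ideal (x [^] Suc k) (ideal_power R A n)" using mult_idealI[OF w(1)] by simp
  qed
qed

text \<open>Expanding \<open>(B + (b))\<^bsup>p+q\<^esup>\<close>, every term contains \<open>p\<close> factors from \<open>B\<close> or \<open>q\<close> factors \<open>b\<close>.\<close>

lemma adjoin_power_subset:
  assumes A: "ideal A R" and B: "ideal B R" "B \<subseteq> A" and b: "b \<in> A"
    and K: "ideal K R"
    and K1: "\<And>u v. u \<in> ideal_power R B p \<Longrightarrow> v \<in> ideal_power R A q \<Longrightarrow> u \<otimes> v \<in> K"
    and K2: "\<And>v. v \<in> ideal_power R A p \<Longrightarrow> b [^] q \<otimes> v \<in> K"
  shows "ideal_power R (adjoin B b) (p + q) \<subseteq> K"
  using K K1 K2
proof (induction "p + q" arbitrary: p q K)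
  case 0
  then have "\<one> \<otimes> \<one> \<in> K" by (intro 0(3)) (auto simp: ideal_power_0)
  then have "\<one> \<in> K" by simp
  then have "K = carrier R" using ideal_eq_carrier_iff[OF 0(2)] by blast
  then show ?case
    using ideal_in_carrier[OF ideal_power_ideal[OF ideal_adjoin[OF B(1) ideal_in_carrier[OF A b]]]] by blast
next
  case (Suc n)
  have bc: "b \<in> carrier R" using ideal_in_carrier[OF A b] .
  have adA: "ideal (adjoin B b) R" by (rule ideal_adjoin[OF B(1) bc])
  have sub: "adjoin B b \<subseteq> A" by (rule adjoin_minimal[OF A B(2) b])
  have AI: "ideal (ideal_power R A k) R" and BI: "ideal (ideal_power R B k) R" for k
    using ideal_power_ideal A B by auto
  have Ac: "v \<in> carrier R" if "v \<in> ideal_power R A k" for v k using ideal_in_carrier[OF AI that] .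
  have Bc: "v \<in> carrier R" if "v \<in> ideal_power R B k" for v k using ideal_in_carrier[OF BI that] .
  have adc: "w \<in> carrier R" if "w \<in> ideal_power R (adjoin B b) k" for w k
    using ideal_in_carrier[OF ideal_power_ideal[OF adA] that] .
  have by_B: "w \<otimes> \<beta> \<in> K" if w: "w \<in> ideal_power R (adjoin B b) n" and \<beta>: "\<beta> \<in> B" for w \<beta>
  proof -
    have \<beta>c: "\<beta> \<in> carrier R" using \<beta> B ideal_in_carrier by blast
    have "ideal_power R (adjoin B b) n \<subseteq> elem_colon K \<beta>"
    proof (cases p)
      case 0
      have "w \<otimes> \<beta> \<in> K" if w: "w \<in> ideal_power R (adjoin B b) n" for w
      proof -
        have "w \<in> ideal_power R A n" using ideal_power_mono[OF adA A sub] w by blast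
        moreover have "q = Suc n" using Suc.hyps(2) 0 by simp
        moreover have "\<beta> \<in> A" using \<beta> B by blast
        ultimately have m: "\<beta> \<otimes> w \<in> ideal_power R A q" using ideal_power_mult_mem_Suc[OF A] by simp
        have "\<one> \<otimes> (\<beta> \<otimes> w) \<in> K" by (rule Suc.prems(2)[OF _ m]) (simp add: 0 ideal_power_0)
        then show ?thesis using \<beta>c adc[OF w] by (simp add: m_comm)
      qed
      then show ?thesis using adc by (auto simp: elem_colon_def)
    next
      case (Suc p')
      have n: "n = p' + q" using Suc.hyps(2) Suc by simp
      show ?thesis unfolding n
      proof (rule Suc.hyps(1)[OF n ideal_elem_colon[OF Suc.prems(1) \<beta>c]])
        fix u v assume uv: "u \<in> ideal_power R B p'" "v \<in> ideal_power R A q"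
        have "\<beta> \<otimes> u \<in> ideal_power R B p" unfolding Suc by (rule ideal_power_mult_mem_Suc[OF B(1) \<beta> uv(1)])
        then have "(\<beta> \<otimes> u) \<otimes> v \<in> K" using Suc.prems(2) uv by blast
        then show "u \<otimes> v \<in> elem_colon K \<beta>"
          using uv Ac Bc \<beta>c by (simp add: elem_colon_def m_ac)
      next
        fix v assume v: "v \<in> ideal_power R A p'"
        have "\<beta> \<otimes> v \<in> ideal_power R A p" unfolding Suc using ideal_power_mult_mem_Suc[OF A _ v] \<beta> B by blast
        then have "b [^] q \<otimes> (\<beta> \<otimes> v) \<in> K" using Suc.prems(3) by blast
        then show "b [^] q \<otimes> v \<in> elem_colon K \<beta>"
          using v Ac bc \<beta>c by (simp add: elem_colon_def m_ac)
      qed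
    qed
    then show ?thesis using w by (auto simp: elem_colon_def)
  qed
  have by_b: "w \<otimes> b \<in> K" if w: "w \<in> ideal_power R (adjoin B b) n" for w
  proof -
    have "ideal_power R (adjoin B b) n \<subseteq> elem_colon K b"
    proof (cases q)
      case 0
      have "w \<otimes> b \<in> K" if w: "w \<in> ideal_power R (adjoin B b) n" for w
      proof -
        have "w \<in> ideal_power R A n" using ideal_power_mono[OF adA A sub] w by blast
        moreover have "p = Suc n" using Suc.hyps(2) 0 by simp
        ultimately have m: "b \<otimes> w \<in> ideal_power R A p" using ideal_power_mult_mem_Suc[OF A b] by simp
        have "b [^] q \<otimes> (b \<otimes> w) \<in> K" by (rule Suc.prems(3)[OF m])
        then show ?thesis using bc adc[OF w] 0 by (simp add: m_comm)
      qed
      then show ?thesis using adc by (auto simp: elem_colon_def)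
    next
      case (Suc q')
      have n: "n = p + q'" using Suc.hyps(2) Suc by simp
      show ?thesis unfolding n
      proof (rule Suc.hyps(1)[OF n ideal_elem_colon[OF Suc.prems(1) bc]])
        fix u v assume uv: "u \<in> ideal_power R B p" "v \<in> ideal_power R A q'"
        have "b \<otimes> v \<in> ideal_power R A q" unfolding Suc by (rule ideal_power_mult_mem_Suc[OF A b uv(2)])
        then have "u \<otimes> (b \<otimes> v) \<in> K" using Suc.prems(2) uv by blast
        then show "u \<otimes> v \<in> elem_colon K b"
          using uv Ac Bc bc by (simp add: elem_colon_def m_ac)
      next
        fix v assume v: "v \<in> ideal_power R A p"
        then have "b [^] q \<otimes> v \<in> K" using Suc.prems(3) by blast
        then show "b [^] q' \<otimes> v \<in> elem_colon K b"
          using v Ac bc Suc by (simp add: elem_colon_def m_ac)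
      qed
    qed
    then show ?thesis using w by (auto simp: elem_colon_def)
  qed
  have "w \<otimes> s \<in> K" if w: "w \<in> ideal_power R (adjoin B b) n" and s: "s \<in> adjoin B b" for w s
  proof -
    obtain \<beta> r where s': "\<beta> \<in> B" "r \<in> carrier R" "s = \<beta> \<oplus> r \<otimes> b" using s by (auto simp: mem_adjoin)
    have \<beta>c: "\<beta> \<in> carrier R" using s' B ideal_in_carrier by blast
    have "w \<otimes> s = w \<otimes> \<beta> \<oplus> r \<otimes> (w \<otimes> b)"
      unfolding s'(3) using \<beta>c s'(2) bc adc[OF w] by algebra
    then show ?thesis
      using ideal_add[OF Suc.prems(1) by_B[OF w s'(1)] ideal_mult_l[OF Suc.prems(1) s'(2) by_b[OF w]]] by simp
  qed
  then have "ideal_prod R (ideal_power R (adjoin B b) n) (adjoin B b) \<subseteq> K"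
    by (intro ideal_prod_subset Suc.prems(1))
  then show ?case unfolding Suc.hyps(2)[symmetric] ideal_power_Suc .
qed

text \<open>This lets a principal reduction be found by treating finitely many generators one at a time.\<close>

lemma genideal_power_subset:
  assumes A: "ideal A R" and x: "x \<in> carrier R" and F: "finite F" "F \<subseteq> A"
    and dom: "\<And>b. b \<in> F \<Longrightarrow> \<exists>n. b [^] Suc n \<in> mult_ideal x (ideal_power R A n)"
  shows "\<exists>n. ideal_power R (Idl F) (Suc n) \<subseteq> mult_ideal x (ideal_power R A n)"
  using F dom
proof (induction F)
  case empty
  have "Idl {} \<subseteq> {\<zero>}" by (rule genideal_minimal[OF zeroideal]) simp
  moreover have "ideal_power R (Idl {}) (Suc 0) = Idl {}"
    using ideal_power_1[OF genideal_ideal] by simp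
  moreover have "\<zero> \<in> mult_ideal x (ideal_power R A 0)"
    by (rule ideal_zero[OF ideal_mult_ideal[OF ideal_power_ideal[OF A] x]])
  ultimately show ?case by (intro exI[of _ 0]) auto
next
  case (insert b F)
  obtain n where n: "ideal_power R (Idl F) (Suc n) \<subseteq> mult_ideal x (ideal_power R A n)"
    using insert by auto
  obtain k where k: "b [^] Suc k \<in> mult_ideal x (ideal_power R A k)" using insert.prems(2)[of b] by blast
  have Ac: "A \<subseteq> carrier R" using A ideal_in_carrier by blast
  have b: "b \<in> A" "b \<in> carrier R" using insert Ac by auto
  have Fc: "F \<subseteq> carrier R" using insert Ac by auto
  have B: "ideal (Idl F) R" by (rule genideal_ideal[OF Fc])
  have BA: "Idl F \<subseteq> A" using genideal_minimal[OF A] insert by blast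
  have AI: "ideal (ideal_power R A k) R" for k by (rule ideal_power_ideal[OF A])
  have Apc: "v \<in> carrier R" if "v \<in> ideal_power R A k" for v k using ideal_in_carrier[OF AI that] .
  let ?K = "mult_ideal x (ideal_power R A (n + Suc k))"
  have KI: "ideal ?K R" by (rule ideal_mult_ideal[OF AI x])
  have "ideal_power R (adjoin (Idl F) b) (Suc n + Suc k) \<subseteq> ?K"
  proof (rule adjoin_power_subset[OF A B BA b(1) KI])
    fix u v assume uv: "u \<in> ideal_power R (Idl F) (Suc n)" "v \<in> ideal_power R A (Suc k)"
    then obtain w where w: "w \<in> ideal_power R A n" "u = x \<otimes> w" using n by (auto elim!: mult_idealE)
    have "u \<otimes> v = x \<otimes> (w \<otimes> v)" unfolding w(2) using x Apc[OF w(1)] Apc[OF uv(2)] by (simp add: m_assoc)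
    then show "u \<otimes> v \<in> ?K" using mult_idealI[OF ideal_power_mult_mem[OF A w(1) uv(2)]] by simp
  next
    fix v assume v: "v \<in> ideal_power R A (Suc n)"
    obtain w where w: "w \<in> ideal_power R A k" "b [^] Suc k = x \<otimes> w" using k by (rule mult_idealE)
    have "b [^] Suc k \<otimes> v = x \<otimes> (w \<otimes> v)" unfolding w(2) using x Apc[OF w(1)] Apc[OF v] by (simp add: m_assoc)
    moreover have "w \<otimes> v \<in> ideal_power R A (n + Suc k)"
      using ideal_power_mult_mem[OF A w(1) v] by (simp add: add.commute)
    ultimately show "b [^] Suc k \<otimes> v \<in> ?K" using mult_idealI by simp
  qed
  moreover have "Idl (insert b F) \<subseteq> adjoin (Idl F) b"
    by (rule genideal_minimal[OF ideal_adjoin[OF B b(2)]])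
      (use self_mem_adjoin[OF B b(2)] subset_adjoin[OF B b(2)] genideal_self[OF Fc] in blast)
  moreover have "ideal (Idl (insert b F)) R" using Fc b by (intro genideal_ideal) simp
  ultimately have "ideal_power R (Idl (insert b F)) (Suc (n + Suc k)) \<subseteq> ?K"
    using ideal_power_mono[of "Idl (insert b F)" "adjoin (Idl F) b" "Suc n + Suc k"] ideal_adjoin[OF B b(2)]
    by auto
  then show ?case by blast
qed

end

context one_dim_local_CM_Q_algebra
begin

lemma ex_good_lines:
  assumes a: "a \<in> \<mm>" "max_primary (PIdl a)" and b: "b \<in> carrier R"
  obtains l where "\<forall>S. finite S \<and> card S = Suc (Suc l) \<longrightarrow> (\<exists>i\<in>S. ideal_power R (pair_ideal a b) (Suc l)
    \<subseteq> mult_ideal (line a b i) (ideal_power R (pair_ideal a b) l))"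
proof -
  obtain k where k: "colength_le k (PIdl a)" using max_primary_colength[OF a(2)] by blast
  have "PIdl a \<subseteq> \<mm>" by (rule cgenideal_minimal[OF ideal_max a(1)])
  then have "PIdl a \<noteq> carrier R" using one_notin_max by auto
  then obtain l where l: "k = Suc l" using k by (cases k) auto
  show ?thesis
  proof (rule that, intro allI impI)
    fix S :: "nat set" assume S: "finite S \<and> card S = Suc (Suc l)"
    show "\<exists>i\<in>S. ideal_power R (pair_ideal a b) (Suc l)
      \<subseteq> mult_ideal (line a b i) (ideal_power R (pair_ideal a b) l)"
      by (rule ex_line_reduction[OF a b k[unfolded l] conjunct1[OF S] conjunct2[OF S]])
  qed
qed

lemma pair_reduction_power:
  assumes A: "ideal A R" "a \<in> A" "b \<in> A" and c: "c \<in> carrier R"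
    and red: "ideal_power R (pair_ideal a b) (Suc l) \<subseteq> mult_ideal c (ideal_power R (pair_ideal a b) l)"
    and u: "u \<in> pair_ideal a b"
  shows "u [^] Suc l \<in> mult_ideal c (ideal_power R A l)"
proof -
  have P: "ideal (pair_ideal a b) R"
    by (rule pair_ideal(1)[OF ideal_in_carrier[OF A(1,2)] ideal_in_carrier[OF A(1,3)]])
  have "u [^] Suc l \<in> ideal_power R (pair_ideal a b) (Suc l)" by (rule elem_power_mem_1[OF P u])
  then have "u [^] Suc l \<in> mult_ideal c (ideal_power R (pair_ideal a b) l)" using red by blast
  then show ?thesis
    using mult_ideal_mono[OF ideal_power_mono[OF P A(1) pair_ideal_minimal[OF A]]] by blast
qed

text \<open>Generators of \<open>I\<close> are incorporated one by one: moving \<open>x\<close> along the line in the direction of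
  the new generator \<open>b\<close> to a point that reduces \<open>(x, b)\<close> keeps control of the old ones.\<close>

lemma ex_dominating:
  assumes I: "max_primary I" "\<one> \<notin> I" and F: "finite F" "F \<subseteq> I"
  shows "\<exists>x\<in>I. max_primary (PIdl x) \<and> (\<forall>b\<in>F. \<exists>n. b [^] Suc n \<in> mult_ideal x (ideal_power R I n))"
  using F
proof (induction F)
  case empty
  then show ?case using ex_parameter[OF I] by blast
next
  case (insert b F)
  have II: "ideal I R" using I max_primary_ideal by blast
  have Im: "I \<subseteq> \<mm>" by (rule proper_ideal_subset_max[OF II I(2)])
  have Ic: "v \<in> carrier R" if "v \<in> I" for v using ideal_in_carrier[OF II that] .
  have Ipc: "v \<in> carrier R" if "v \<in> ideal_power R I k" for v k
    using ideal_in_carrier[OF ideal_power_ideal[OF II] that] .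
  obtain x where x: "x \<in> I" "max_primary (PIdl x)"
    "\<forall>b\<in>F. \<exists>n. b [^] Suc n \<in> mult_ideal x (ideal_power R I n)" using insert by auto
  have b: "b \<in> I" using insert by simp
  have xm: "x \<in> \<mm>" using x(1) Im by blast
  obtain l where l: "\<forall>S. finite S \<and> card S = Suc (Suc l) \<longrightarrow> (\<exists>i\<in>S. ideal_power R (pair_ideal x b) (Suc l)
    \<subseteq> mult_ideal (line x b i) (ideal_power R (pair_ideal x b) l))"
    by (rule ex_good_lines[OF xm x(2) Ic[OF b]])
  obtain i where i: "ideal_power R (pair_ideal x b) (Suc l)
    \<subseteq> mult_ideal (line x b i) (ideal_power R (pair_ideal x b) l)"
    using l[rule_format, of "{..<Suc (Suc l)}"] by auto
  define c where "c = line x b i"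
  have cI: "c \<in> I" unfolding c_def by (rule line_mem[OF II x(1) b])
  have cc: "c \<in> carrier R" by (rule Ic[OF cI])
  note P = pair_ideal[OF Ic[OF x(1)] Ic[OF b]]
  have xl: "x [^] Suc l \<in> mult_ideal c (ideal_power R I l)"
    and bl: "b [^] Suc l \<in> mult_ideal c (ideal_power R I l)"
    using pair_reduction_power[OF II x(1) b cc i[folded c_def]] P by auto
  have "x [^] Suc l \<in> PIdl c"
  proof -
    obtain w where "w \<in> ideal_power R I l" "x [^] Suc l = c \<otimes> w" using xl by (rule mult_idealE)
    then show ?thesis using Ipc cc m_comm unfolding mem_PIdl by metis
  qed
  then have "max_primary (PIdl c)"
    by (rule max_primary_if_power_dvd[OF Ic[OF x(1)] x(2) cgenideal_ideal[OF cc]])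
  moreover have "\<exists>n. f [^] Suc n \<in> mult_ideal c (ideal_power R I n)" if f: "f \<in> F" for f
  proof -
    obtain n where n: "f [^] Suc n \<in> mult_ideal x (ideal_power R I n)" using x(3) f by blast
    obtain v where v: "v \<in> ideal_power R I n" "f [^] Suc n = x \<otimes> v" using n by (rule mult_idealE)
    obtain w where w: "w \<in> ideal_power R I l" "x [^] Suc l = c \<otimes> w" using xl by (rule mult_idealE)
    have fc: "f \<in> carrier R" using insert f Ic by auto
    have "f [^] (Suc n * Suc l) = (f [^] Suc n) [^] Suc l" by (rule nat_pow_pow[OF fc, symmetric])
    also have "\<dots> = x [^] Suc l \<otimes> v [^] Suc l"
      unfolding v(2) by (rule nat_pow_distrib[OF Ic[OF x(1)] Ipc[OF v(1)]])
    also have "\<dots> = c \<otimes> (w \<otimes> v [^] Suc l)"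
      unfolding w(2) by (rule m_assoc[OF cc Ipc[OF w(1)] nat_pow_closed[OF Ipc[OF v(1)]]])
    also have "\<dots> \<in> mult_ideal c (ideal_power R I (l + n * Suc l))"
      by (rule mult_idealI[OF ideal_power_mult_mem[OF II w(1) elem_power_mem[OF II v(1)]]])
    finally have "f [^] (Suc n * Suc l) \<in> mult_ideal c (ideal_power R I (l + n * Suc l))" .
    moreover have "Suc n * Suc l = Suc (l + n * Suc l)" by simp
    ultimately have "f [^] Suc (l + n * Suc l) \<in> mult_ideal c (ideal_power R I (l + n * Suc l))"
      by (simp only:)
    then show ?thesis by blast
  qed
  ultimately show ?case using cI bl by blast
qed

lemma ex_principal_reduction:
  assumes I: "max_primary I" "\<one> \<notin> I"
  obtains x where "principal_reduction x I"
proof -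
  have II: "ideal I R" using I max_primary_ideal by blast
  obtain F where F: "F \<subseteq> carrier R" "finite F" "I = Idl F" using finetely_gen[OF II] by blast
  have FI: "F \<subseteq> I" unfolding F(3) by (rule genideal_self[OF F(1)])
  obtain x where x: "x \<in> I" "\<forall>b\<in>F. \<exists>n. b [^] Suc n \<in> mult_ideal x (ideal_power R I n)"
    using ex_dominating[OF I F(2) FI] by blast
  have "\<exists>n. ideal_power R (Idl F) (Suc n) \<subseteq> mult_ideal x (ideal_power R I n)"
    by (rule genideal_power_subset[OF II ideal_in_carrier[OF II x(1)] F(2) FI]) (use x(2) in blast)
  then have "principal_reduction x I" using x(1) unfolding F(3)[symmetric] principal_reduction_def by blast
  then show ?thesis by (rule that)
qed

end

section \<open>Minimal reductions and the reduction number\<close>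

locale one_dim_CM_ideal = one_dim_local_CM_Q_algebra +
  fixes I
  assumes max_primary_I: "max_primary I" and proper_I: "\<one> \<notin> I"
begin

lemma ideal_I: "ideal I R"
  using max_primary_I max_primary_ideal by blast

lemma I_closed: "v \<in> I \<Longrightarrow> v \<in> carrier R"
  by (rule ideal_in_carrier[OF ideal_I])

lemma I_subset_max: "I \<subseteq> \<mm>"
  by (rule proper_ideal_subset_max[OF ideal_I proper_I])

abbreviation I_power :: "nat \<Rightarrow> 'a set" where "I_power n \<equiv> ideal_power R I n"

lemma ideal_I_power: "ideal (I_power n) R"
  by (rule ideal_power_ideal[OF ideal_I])

lemma I_power_closed: "v \<in> I_power n \<Longrightarrow> v \<in> carrier R"
  by (rule ideal_in_carrier[OF ideal_I_power])

lemma max_primary_if_contains_power: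
  assumes B: "ideal B R" and sub: "I_power n \<subseteq> B"
  shows "max_primary B"
  unfolding max_primary_def
proof (intro conjI allI impI B)
  fix Q assume Q: "primeideal Q R \<and> B \<subseteq> Q"
  have "I \<subseteq> Q"
  proof
    fix i assume i: "i \<in> I"
    then have "i [^] n \<in> Q" using elem_power_mem_1[OF ideal_I i] sub Q by blast
    then show "i \<in> Q" using prime_pow_mem Q I_closed[OF i] by blast
  qed
  then show "Q = \<mm>" using max_primary_I Q unfolding max_primary_def by blast
qed

lemma principal_reduction_mem: "principal_reduction x I \<Longrightarrow> x \<in> I"
  by (simp add: principal_reduction_def)

lemma principal_reduction_closed: "principal_reduction x I \<Longrightarrow> x \<in> carrier R"
  using principal_reduction_mem I_closed by blast

lemma mult_ideal_subset_PIdl: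
  assumes "x \<in> carrier R" shows "mult_ideal x (I_power n) \<subseteq> PIdl x"
proof
  fix v assume "v \<in> mult_ideal x (I_power n)"
  then obtain u where "u \<in> I_power n" "v = x \<otimes> u" by (rule mult_idealE)
  then show "v \<in> PIdl x" using I_power_closed assms m_comm unfolding mem_PIdl by blast
qed

lemma principal_reduction_max_primary:
  assumes "principal_reduction x I" shows "max_primary (PIdl x)"
proof -
  obtain n where "I_power (Suc n) \<subseteq> mult_ideal x (I_power n)"
    using assms principal_reduction_def by blast
  then have "I_power (Suc n) \<subseteq> PIdl x"
    using mult_ideal_subset_PIdl principal_reduction_closed[OF assms] by blast
  then show ?thesis
    by (rule max_primary_if_contains_power[OF cgenideal_ideal[OF principal_reduction_closed[OF assms]]])
qed

lemma principal_reduction_nonzerodivisor: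
  assumes "principal_reduction x I" shows "nonzerodivisor x"
  using parameter_nonzerodivisor principal_reduction_closed principal_reduction_max_primary assms by blast

lemma ideal_power_Suc_eq_PIdl_prod:
  assumes x: "x \<in> I" and red: "I_power (Suc n) \<subseteq> mult_ideal x (I_power n)"
  shows "I_power (n + 1) = (PIdl x) \<cdot> I_power n"
  unfolding PIdl_prod_eq_mult_ideal[OF ideal_I_power I_closed[OF x]]
  using red mult_ideal_power_subset[OF ideal_I x] by auto

lemma reduction_PIdl:
  assumes "principal_reduction x I" shows "reduction R (PIdl x) I"
proof -
  have x: "x \<in> I" by (rule principal_reduction_mem[OF assms])
  then show ?thesis
    using assms ideal_power_Suc_eq_PIdl_prod[OF x] cgenideal_ideal[OF I_closed[OF x]]
      cgenideal_minimal[OF ideal_I x]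
    unfolding reduction_def principal_reduction_def by blast
qed

text \<open>The reduction number does not depend on the reduction: \<open>x\<^sup>k\<close> can be cancelled from
  \<open>x\<^sup>k I\<^bsup>n+1\<^esup> = I\<^bsup>n+k+1\<^esup> = y I\<^bsup>n+k\<^esup> = y x\<^sup>k I\<^sup>n\<close>.\<close>

lemma reduction_exponent_independent:
  assumes x: "principal_reduction x I" and y: "principal_reduction y I"
    and red: "I_power (Suc n) \<subseteq> mult_ideal x (I_power n)"
  shows "I_power (Suc n) \<subseteq> mult_ideal y (I_power n)"
proof
  fix z assume z: "z \<in> I_power (Suc n)"
  have xc: "x \<in> carrier R" and yc: "y \<in> carrier R" using x y principal_reduction_closed by auto
  obtain k where k: "I_power (Suc k) \<subseteq> mult_ideal y (I_power k)" using y principal_reduction_def by blast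
  have ky: "I_power (Suc (n + k)) \<subseteq> mult_ideal y (I_power (n + k))"
    using ideal_power_absorb[OF ideal_I yc k, of n] by (simp add: add.commute)
  have "x [^] k \<otimes> z \<in> I_power (Suc (n + k))"
    using ideal_power_mult_mem[OF ideal_I elem_power_mem_1[OF ideal_I principal_reduction_mem[OF x]] z, of k]
    by (simp add: add.commute)
  then obtain u where u: "u \<in> I_power (n + k)" "x [^] k \<otimes> z = y \<otimes> u" using ky by (auto elim!: mult_idealE)
  obtain w where w: "w \<in> I_power n" "u = x [^] k \<otimes> w"
    using ideal_power_factor[OF ideal_I xc red, of k] u(1) by (auto elim!: mult_idealE)
  have "x [^] k \<otimes> z = x [^] k \<otimes> (y \<otimes> w)"
    unfolding u(2) w(2) using xc yc I_power_closed[OF w(1)] by (simp add: m_lcomm)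
  then have "z = y \<otimes> w"
    using nonzerodivisor_cancel[OF nonzerodivisor_pow[OF principal_reduction_nonzerodivisor[OF x]]]
      I_power_closed[OF z] I_power_closed[OF w(1)] yc by simp
  then show "z \<in> mult_ideal y (I_power n)" using mult_idealI[OF w(1)] by simp
qed

text \<open>A principal reduction of the reduction \<open>J\<close> is one of \<open>I\<close>, because
  \<open>I\<^bsup>m+j\<^esup> = J\<^sup>j I\<^sup>m\<close> for all \<open>j\<close>.\<close>

lemma reduction_contains_principal:
  assumes J: "reduction R J I"
  obtains x where "x \<in> J" "principal_reduction x I"
proof -
  obtain m where JI: "ideal J R" "J \<subseteq> I" and m: "I_power (m + 1) = J \<cdot> I_power m"
    using J unfolding reduction_def by blast
  have "I_power (m + 1) \<subseteq> J" unfolding m using ideal_prod_inter[OF JI(1) ideal_I_power] by blast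
  then have "max_primary J" by (rule max_primary_if_contains_power[OF JI(1)])
  moreover have "\<one> \<notin> J" using JI proper_I by blast
  ultimately obtain x where x: "principal_reduction x J" using ex_principal_reduction by blast
  obtain k where k: "ideal_power R J (Suc k) \<subseteq> mult_ideal x (ideal_power R J k)"
    using x principal_reduction_def by blast
  have xJ: "x \<in> J" using x principal_reduction_def by blast
  have xc: "x \<in> carrier R" using xJ JI I_closed by blast
  have JP: "ideal (ideal_power R J j) R" for j by (rule ideal_power_ideal[OF JI(1)])
  have eq: "I_power (m + j) = ideal_power R J j \<cdot> I_power m" for j
  proof (induction j)
    case 0
    show ?case
      using ideal_prod_one[OF ideal_I_power] ideal_prod_commute[OF oneideal ideal_I_power]
      by (simp add: ideal_power_0)
  next
    case (Suc j)
    have "I_power (m + Suc j) = (ideal_power R J j \<cdot> I_power m) \<cdot> I"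
      using Suc by (simp add: ideal_power_Suc)
    also have "\<dots> = ideal_power R J j \<cdot> I_power (m + 1)"
      using ideal_prod_assoc[OF JP ideal_I_power ideal_I] by (simp add: ideal_power_Suc)
    also have "\<dots> = ideal_power R J (Suc j) \<cdot> I_power m"
      unfolding m using ideal_prod_assoc[OF JP JI(1) ideal_I_power] by (simp add: ideal_power_Suc)
    finally show ?case .
  qed
  have "I_power (Suc (m + k)) \<subseteq> mult_ideal x (I_power (m + k))"
  proof -
    have "u \<otimes> v \<in> mult_ideal x (I_power (m + k))"
      if u: "u \<in> ideal_power R J (Suc k)" and v: "v \<in> I_power m" for u v
    proof -
      obtain w where w: "w \<in> ideal_power R J k" "u = x \<otimes> w" using u k by (auto elim!: mult_idealE)
      have wc: "w \<in> carrier R" by (rule ideal_in_carrier[OF JP w(1)])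
      have "w \<in> I_power k" using ideal_power_mono[OF JI(1) ideal_I JI(2)] w by blast
      then have "w \<otimes> v \<in> I_power (m + k)" using ideal_power_mult_mem[OF ideal_I _ v] by (simp add: add.commute)
      moreover have "u \<otimes> v = x \<otimes> (w \<otimes> v)"
        unfolding w(2) by (rule m_assoc[OF xc wc I_power_closed[OF v]])
      ultimately show ?thesis using mult_idealI by simp
    qed
    then have "ideal_power R J (Suc k) \<cdot> I_power m \<subseteq> mult_ideal x (I_power (m + k))"
      by (intro ideal_prod_subset ideal_mult_ideal ideal_I_power xc)
    then show ?thesis using eq[of "Suc k"] by simp
  qed
  then have "principal_reduction x I" unfolding principal_reduction_def using xJ JI by blast
  then show ?thesis using that xJ by blast
qed

text \<open>A nonzero \<open>v \<in> W\<close> with \<open>(v)\<close> maximal would be \<open>r u\<close> with \<open>(u) = (v)\<close>.\<close>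

lemma eq_zero_if_subset_mult_ideal:
  assumes W: "ideal W R" and r: "r \<in> \<mm>" and sub: "W \<subseteq> mult_ideal r W" and w: "w \<in> W"
  shows "w = \<zero>"
proof (rule ccontr)
  assume "w \<noteq> \<zero>"
  let ?F = "{PIdl w | w. w \<in> W \<and> w \<noteq> \<zero>}"
  have Wc: "w \<in> carrier R" if "w \<in> W" for w using ideal_in_carrier[OF W that] .
  have rc: "r \<in> carrier R" using r ideal_max ideal_in_carrier by blast
  have "PIdl w \<in> ?F" using w \<open>w \<noteq> \<zero>\<close> by blast
  then obtain M where M: "M \<in> ?F" "\<And>B. B \<in> ?F \<Longrightarrow> M \<subseteq> B \<Longrightarrow> B = M"
    by (rule ex_maximal_ideal_in) (use Wc cgenideal_ideal in auto)
  then obtain v where v: "v \<in> W" "v \<noteq> \<zero>" "M = PIdl v" by blast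
  obtain u where u: "u \<in> W" "v = r \<otimes> u" using sub v by (auto elim!: mult_idealE)
  have "u \<noteq> \<zero>" using u v rc by auto
  then have uF: "PIdl u \<in> ?F" using u by blast
  have "v \<in> PIdl u" using u rc mem_PIdl by blast
  then have "M \<subseteq> PIdl u" unfolding v(3) by (rule cgenideal_minimal[OF cgenideal_ideal[OF Wc[OF u(1)]]])
  then have "PIdl u = PIdl v" using M(2)[OF uF] v(3) by simp
  then have "u \<in> PIdl v" using cgenideal_self[OF Wc[OF u(1)]] by simp
  then obtain t where t: "t \<in> carrier R" "u = t \<otimes> v" using mem_PIdl by blast
  have "u = (t \<otimes> r) \<otimes> u"
    by (rule trans[OF t(2)]) (simp add: u(2) m_assoc t(1) rc Wc[OF u(1)])
  moreover have "t \<otimes> r \<in> \<mm>" by (rule ideal_mult_l[OF ideal_max t(1) r])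
  ultimately have "u = \<zero>" using eq_zero_if_fixed[OF Wc[OF u(1)]] by blast
  then show False using \<open>u \<noteq> \<zero>\<close> by blast
qed

text \<open>If \<open>(x)\<close> contains another principal reduction \<open>y = r x\<close>, then cancelling \<open>x\<close> from
  \<open>x I\<^sup>n = I\<^bsup>n+1\<^esup> = r x I\<^sup>n\<close> leaves \<open>I\<^sup>n = r I\<^sup>n\<close>, which forces \<open>r\<close> to be a unit.\<close>

lemma minimal_reduction_PIdl:
  assumes x: "principal_reduction x I" shows "minimal_reduction R (PIdl x) I"
  unfolding minimal_reduction_def
proof (intro conjI allI impI reduction_PIdl[OF x])
  fix K assume K: "reduction R K I \<and> K \<subseteq> PIdl x"
  have KI: "ideal K R" using K reduction_def by blast
  obtain y where y: "y \<in> K" "principal_reduction y I" using reduction_contains_principal K by blast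
  have xc: "x \<in> carrier R" by (rule principal_reduction_closed[OF x])
  have nz: "nonzerodivisor x" by (rule principal_reduction_nonzerodivisor[OF x])
  obtain r where r: "r \<in> carrier R" "y = r \<otimes> x" using y K mem_PIdl by blast
  obtain n where n: "I_power (Suc n) \<subseteq> mult_ideal x (I_power n)" using x principal_reduction_def by blast
  have ny: "I_power (Suc n) \<subseteq> mult_ideal y (I_power n)"
    by (rule reduction_exponent_independent[OF x y(2) n])
  have "r \<in> Units R"
  proof (rule ccontr)
    assume "r \<notin> Units R"
    then have rm: "r \<in> \<mm>" using Units_iff_notin_max r by blast
    have "I_power n \<subseteq> mult_ideal r (I_power n)"
    proof
      fix u assume u: "u \<in> I_power n"
      have "x \<otimes> u \<in> I_power (Suc n)" by (rule ideal_power_mult_mem_Suc[OF ideal_I principal_reduction_mem[OF x] u])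
      then obtain w where w: "w \<in> I_power n" "x \<otimes> u = y \<otimes> w" using ny by (auto elim!: mult_idealE)
      have "x \<otimes> u = x \<otimes> (r \<otimes> w)" unfolding w(2) r(2) using r(1) xc I_power_closed[OF w(1)] by (simp add: m_ac)
      then have "u = r \<otimes> w" using nonzerodivisor_cancel[OF nz] I_power_closed[OF u] I_power_closed[OF w(1)] r(1) by simp
      then show "u \<in> mult_ideal r (I_power n)" using mult_idealI[OF w(1)] by simp
    qed
    then have "x [^] n = \<zero>"
      by (rule eq_zero_if_subset_mult_ideal[OF ideal_I_power rm _ elem_power_mem_1[OF ideal_I principal_reduction_mem[OF x]]])
    then have "x [^] n \<otimes> \<one> = x [^] n \<otimes> \<zero>" using xc by simp
    then have "\<one> = \<zero>" using nonzerodivisor_cancel[OF nonzerodivisor_pow[OF nz]] by blast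
    then show False using one_notin_max ideal_zero[OF ideal_max] by simp
  qed
  then have "x \<in> K" using Unit_mult_mem_cancel[OF KI _ _ xc] y(1) r(2) by simp
  then show "K = PIdl x" using K cgenideal_minimal[OF KI] by blast
qed

lemma minimal_reduction_iff:
  "minimal_reduction R J I \<longleftrightarrow> (\<exists>x. principal_reduction x I \<and> J = PIdl x)"
proof
  assume J: "minimal_reduction R J I"
  then have Jr: "reduction R J I" by (simp add: minimal_reduction_def)
  then have JI: "ideal J R" by (simp add: reduction_def)
  obtain x where x: "x \<in> J" "principal_reduction x I" by (rule reduction_contains_principal[OF Jr])
  have "PIdl x \<subseteq> J" by (rule cgenideal_minimal[OF JI x(1)])
  then have "PIdl x = J" using J reduction_PIdl[OF x(2)] unfolding minimal_reduction_def by blast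
  then show "\<exists>x. principal_reduction x I \<and> J = PIdl x" using x by blast
qed (use minimal_reduction_PIdl in blast)

lemma reduction_number_le_iff:
  assumes x: "principal_reduction x I"
  shows "reduction_number R I \<le> n \<longleftrightarrow> I_power (Suc n) \<subseteq> mult_ideal x (I_power n)"
proof
  let ?N = "{reduction_number_wrt R J I | J. minimal_reduction R J I}"
  assume le: "reduction_number R I \<le> n"
  have "?N \<noteq> {}" using minimal_reduction_PIdl[OF x] by blast
  then have "Inf ?N \<in> ?N" by (rule Inf_nat_def1)
  then obtain J where J: "minimal_reduction R J I" "reduction_number R I = reduction_number_wrt R J I"
    unfolding reduction_number_def by blast
  obtain y where y: "principal_reduction y I" "J = PIdl y" using J(1) minimal_reduction_iff by blast
  have yc: "y \<in> carrier R" by (rule principal_reduction_closed[OF y(1)])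
  obtain m where "I_power (m + 1) = J \<cdot> I_power m"
    using J(1) unfolding minimal_reduction_def reduction_def by blast
  then have "I_power (reduction_number R I + 1) = J \<cdot> I_power (reduction_number R I)"
    unfolding J(2) reduction_number_wrt_def by (rule LeastI)
  then have "I_power (Suc (reduction_number R I)) \<subseteq> mult_ideal y (I_power (reduction_number R I))"
    unfolding y(2) PIdl_prod_eq_mult_ideal[OF ideal_I_power yc] by simp
  then have "I_power (Suc n) \<subseteq> mult_ideal y (I_power n)"
    using ideal_power_absorb[OF ideal_I yc, of "reduction_number R I" "n - reduction_number R I"] le by simp
  then show "I_power (Suc n) \<subseteq> mult_ideal x (I_power n)"
    by (rule reduction_exponent_independent[OF y(1) x])
next
  assume "I_power (Suc n) \<subseteq> mult_ideal x (I_power n)"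
  then have "I_power (n + 1) = (PIdl x) \<cdot> I_power n"
    by (rule ideal_power_Suc_eq_PIdl_prod[OF principal_reduction_mem[OF x]])
  then have "reduction_number_wrt R (PIdl x) I \<le> n"
    unfolding reduction_number_wrt_def by (rule Least_le)
  moreover have "reduction_number R I \<le> reduction_number_wrt R (PIdl x) I"
    unfolding reduction_number_def
    by (rule cInf_lower) (use minimal_reduction_PIdl[OF x] in auto)
  ultimately show "reduction_number R I \<le> n" by simp
qed

end

section \<open>Polarization\<close>

context cring
begin

text \<open>\<open>differences_vanish n f\<close>: the \<open>n\<close>-th iterated difference of the sequence \<open>f\<close> is zero, as it
  is for the values of a polynomial of degree less than \<open>n\<close>.\<close>

primrec differences_vanish :: "nat \<Rightarrow> (nat \<Rightarrow> 'a) \<Rightarrow> bool"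
  where "differences_vanish 0 f \<longleftrightarrow> (\<forall>i. f i = \<zero>)"
  | "differences_vanish (Suc n) f \<longleftrightarrow> differences_vanish n (\<lambda>i. f (Suc i) \<ominus> f i)"

lemma differences_vanish_shift:
  "differences_vanish n f \<Longrightarrow> differences_vanish n (\<lambda>i. f (Suc i))"
  by (induction n arbitrary: f) auto

lemma differences_vanish_Suc:
  "differences_vanish n f \<Longrightarrow> differences_vanish (Suc n) f"
proof (induction n arbitrary: f)
  case 0
  then show ?case by simp
next
  case (Suc n)
  then have "differences_vanish (Suc n) (\<lambda>i. f (Suc i) \<ominus> f i)" by (intro Suc.IH) simp
  then show ?case by simp
qed

lemma differences_vanish_add:
  assumes "\<And>i. f i \<in> carrier R" "\<And>i. g i \<in> carrier R" "differences_vanish n f" "differences_vanish n g"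
  shows "differences_vanish n (\<lambda>i. f i \<oplus> g i)"
  using assms
proof (induction n arbitrary: f g)
  case 0
  then show ?case by simp
next
  case (Suc n)
  have eq: "(f (Suc i) \<oplus> g (Suc i)) \<ominus> (f i \<oplus> g i) = (f (Suc i) \<ominus> f i) \<oplus> (g (Suc i) \<ominus> g i)" for i
    using Suc.prems(1)[of i] Suc.prems(1)[of "Suc i"] Suc.prems(2)[of i] Suc.prems(2)[of "Suc i"] by algebra
  have "differences_vanish n (\<lambda>i. (f (Suc i) \<ominus> f i) \<oplus> (g (Suc i) \<ominus> g i))"
    by (rule Suc.IH) (use Suc.prems in auto)
  then show ?case by (simp add: eq)
qed

lemma differences_vanish_const_mult:
  assumes "\<And>i. f i \<in> carrier R" "r \<in> carrier R" "differences_vanish n f"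
  shows "differences_vanish n (\<lambda>i. r \<otimes> f i)"
  using assms
proof (induction n arbitrary: f)
  case 0
  then show ?case by simp
next
  case (Suc n)
  have eq: "r \<otimes> f (Suc i) \<ominus> r \<otimes> f i = r \<otimes> (f (Suc i) \<ominus> f i)" for i
    using Suc.prems(1)[of i] Suc.prems(1)[of "Suc i"] Suc.prems(2) by algebra
  have "differences_vanish n (\<lambda>i. r \<otimes> (f (Suc i) \<ominus> f i))"
    by (rule Suc.IH) (use Suc.prems in auto)
  then show ?case by (simp add: eq)
qed

lemma differences_vanish_index_mult:
  assumes "\<And>i. f i \<in> carrier R" "differences_vanish n f"
  shows "differences_vanish (Suc n) (\<lambda>i. nat_embed i \<otimes> f i)"
  using assms
proof (induction n arbitrary: f)
  case 0
  then show ?case by simp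
next
  case (Suc n)
  have eq: "nat_embed (Suc i) \<otimes> f (Suc i) \<ominus> nat_embed i \<otimes> f i
      = nat_embed i \<otimes> (f (Suc i) \<ominus> f i) \<oplus> f (Suc i)" for i
    unfolding nat_embed_Suc using Suc.prems(1)[of i] Suc.prems(1)[of "Suc i"] nat_embed_closed[of i] by algebra
  have "differences_vanish (Suc n) (\<lambda>i. nat_embed i \<otimes> (f (Suc i) \<ominus> f i))"
    by (rule Suc.IH) (use Suc.prems in auto)
  then have "differences_vanish (Suc n) (\<lambda>i. nat_embed i \<otimes> (f (Suc i) \<ominus> f i) \<oplus> f (Suc i))"
    by (rule differences_vanish_add[rotated 2]) (use Suc.prems differences_vanish_shift in auto)
  then show ?case by (simp only: differences_vanish.simps(2)[of "Suc n"] eq)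
qed

text \<open>This gives access to the value at \<open>0\<close> of a difference quotient, which division by the index
  reaches only at positive indices.\<close>

lemma differences_vanish_extrapolate:
  assumes A: "ideal A R" and "\<And>i. f i \<in> carrier R" "differences_vanish n f" "\<And>i. i > 0 \<Longrightarrow> f i \<in> A"
  shows "f 0 \<in> A"
  using assms(2-)
proof (induction n arbitrary: f)
  case 0
  then show ?case using ideal_zero[OF A] by simp
next
  case (Suc n)
  have "f (Suc 0) \<ominus> f 0 \<in> A"
    by (rule Suc.IH[of "\<lambda>i. f (Suc i) \<ominus> f i"]) (use Suc.prems ideal_minus[OF A] in auto)
  then have "f (Suc 0) \<ominus> (f (Suc 0) \<ominus> f 0) \<in> A" using ideal_minus[OF A] Suc.prems(3) by blast
  moreover have "f (Suc 0) \<ominus> (f (Suc 0) \<ominus> f 0) = f 0"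
    using Suc.prems(1)[of 0] Suc.prems(1)[of "Suc 0"] by algebra
  ultimately show ?case by simp
qed

lemma line_power_Suc:
  assumes y: "y \<in> carrier R" and w: "w \<in> carrier R"
  shows "line y w i [^] Suc m = y \<otimes> line y w i [^] m \<oplus> nat_embed i \<otimes> (w \<otimes> line y w i [^] m)"
proof -
  have "p \<otimes> line y w i = y \<otimes> p \<oplus> nat_embed i \<otimes> (w \<otimes> p)" if "p \<in> carrier R" for p
    unfolding line_def using that y w nat_embed_closed[of i] by algebra
  then show ?thesis using y w by simp
qed

text \<open>The difference quotient \<open>((y + i w)\<^sup>m - y\<^sup>m) / i\<close>.\<close>

primrec line_quotient :: "'a \<Rightarrow> 'a \<Rightarrow> nat \<Rightarrow> nat \<Rightarrow> 'a"
  where "line_quotient y w 0 i = \<zero>"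
  | "line_quotient y w (Suc m) i = y \<otimes> line_quotient y w m i \<oplus> w \<otimes> line y w i [^] m"

lemma line_quotient_closed [simp]:
  "y \<in> carrier R \<Longrightarrow> w \<in> carrier R \<Longrightarrow> line_quotient y w m i \<in> carrier R"
  by (induction m) auto

lemma line_power_eq:
  assumes y: "y \<in> carrier R" and w: "w \<in> carrier R"
  shows "line y w i [^] m = y [^] m \<oplus> nat_embed i \<otimes> line_quotient y w m i"
proof (induction m)
  case 0
  then show ?case by simp
next
  case (Suc m)
  have c: "line y w i [^] m \<in> carrier R" "y [^] m \<in> carrier R" "line_quotient y w m i \<in> carrier R"
    using y w by auto
  have "line y w i [^] Suc m = y \<otimes> line y w i [^] m \<oplus> nat_embed i \<otimes> (w \<otimes> line y w i [^] m)"
    by (rule line_power_Suc[OF y w])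
  also have "y \<otimes> line y w i [^] m = y [^] Suc m \<oplus> nat_embed i \<otimes> (y \<otimes> line_quotient y w m i)"
    unfolding Suc.IH using c y nat_embed_closed[of i] by (simp add: r_distr m_ac)
  finally show ?case
    using c y w nat_embed_closed[of i] by (simp add: r_distr a_assoc)
qed

lemma line_quotient_0:
  assumes y: "y \<in> carrier R" and w: "w \<in> carrier R"
  shows "line_quotient y w (Suc m) 0 = nat_embed (Suc m) \<otimes> (y [^] m \<otimes> w)"
proof (induction m)
  case 0
  then show ?case using y w by simp
next
  case (Suc m)
  have c: "y [^] m \<in> carrier R" using y by simp
  have "line_quotient y w (Suc (Suc m)) 0
      = y \<otimes> (nat_embed (Suc m) \<otimes> (y [^] m \<otimes> w)) \<oplus> w \<otimes> (y [^] m \<otimes> y)"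
    unfolding line_quotient.simps(2)[of y w "Suc m"] Suc.IH using y w by (simp add: line_def)
  also have "\<dots> = nat_embed (Suc (Suc m)) \<otimes> (y [^] Suc m \<otimes> w)"
    unfolding nat_embed_Suc[of "Suc m"] nat_pow_Suc using y w c nat_embed_closed[of "Suc m"] by algebra
  finally show ?case .
qed

lemma line_power_differences_vanish:
  assumes y: "y \<in> carrier R" and w: "w \<in> carrier R"
  shows "differences_vanish (Suc m) (\<lambda>i. line y w i [^] m)"
proof (induction m)
  case 0
  then show ?case by simp
next
  case (Suc m)
  have eq: "line y w i [^] Suc m = y \<otimes> line y w i [^] m \<oplus> nat_embed i \<otimes> (w \<otimes> line y w i [^] m)" for i
    by (rule line_power_Suc[OF y w])
  show ?case unfolding eq
  proof (rule differences_vanish_add)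
    show "differences_vanish (Suc (Suc m)) (\<lambda>i. y \<otimes> line y w i [^] m)"
      by (intro differences_vanish_Suc differences_vanish_const_mult Suc.IH) (use y w in auto)
    show "differences_vanish (Suc (Suc m)) (\<lambda>i. nat_embed i \<otimes> (w \<otimes> line y w i [^] m))"
      by (intro differences_vanish_index_mult differences_vanish_const_mult Suc.IH) (use y w in auto)
  qed (use y w in auto)
qed

lemma line_quotient_differences_vanish:
  assumes y: "y \<in> carrier R" and w: "w \<in> carrier R"
  shows "differences_vanish m (line_quotient y w m)"
proof (induction m)
  case 0
  then show ?case by simp
next
  case (Suc m)
  have "differences_vanish (Suc m) (\<lambda>i. y \<otimes> line_quotient y w m i \<oplus> w \<otimes> line y w i [^] m)"
  proof (rule differences_vanish_add)
    show "differences_vanish (Suc m) (\<lambda>i. y \<otimes> line_quotient y w m i)"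
      by (intro differences_vanish_Suc differences_vanish_const_mult Suc.IH) (use y w in auto)
    show "differences_vanish (Suc m) (\<lambda>i. w \<otimes> line y w i [^] m)"
      by (intro differences_vanish_const_mult line_power_differences_vanish) (use y w in auto)
  qed (use y w in auto)
  then show ?case by (simp del: differences_vanish.simps)
qed

text \<open>When the positive integers are units, \<open>A\<^sup>k\<close> is generated by \<open>k\<close>-th powers: in
  \<open>y\<^sup>m\<close>, replace \<open>y\<close> by \<open>y + i w\<close> and extract the linear coefficient \<open>m y\<^bsup>m-1\<^esup> w\<close>.\<close>

lemma ideal_power_subset_if_powers_mem:
  assumes A: "ideal A R" and B: "ideal B R" and units: "\<And>n. n > 0 \<Longrightarrow> nat_embed n \<in> Units R"
    and pow: "\<And>y. y \<in> A \<Longrightarrow> y [^] k \<in> B"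
  shows "ideal_power R A k \<subseteq> B"
proof -
  have Ac: "y \<in> carrier R" if "y \<in> A" for y using ideal_in_carrier[OF A that] .
  have AP: "ideal (ideal_power R A j) R" for j by (rule ideal_power_ideal[OF A])
  have "\<forall>y\<in>A. ideal_power R A j \<subseteq> elem_colon B (y [^] (k - j))" if "j \<le> k" for j
    using that
  proof (induction j)
    case 0
    show ?case
      using pow Ac ideal_mult_l[OF B] by (auto simp: ideal_power_0 elem_colon_def)
  next
    case (Suc j)
    obtain m where m: "k - j = Suc m" "k - Suc j = m" using Suc.prems by (metis Suc_diff_Suc Suc_le_lessD)
    show ?case
    proof
      fix y assume y: "y \<in> A"
      have yc: "y \<in> carrier R" by (rule Ac[OF y])
      have ym: "y [^] m \<in> carrier R" using yc by simp
      have "v \<otimes> w \<in> elem_colon B (y [^] m)" if v: "v \<in> ideal_power R A j" and w: "w \<in> A" for v w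
      proof -
        have vc: "v \<in> carrier R" by (rule ideal_in_carrier[OF AP v])
        have wc: "w \<in> carrier R" by (rule Ac[OF w])
        let ?q = "\<lambda>i. v \<otimes> line_quotient y w (Suc m) i"
        have line: "v \<otimes> line y w i [^] Suc m \<in> B" for i
          using Suc.IH Suc.prems v line_mem[OF A y w, of i] m by (auto simp: elem_colon_def)
        have mult: "nat_embed i \<otimes> ?q i \<in> B" for i
        proof -
          have q: "line_quotient y w (Suc m) i \<in> carrier R" using yc wc by (rule line_quotient_closed)
          have yS: "y [^] Suc m \<in> carrier R" using yc by (rule nat_pow_closed)
          have "line y w 0 = y" using yc wc by (simp add: line_def)
          then have "v \<otimes> y [^] Suc m \<in> B" using line[of 0] by simp
          then have "v \<otimes> line y w i [^] Suc m \<ominus> v \<otimes> y [^] Suc m \<in> B" using line ideal_minus[OF B] by blast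
          moreover have "v \<otimes> line y w i [^] Suc m \<ominus> v \<otimes> y [^] Suc m = nat_embed i \<otimes> ?q i"
            unfolding line_power_eq[OF yc wc, of i "Suc m"]
            using vc yS q nat_embed_closed[of i] by algebra
          ultimately show ?thesis by simp
        qed
        have "?q 0 \<in> B"
        proof (rule differences_vanish_extrapolate[OF B])
          show "?q i \<in> carrier R" for i using vc line_quotient_closed[OF yc wc] by blast
          show "differences_vanish (Suc m) ?q"
            by (rule differences_vanish_const_mult[OF line_quotient_closed[OF yc wc] vc
                  line_quotient_differences_vanish[OF yc wc]])
          show "?q i \<in> B" if "i > 0" for i
            using Unit_mult_mem_cancel[OF B units[OF that] mult] vc line_quotient_closed[OF yc wc] by blast
        qed
        moreover have "?q 0 = nat_embed (Suc m) \<otimes> ((v \<otimes> w) \<otimes> y [^] m)"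
          unfolding line_quotient_0[OF yc wc] using vc wc ym nat_embed_closed[of "Suc m"] by (simp add: m_ac)
        ultimately have "(v \<otimes> w) \<otimes> y [^] m \<in> B"
          using Unit_mult_mem_cancel[OF B units[of "Suc m"]] vc wc ym by simp
        then show ?thesis using vc wc by (simp add: elem_colon_def)
      qed
      then show "ideal_power R A (Suc j) \<subseteq> elem_colon B (y [^] (k - Suc j))"
        unfolding m(2) ideal_power_Suc by (intro ideal_prod_subset ideal_elem_colon[OF B ym])
    qed
  qed
  from this[of k] show ?thesis
    using ideal_zero[OF A] ideal_in_carrier[OF AP] by (fastforce simp: elem_colon_def)
qed

end

section \<open>The core\<close>

lemma (in cring) mem_ideal_colon:
  "c \<in> ideal_colon R A B \<longleftrightarrow> c \<in> carrier R \<and> (\<forall>b\<in>B. c \<otimes> b \<in> A)"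
  by (simp add: ideal_colon_def)

context one_dim_CM_ideal
begin

abbreviation colon_power :: "'a \<Rightarrow> nat \<Rightarrow> 'a set"
  where "colon_power x n \<equiv> ideal_colon R (PIdl (x [^] Suc n)) (I_power n)"

lemma mem_core_iff: "a \<in> core R I \<longleftrightarrow> (\<forall>x. principal_reduction x I \<longrightarrow> a \<in> PIdl x)"
proof
  assume "a \<in> core R I"
  then show "\<forall>x. principal_reduction x I \<longrightarrow> a \<in> PIdl x"
    using reduction_PIdl unfolding core_def by blast
next
  assume a: "\<forall>x. principal_reduction x I \<longrightarrow> a \<in> PIdl x"
  show "a \<in> core R I"
    unfolding core_def
  proof (intro InterI)
    fix J assume "J \<in> {J. reduction R J I}"
    then have J: "reduction R J I" by simp
    then have JI: "ideal J R" by (simp add: reduction_def)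
    obtain x where "x \<in> J" "principal_reduction x I" by (rule reduction_contains_principal[OF J])
    then show "a \<in> J" using a cgenideal_minimal[OF JI] by blast
  qed
qed

lemma colon_power_subset_PIdl:
  assumes x: "principal_reduction x I" shows "colon_power x n \<subseteq> PIdl x"
proof
  fix c assume c: "c \<in> colon_power x n"
  have xc: "x \<in> carrier R" by (rule principal_reduction_closed[OF x])
  have "c \<otimes> x [^] n \<in> PIdl (x [^] Suc n)"
    using c elem_power_mem_1[OF ideal_I principal_reduction_mem[OF x]] by (simp add: mem_ideal_colon)
  then have "x [^] n \<otimes> c \<in> PIdl (x [^] n \<otimes> x)" using c xc by (simp add: mem_ideal_colon m_comm)
  then show "c \<in> PIdl x"
    using PIdl_cancel[OF nonzerodivisor_pow[OF principal_reduction_nonzerodivisor[OF x]] xc] c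
    by (simp add: mem_ideal_colon)
qed

text \<open>For \<open>c I\<^sup>n \<subseteq> (x\<^bsup>n+1\<^esup>)\<close> and \<open>x\<^bsup>n+1\<^esup> = y u\<close> with \<open>u \<in> I\<^sup>n\<close>, the element \<open>c u\<close> is a
  multiple of \<open>y u\<close>.\<close>

lemma colon_power_subset_core:
  assumes x: "principal_reduction x I" and red: "I_power (Suc n) \<subseteq> mult_ideal x (I_power n)"
  shows "colon_power x n \<subseteq> core R I"
proof
  fix c assume c: "c \<in> colon_power x n"
  have cc: "c \<in> carrier R" using c by (simp add: mem_ideal_colon)
  have xc: "x \<in> carrier R" by (rule principal_reduction_closed[OF x])
  have "c \<in> PIdl y" if y: "principal_reduction y I" for y
  proof -
    have yc: "y \<in> carrier R" by (rule principal_reduction_closed[OF y])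
    have "x [^] Suc n \<in> I_power (Suc n)" by (rule elem_power_mem_1[OF ideal_I principal_reduction_mem[OF x]])
    then have "x [^] Suc n \<in> mult_ideal y (I_power n)" using reduction_exponent_independent[OF x y red] by blast
    then obtain u where u: "u \<in> I_power n" "x [^] Suc n = y \<otimes> u" by (rule mult_idealE)
    have uc: "u \<in> carrier R" by (rule I_power_closed[OF u(1)])
    have nz: "nonzerodivisor u"
    proof (rule nonzerodivisor_dvd[OF _ yc uc])
      show "nonzerodivisor (y \<otimes> u)"
        unfolding u(2)[symmetric] by (rule nonzerodivisor_pow[OF principal_reduction_nonzerodivisor[OF x]])
    qed
    have "c \<otimes> u \<in> PIdl (y \<otimes> u)" using c u by (simp add: mem_ideal_colon)
    then have "u \<otimes> c \<in> PIdl (u \<otimes> y)" using cc uc yc by (simp add: m_comm)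
    then show ?thesis by (rule PIdl_cancel[OF nz yc cc])
  qed
  then show "c \<in> core R I" unfolding mem_core_iff by blast
qed

text \<open>Integrality of \<open>y / x\<close>: the ideals \<open>x\<^sup>n P\<^sup>j : x\<^sup>j\<close> become stationary.\<close>

lemma pair_ideal_reduction:
  assumes x: "principal_reduction x I" and y: "y \<in> I"
  obtains d where "ideal_power R (pair_ideal x y) (Suc d) \<subseteq> mult_ideal x (ideal_power R (pair_ideal x y) d)"
proof -
  have xI: "x \<in> I" by (rule principal_reduction_mem[OF x])
  have xc: "x \<in> carrier R" and yc: "y \<in> carrier R" using I_closed xI y by auto
  let ?P = "pair_ideal x y"
  note P = pair_ideal[OF xc yc]
  have PI: "ideal (ideal_power R ?P j) R" for j by (rule ideal_power_ideal[OF P(1)])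
  obtain n where n: "I_power (Suc n) \<subseteq> mult_ideal x (I_power n)" using x principal_reduction_def by blast
  define L where "L j = elem_colon (mult_ideal (x [^] n) (ideal_power R ?P j)) (x [^] j)" for j
  have LI: "ideal (L j) R" for j
    unfolding L_def using xc by (intro ideal_elem_colon ideal_mult_ideal PI) auto
  have "L 0 \<in> {L j | j. True}" by blast
  then obtain M where M: "M \<in> {L j | j. True}" "\<And>B. B \<in> {L j | j. True} \<Longrightarrow> M \<subseteq> B \<Longrightarrow> B = M"
    by (rule ex_maximal_ideal_in) (use LI in auto)
  then obtain d where d: "M = L d" by blast
  have "L d \<subseteq> L (Suc d)"
  proof
    fix v assume "v \<in> L d"
    then have v: "v \<in> carrier R" "v \<otimes> x [^] d \<in> mult_ideal (x [^] n) (ideal_power R ?P d)"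
      by (auto simp: L_def elem_colon_def)
    obtain g where g: "g \<in> ideal_power R ?P d" "v \<otimes> x [^] d = x [^] n \<otimes> g" using v(2) by (rule mult_idealE)
    have gc: "g \<in> carrier R" by (rule ideal_in_carrier[OF PI g(1)])
    have "v \<otimes> x [^] Suc d = (v \<otimes> x [^] d) \<otimes> x" using v(1) xc by (simp add: m_assoc)
    also have "\<dots> = x [^] n \<otimes> (x \<otimes> g)" unfolding g(2) using xc gc by (simp add: m_ac)
    also have "\<dots> \<in> mult_ideal (x [^] n) (ideal_power R ?P (Suc d))"
      by (rule mult_idealI[OF ideal_power_mult_mem_Suc[OF P(1,2) g(1)]])
    finally show "v \<in> L (Suc d)" using v(1) by (simp add: L_def elem_colon_def)
  qed
  then have eq: "L (Suc d) = L d" using M(2)[of "L (Suc d)"] d by blast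
  have "x [^] n \<otimes> y [^] Suc d \<in> I_power (n + Suc d)"
    by (rule ideal_power_mult_mem[OF ideal_I elem_power_mem_1[OF ideal_I xI] elem_power_mem_1[OF ideal_I y]])
  then have "x [^] n \<otimes> y [^] Suc d \<in> mult_ideal (x [^] Suc d) (I_power n)"
    using ideal_power_factor[OF ideal_I xc n, of "Suc d"] by blast
  then obtain v where v: "v \<in> I_power n" "x [^] n \<otimes> y [^] Suc d = x [^] Suc d \<otimes> v" by (rule mult_idealE)
  have vc: "v \<in> carrier R" by (rule I_power_closed[OF v(1)])
  have "v \<otimes> x [^] Suc d = x [^] n \<otimes> y [^] Suc d"
    unfolding v(2) by (rule m_comm) (use vc xc in auto)
  then have "v \<otimes> x [^] Suc d \<in> mult_ideal (x [^] n) (ideal_power R ?P (Suc d))"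
    using mult_idealI[OF elem_power_mem_1[OF P(1,3)]] by metis
  then have "v \<in> L (Suc d)" using vc by (simp add: L_def elem_colon_def)
  then have "v \<in> L d" unfolding eq .
  then have "v \<otimes> x [^] d \<in> mult_ideal (x [^] n) (ideal_power R ?P d)" by (simp add: L_def elem_colon_def)
  then obtain g where g: "g \<in> ideal_power R ?P d" "v \<otimes> x [^] d = x [^] n \<otimes> g" by (rule mult_idealE)
  have gc: "g \<in> carrier R" by (rule ideal_in_carrier[OF PI g(1)])
  have "x [^] n \<otimes> y [^] Suc d = (v \<otimes> x [^] d) \<otimes> x" unfolding v(2) using vc xc by (simp add: m_ac)
  also have "\<dots> = x [^] n \<otimes> (x \<otimes> g)" unfolding g(2) using xc gc by (simp add: m_ac)
  finally have "y [^] Suc d = x \<otimes> g"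
    by (rule nonzerodivisor_cancel[OF nonzerodivisor_pow[OF principal_reduction_nonzerodivisor[OF x]]])
      (use xc yc gc in auto)
  then have "y [^] Suc d \<in> mult_ideal x (ideal_power R ?P d)" using mult_idealI[OF g(1)] by simp
  then have "adjoin (mult_ideal x (ideal_power R ?P d)) (y [^] Suc d) \<subseteq> mult_ideal x (ideal_power R ?P d)"
    by (intro adjoin_minimal ideal_mult_ideal PI xc subset_refl)
  then show ?thesis using pair_ideal_power_subset[OF xc yc, of d] by (intro that) blast
qed

text \<open>A set of exceptional points could not contain more points than the length of \<open>R / (x)\<close>
  allows.\<close>

lemma infinite_line_reductions:
  assumes x: "principal_reduction x I" and y: "y \<in> I"
  shows "infinite {i. principal_reduction (line x y i) I}" (is "infinite ?G")
proof
  assume fin: "finite ?G"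
  have xI: "x \<in> I" by (rule principal_reduction_mem[OF x])
  have xc: "x \<in> carrier R" and yc: "y \<in> carrier R" using I_closed xI y by auto
  have xm: "x \<in> \<mm>" using xI I_subset_max by blast
  obtain l where l: "\<forall>S. finite S \<and> card S = Suc (Suc l) \<longrightarrow> (\<exists>i\<in>S. ideal_power R (pair_ideal x y) (Suc l)
    \<subseteq> mult_ideal (line x y i) (ideal_power R (pair_ideal x y) l))"
    by (rule ex_good_lines[OF xm principal_reduction_max_primary[OF x] yc])
  obtain n where n: "I_power (Suc n) \<subseteq> mult_ideal x (I_power n)" using x principal_reduction_def by blast
  have "infinite (- ?G)" using fin finite_compl infinite_UNIV_nat by blast
  then obtain S where S: "finite S" "card S = Suc (Suc l)" "S \<subseteq> - ?G"
    using infinite_arbitrarily_large by blast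
  obtain i where i: "i \<in> S" "ideal_power R (pair_ideal x y) (Suc l)
    \<subseteq> mult_ideal (line x y i) (ideal_power R (pair_ideal x y) l)" using l S by blast
  define c where "c = line x y i"
  have cI: "c \<in> I" unfolding c_def by (rule line_mem[OF ideal_I xI y])
  have cc: "c \<in> carrier R" by (rule I_closed[OF cI])
  have "x [^] Suc l \<in> mult_ideal c (I_power l)"
    by (rule pair_reduction_power[OF ideal_I xI y cc i(2)[folded c_def] pair_ideal(2)[OF xc yc]])
  then obtain w where w: "w \<in> I_power l" "x [^] Suc l = c \<otimes> w" by (rule mult_idealE)
  have "I_power (Suc (n + l)) \<subseteq> mult_ideal c (I_power (n + l))"
  proof
    fix v assume "v \<in> I_power (Suc (n + l))"
    then have "v \<in> mult_ideal (x [^] Suc l) (I_power n)"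
      using ideal_power_factor[OF ideal_I xc n, of "Suc l"] by auto
    then obtain u where u: "u \<in> I_power n" "v = x [^] Suc l \<otimes> u" by (rule mult_idealE)
    have "v = c \<otimes> (w \<otimes> u)"
      unfolding u(2) w(2) by (rule m_assoc[OF cc I_power_closed[OF w(1)] I_power_closed[OF u(1)]])
    moreover have "w \<otimes> u \<in> I_power (n + l)"
      using ideal_power_mult_mem[OF ideal_I w(1) u(1)] by (simp add: add.commute)
    ultimately show "v \<in> mult_ideal c (I_power (n + l))" using mult_idealI by simp
  qed
  then have "principal_reduction c I" using cI unfolding principal_reduction_def by blast
  then have "i \<in> ?G" by (simp add: c_def)
  then show False using i(1) S(3) by blast
qed

text \<open>If \<open>a\<close> is divisible by pairwise independent points of the line through \<open>x\<close> and \<open>y\<close>, then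
  \<open>a P\<^sup>D\<close> is divisible by their product: over a field, the products of all but one of the points
  are a basis of the forms of degree \<open>D\<close>.\<close>

lemma mult_by_pair_power:
  assumes x: "x \<in> carrier R" and y: "y \<in> carrier R" and a: "a \<in> carrier R"
    and L: "finite L" "card L = Suc D" "\<And>i. i \<in> L \<Longrightarrow> a \<in> PIdl (line x y i)"
  shows "ideal_power R (pair_ideal x y) D \<subseteq> elem_colon (PIdl (finprod R (line x y) L)) a"
  using L
proof (induction D arbitrary: L)
  case 0
  then obtain i where i: "L = {i}" using card_1_singletonE by (metis One_nat_def)
  have lc: "line x y i \<in> carrier R" using x y by simp
  then have "finprod R (line x y) L = line x y i" unfolding i by simp
  moreover have "a \<in> PIdl (line x y i)" using 0(3) i by simp
  ultimately show ?case
    using ideal_mult_l[OF cgenideal_ideal[OF lc]] by (auto simp: ideal_power_0 elem_colon_def)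
next
  case (Suc D)
  let ?p = "finprod R (line x y)"
  let ?P = "pair_ideal x y"
  have lc: "line x y i \<in> carrier R" for i using x y by simp
  then have pc: "?p F \<in> carrier R" for F by (intro finprod_closed) auto
  have QI: "ideal (PIdl (?p L)) R" by (rule cgenideal_ideal[OF pc])
  obtain i where iL: "i \<in> L" using Suc.prems(2) by (metis card.empty ex_in_conv nat.distinct(1))
  have "card (L - {i}) = Suc D" using iL Suc.prems by simp
  then obtain j where jL: "j \<in> L" "j \<noteq> i" by (metis Diff_iff card.empty ex_in_conv insertCI nat.distinct(1))
  obtain u where u: "u \<in> Units R" "line x y j = line x y i \<oplus> u \<otimes> y"
    using line_shift[OF x y, of i j] jL by blast
  have uc: "u \<in> carrier R" using u Units_closed by blast
  have step: "line x y k \<otimes> (h \<otimes> a) \<in> PIdl (?p L)" if k: "k \<in> L" and h: "h \<in> ideal_power R ?P D" for k h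
  proof -
    have "ideal_power R ?P D \<subseteq> elem_colon (PIdl (?p (L - {k}))) a"
      by (rule Suc.IH) (use Suc.prems k in auto)
    then obtain r where r: "r \<in> carrier R" "h \<otimes> a = r \<otimes> ?p (L - {k})"
      using h by (auto simp: elem_colon_def mem_PIdl)
    have eq: "L = insert k (L - {k})" using k by blast
    have "?p L = line x y k \<otimes> ?p (L - {k})"
      by (subst eq, subst finprod_insert) (use Suc.prems lc in auto)
    then have "line x y k \<otimes> (h \<otimes> a) = r \<otimes> ?p L"
      unfolding r(2) using r(1) lc[of k] pc by (simp add: m_lcomm)
    then show ?thesis using r(1) mem_PIdl by blast
  qed
  have "h \<otimes> s \<in> elem_colon (PIdl (?p L)) a" if h: "h \<in> ideal_power R ?P D" and s: "s \<in> ?P" for h s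
  proof -
    have hc: "h \<in> carrier R"
      using ideal_in_carrier[OF ideal_power_ideal[OF pair_ideal(1)[OF x y]] h] .
    define g where "g = h \<otimes> a"
    have gc: "g \<in> carrier R" using hc a by (simp add: g_def)
    have gi: "line x y i \<otimes> g \<in> PIdl (?p L)" and gj: "line x y j \<otimes> g \<in> PIdl (?p L)"
      unfolding g_def using step iL jL h by auto
    have "u \<otimes> (y \<otimes> g) = line x y j \<otimes> g \<ominus> line x y i \<otimes> g"
      unfolding u(2) using lc[of i] uc y gc by algebra
    then have "u \<otimes> (y \<otimes> g) \<in> PIdl (?p L)" using ideal_minus[OF QI gj gi] by simp
    then have yg: "y \<otimes> g \<in> PIdl (?p L)" by (rule Unit_mult_mem_cancel[OF QI u(1)]) (use y gc in auto)
    have "x \<otimes> g = line x y i \<otimes> g \<ominus> nat_embed i \<otimes> (y \<otimes> g)"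
      unfolding line_def using x y gc nat_embed_closed[of i] by algebra
    then have xg: "x \<otimes> g \<in> PIdl (?p L)"
      using ideal_minus[OF QI gi ideal_mult_l[OF QI nat_embed_closed yg]] by simp
    obtain r t where rt: "r \<in> carrier R" "t \<in> carrier R" "s = r \<otimes> x \<oplus> t \<otimes> y"
      using s by (auto simp: mem_adjoin mem_PIdl)
    have "(h \<otimes> s) \<otimes> a = r \<otimes> (x \<otimes> g) \<oplus> t \<otimes> (y \<otimes> g)"
      unfolding rt(3) g_def using rt(1,2) x y hc a by algebra
    then have "(h \<otimes> s) \<otimes> a \<in> PIdl (?p L)"
      using ideal_add[OF QI ideal_mult_l[OF QI rt(1) xg] ideal_mult_l[OF QI rt(2) yg]] by simp
    moreover have "s \<in> carrier R" using s ideal_in_carrier[OF pair_ideal(1)[OF x y]] by blast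
    ultimately show ?thesis using hc by (simp add: elem_colon_def)
  qed
  then show ?case
    unfolding ideal_power_Suc by (intro ideal_prod_subset ideal_elem_colon[OF QI a])
qed

text \<open>An element \<open>a\<close> of the core is divisible by infinitely many points of the line, so \<open>a P\<^sup>D\<close>
  is divisible by the product \<open>q\<close> of any \<open>D + 1\<close> of them. In \<open>R[y / x]\<close> this product is
  \<open>x\<^bsup>D+1\<^esup>\<close> times a unit, because \<open>q P\<^sup>D \<subseteq> P\<^bsup>2D+1\<^esup> = x\<^bsup>D+1\<^esup> P\<^sup>D\<close>, so that \<open>q\<close> can be replaced by
  \<open>x\<^bsup>D+1\<^esup>\<close>.\<close>

lemma core_mult_power:
  assumes a: "a \<in> core R I" and x: "principal_reduction x I" and y: "y \<in> I"
  shows "y [^] k \<otimes> a \<in> PIdl (x [^] Suc k)"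
proof -
  have xI: "x \<in> I" by (rule principal_reduction_mem[OF x])
  have xc: "x \<in> carrier R" and yc: "y \<in> carrier R" using I_closed xI y by auto
  have nz: "nonzerodivisor x" by (rule principal_reduction_nonzerodivisor[OF x])
  have ac: "a \<in> carrier R"
    using a x ideal_in_carrier[OF cgenideal_ideal[OF xc]] unfolding mem_core_iff by blast
  let ?P = "pair_ideal x y"
  note P = pair_ideal[OF xc yc]
  have PI: "ideal (ideal_power R ?P j) R" for j by (rule ideal_power_ideal[OF P(1)])
  have Pc: "v \<in> carrier R" if "v \<in> ideal_power R ?P j" for v j by (rule ideal_in_carrier[OF PI that])
  obtain d where d: "ideal_power R ?P (Suc d) \<subseteq> mult_ideal x (ideal_power R ?P d)"
    by (rule pair_ideal_reduction[OF x y])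
  define D where "D = d + k"
  have D: "ideal_power R ?P (Suc D) \<subseteq> mult_ideal x (ideal_power R ?P D)"
    unfolding D_def by (rule ideal_power_absorb[OF P(1) xc d])
  obtain L where L: "finite L" "card L = Suc D" "L \<subseteq> {i. principal_reduction (line x y i) I}"
    using infinite_arbitrarily_large[OF infinite_line_reductions[OF x y]] by metis
  define q where "q = finprod R (line x y) L"
  have lc: "line x y i \<in> carrier R" for i using xc yc by simp
  have qc: "q \<in> carrier R" unfolding q_def using lc by (intro finprod_closed) auto
  have qnz: "nonzerodivisor q"
    unfolding q_def using L(1,3)
  proof (induction L)
    case empty
    then show ?case by (simp add: nonzerodivisor_def)
  next
    case (insert i F)
    have "finprod R (line x y) (insert i F) = line x y i \<otimes> finprod R (line x y) F"
      by (rule finprod_insert) (use insert lc in auto)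
    moreover have "nonzerodivisor (line x y i)" using insert principal_reduction_nonzerodivisor by simp
    ultimately show ?case using insert nonzerodivisor_mult by simp
  qed
  have qP: "q \<in> ideal_power R ?P (Suc D)"
    unfolding q_def L(2)[symmetric]
    by (rule finprod_mem_ideal_power[OF P(1) L(1)]) (rule line_mem[OF P])
  have div: "ideal_power R ?P D \<subseteq> elem_colon (PIdl q) a"
    unfolding q_def
    by (rule mult_by_pair_power[OF xc yc ac L(1,2)]) (use a L(3) in \<open>auto simp: mem_core_iff\<close>)
  have all: "w \<otimes> a \<in> PIdl (x [^] Suc D)" if w: "w \<in> ideal_power R ?P D" for w
  proof -
    have wc: "w \<in> carrier R" by (rule Pc[OF w])
    have xS: "x [^] Suc D \<in> carrier R" using xc by (rule nat_pow_closed)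
    have "w \<otimes> q \<in> ideal_power R ?P (D + Suc D)" by (rule ideal_power_mult_mem[OF P(1) w qP])
    then have "w \<otimes> q \<in> mult_ideal (x [^] Suc D) (ideal_power R ?P D)"
      using ideal_power_factor[OF P(1) xc D, of "Suc D"] by blast
    then obtain w' where w': "w' \<in> ideal_power R ?P D" "w \<otimes> q = x [^] Suc D \<otimes> w'" by (rule mult_idealE)
    have w'c: "w' \<in> carrier R" by (rule Pc[OF w'(1)])
    obtain v where v: "v \<in> carrier R" "w' \<otimes> a = v \<otimes> q"
      using div w'(1) by (auto simp: elem_colon_def mem_PIdl)
    have "q \<otimes> (w \<otimes> a) = (w \<otimes> q) \<otimes> a" using qc wc ac by (simp add: m_ac)
    also have "\<dots> = x [^] Suc D \<otimes> (w' \<otimes> a)" unfolding w'(2) by (rule m_assoc[OF xS w'c ac])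
    also have "\<dots> = q \<otimes> (v \<otimes> x [^] Suc D)"
      unfolding v(2) using v(1) qc xS by (simp add: m_ac del: nat_pow_Suc)
    finally have "w \<otimes> a = v \<otimes> x [^] Suc D"
      by (rule nonzerodivisor_cancel[OF qnz]) (use wc ac v(1) xS in auto)
    then show ?thesis using v(1) mem_PIdl by blast
  qed
  have "x [^] d \<otimes> y [^] k \<in> ideal_power R ?P D"
    unfolding D_def by (rule ideal_power_mult_mem[OF P(1) elem_power_mem_1[OF P(1,2)] elem_power_mem_1[OF P(1,3)]])
  then have "(x [^] d \<otimes> y [^] k) \<otimes> a \<in> PIdl (x [^] Suc D)" by (rule all)
  moreover have "(x [^] d \<otimes> y [^] k) \<otimes> a = x [^] d \<otimes> (y [^] k \<otimes> a)"
    using xc yc ac by (simp add: m_assoc)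
  moreover have "x [^] Suc D = x [^] d \<otimes> x [^] Suc k"
    using nat_pow_mult[OF xc, of d "Suc k"] by (simp add: D_def)
  ultimately have "x [^] d \<otimes> (y [^] k \<otimes> a) \<in> PIdl (x [^] d \<otimes> x [^] Suc k)" by simp
  then show ?thesis
    by (rule PIdl_cancel[OF nonzerodivisor_pow[OF nz], rotated 2]) (use xc yc ac in auto)
qed

lemma core_subset_colon_power:
  assumes x: "principal_reduction x I" shows "core R I \<subseteq> colon_power x n"
proof
  fix a assume a: "a \<in> core R I"
  have xc: "x \<in> carrier R" by (rule principal_reduction_closed[OF x])
  have ac: "a \<in> carrier R"
    using a x ideal_in_carrier[OF cgenideal_ideal[OF xc]] unfolding mem_core_iff by blast
  have xS: "x [^] Suc n \<in> carrier R" using xc by (rule nat_pow_closed)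
  have "I_power n \<subseteq> elem_colon (PIdl (x [^] Suc n)) a"
  proof (rule ideal_power_subset_if_powers_mem[OF ideal_I ideal_elem_colon[OF cgenideal_ideal[OF xS] ac] nat_embed_Unit])
    fix y assume y: "y \<in> I"
    show "y [^] n \<in> elem_colon (PIdl (x [^] Suc n)) a"
      using core_mult_power[OF a x y, of n] I_closed[OF y] by (simp add: elem_colon_def)
  qed
  then show "a \<in> colon_power x n"
    using ac by (auto simp: elem_colon_def mem_ideal_colon m_comm)
qed

lemma colon_power_eq_core:
  assumes "principal_reduction x I" "I_power (Suc n) \<subseteq> mult_ideal x (I_power n)"
  shows "colon_power x n = core R I"
  using colon_power_subset_core core_subset_colon_power assms by blast

end

section \<open>The equivalence\<close>

locale gorenstein_one_dim_ideal =
  gorenstein_one_dim_local_ring R e E d N + one_dim_CM_ideal R I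
  for R :: "('a, 'r) ring_scheme" (structure) and e :: "'a \<Rightarrow> 'm" and E d N I
begin

text \<open>The duality of \<open>R / (x\<^sup>k)\<close> recovers \<open>x\<^bsup>k-n\<^esup> I\<^sup>n\<close> from its annihilator, hence from
  \<open>(x\<^bsup>n+1\<^esup>) : I\<^sup>n\<close>.\<close>

lemma reduction_if_colon_power_eq_core:
  assumes x: "principal_reduction x I" and eq: "colon_power x n = core R I"
  shows "I_power (Suc n) \<subseteq> mult_ideal x (I_power n)"
proof -
  have xI: "x \<in> I" by (rule principal_reduction_mem[OF x])
  have xc: "x \<in> carrier R" by (rule I_closed[OF xI])
  have nz: "nonzerodivisor x" by (rule principal_reduction_nonzerodivisor[OF x])
  obtain m where m: "I_power (Suc m) \<subseteq> mult_ideal x (I_power m)" using x principal_reduction_def by blast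
  \<comment> \<open>An exponent beyond both \<open>n\<close> and the reduction number, at which the colon ideal is the core.\<close>
  define k where "k = Suc (n + m)"
  have red: "I_power (Suc k) \<subseteq> mult_ideal x (I_power k)"
    using ideal_power_absorb[OF ideal_I xc m, of "Suc n"] by (simp add: k_def add.commute)
  have split: "x [^] k = x [^] Suc m \<otimes> x [^] n"
    using nat_pow_mult[OF xc, of "Suc m" n] by (simp add: k_def add.commute)
  define z where "z = x [^] k"
  have zc: "z \<in> carrier R" using xc by (simp add: z_def)
  have xm: "x \<in> \<mm>" using xI I_subset_max by blast
  have zm: "z \<in> \<mm>"
    unfolding z_def k_def nat_pow_Suc using xm xc by (intro ideal_mult_l[OF ideal_max]) auto
  have zp: "max_primary (PIdl z)"
    using max_primary_if_power_dvd[OF xc principal_reduction_max_primary[OF x] cgenideal_ideal[OF zc], of k]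
      cgenideal_self[OF zc] by (simp add: z_def)
  define A where "A = mult_ideal (x [^] Suc m) (I_power n)"
  have xSc: "x [^] Suc m \<in> carrier R" using xc by (rule nat_pow_closed)
  have AI: "ideal A R" unfolding A_def by (rule ideal_mult_ideal[OF ideal_I_power xSc])
  have zA: "z \<in> A"
    unfolding A_def z_def split by (rule mult_idealI[OF elem_power_mem_1[OF ideal_I xI]])
  have sub: "I_power k \<subseteq> A"
  proof (rule ccontr)
    assume "\<not> I_power k \<subseteq> A"
    then obtain b where b: "b \<in> I_power k" "b \<notin> A" by blast
    have bc: "b \<in> carrier R" by (rule I_power_closed[OF b(1)])
    obtain w where w: "w \<in> carrier R" "\<And>a. a \<in> A \<Longrightarrow> a \<otimes> w \<in> PIdl z" "b \<otimes> w \<notin> PIdl z"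
      using colon_duality[OF zm zp AI zA bc b(2)] by blast
    have "x \<otimes> w \<in> colon_power x n"
      unfolding mem_ideal_colon
    proof (intro conjI ballI)
      show "x \<otimes> w \<in> carrier R" using xc w by simp
      fix u assume u: "u \<in> I_power n"
      have uc: "u \<in> carrier R" by (rule I_power_closed[OF u])
      have "(x [^] Suc m \<otimes> u) \<otimes> w \<in> PIdl (x [^] Suc m \<otimes> x [^] n)"
        using w(2)[of "x [^] Suc m \<otimes> u"] mult_idealI[OF u] unfolding A_def z_def split by blast
      then have "x [^] Suc m \<otimes> (u \<otimes> w) \<in> PIdl (x [^] Suc m \<otimes> x [^] n)"
        using m_assoc[OF xSc uc w(1)] by simp
      then have "u \<otimes> w \<in> PIdl (x [^] n)"
        by (rule PIdl_cancel[OF nonzerodivisor_pow[OF nz], rotated 2]) (use xc uc w in auto)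
      then obtain r where r: "r \<in> carrier R" "u \<otimes> w = r \<otimes> x [^] n" using mem_PIdl by blast
      have "(x \<otimes> w) \<otimes> u = (u \<otimes> w) \<otimes> x" using xc w(1) uc by (simp add: m_ac)
      also have "\<dots> = r \<otimes> x [^] Suc n" unfolding r(2) using r(1) xc by (simp add: m_assoc)
      finally show "(x \<otimes> w) \<otimes> u \<in> PIdl (x [^] Suc n)" using r(1) mem_PIdl by blast
    qed
    then have "x \<otimes> w \<in> colon_power x k" unfolding eq colon_power_eq_core[OF x red] .
    then have "(x \<otimes> w) \<otimes> b \<in> PIdl (x [^] Suc k)" using b(1) by (simp add: mem_ideal_colon)
    then have "x \<otimes> (b \<otimes> w) \<in> PIdl (x \<otimes> z)"
      using xc w(1) bc by (simp add: z_def m_ac)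
    then have "b \<otimes> w \<in> PIdl z" by (rule PIdl_cancel[OF nz zc, rotated]) (use bc w in auto)
    then show False using w(3) by blast
  qed
  show ?thesis
  proof
    fix v assume v: "v \<in> I_power (Suc n)"
    have vc: "v \<in> carrier R" by (rule I_power_closed[OF v])
    have "x [^] m \<otimes> v \<in> I_power k"
      using ideal_power_mult_mem[OF ideal_I elem_power_mem_1[OF ideal_I xI] v, of m] by (simp add: k_def add.commute)
    then obtain u where u: "u \<in> I_power n" "x [^] m \<otimes> v = x [^] Suc m \<otimes> u"
      using sub unfolding A_def by (auto elim!: mult_idealE)
    have uc: "u \<in> carrier R" by (rule I_power_closed[OF u(1)])
    have "x [^] m \<otimes> v = x [^] m \<otimes> (x \<otimes> u)" unfolding u(2) using xc uc by (simp add: m_assoc)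
    then have "v = x \<otimes> u"
      by (rule nonzerodivisor_cancel[OF nonzerodivisor_pow[OF nz]]) (use vc xc uc in auto)
    then show "v \<in> mult_ideal x (I_power n)" using mult_idealI[OF u(1)] by simp
  qed
qed

lemma colon_eq_core_iff_reduction_number:
  assumes x: "principal_reduction x I"
  shows "colon_power x n = core R I \<longleftrightarrow> reduction_number R I \<le> n"
  using reduction_if_colon_power_eq_core[OF x] colon_power_eq_core[OF x] reduction_number_le_iff[OF x]
  by blast

lemma equivalence_proper:
  shows "((\<forall>J J'. minimal_reduction R J I \<and> minimal_reduction R J' I \<longrightarrow>
             ideal_colon R (ideal_power R J (n + 1)) (ideal_power R I n) =
             ideal_colon R (ideal_power R J' (n + 1)) (ideal_power R I n))
          \<longleftrightarrow> (\<exists>J. minimal_reduction R J I \<and>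
             core R I = ideal_colon R (ideal_power R J (n + 1)) (ideal_power R I n)))
       \<and> ((\<exists>J. minimal_reduction R J I \<and>
             core R I = ideal_colon R (ideal_power R J (n + 1)) (ideal_power R I n))
          \<longleftrightarrow> n \<ge> reduction_number R I)" (is "(?a \<longleftrightarrow> ?b) \<and> (?b \<longleftrightarrow> ?c)")
proof -
  have colon: "ideal_colon R (ideal_power R (PIdl x) (n + 1)) (ideal_power R I n) = colon_power x n"
    if "principal_reduction x I" for x
    using ideal_power_PIdl[OF principal_reduction_closed[OF that]] by simp
  obtain x0 where x0: "principal_reduction x0 I"
    by (rule ex_principal_reduction[OF max_primary_I proper_I])
  have a: "?a \<longleftrightarrow> (\<forall>x y. principal_reduction x I \<and> principal_reduction y I \<longrightarrow> colon_power x n = colon_power y n)"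
    unfolding minimal_reduction_iff using colon by metis
  have b: "?b \<longleftrightarrow> (\<exists>x. principal_reduction x I \<and> core R I = colon_power x n)"
    unfolding minimal_reduction_iff using colon by metis
  have "?b \<longleftrightarrow> ?c"
    unfolding b using colon_eq_core_iff_reduction_number x0 by metis
  moreover have "?c \<Longrightarrow> ?a"
    unfolding a using colon_eq_core_iff_reduction_number by metis
  moreover have "?a \<Longrightarrow> ?b"
  proof -
    assume "?a"
    then have all: "colon_power x0 n = colon_power x n" if "principal_reduction x I" for x
      using a x0 that by blast
    have "colon_power x0 n \<subseteq> core R I"
    proof
      fix c assume c: "c \<in> colon_power x0 n"
      then show "c \<in> core R I" unfolding mem_core_iff using all colon_power_subset_PIdl by blast
    qed
    then have "core R I = colon_power x0 n" using core_subset_colon_power[OF x0] by blast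
    then show ?b unfolding b using x0 by blast
  qed
  ultimately show ?thesis by blast
qed

end

text \<open>The unit ideal has infinite height and must be treated on its own, since the parameters used
  for proper ideals lie in \<open>\<mm>\<close>.\<close>

lemma (in cring) reduction_carrier_iff: "reduction R J (carrier R) \<longleftrightarrow> J = carrier R"
proof -
  have pow: "ideal_power R (carrier R) k = carrier R" for k
    by (induction k) (simp_all add: ideal_power_0 ideal_power_Suc ideal_prod_one oneideal)
  show ?thesis
    unfolding reduction_def pow
    using ideal_prod_one oneideal by auto
qed

lemma (in noetherian_local_ring) nat_embed_Unit_if_char_zero:
  assumes "char_zero (residue_field R)" "n > 0"
  shows "nat_embed n \<in> Units R"
proof (rule ccontr)
  interpret M: ideal \<mm> R by (rule ideal_max)
  interpret Q: ring "R Quot \<mm>" by (rule M.quotient_is_ring)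
  have add: "add_pow (R Quot \<mm>) k (\<one>\<^bsub>R Quot \<mm>\<^esub>) = \<mm> +> nat_embed k" for k :: nat
  proof (induction k)
    case 0
    have "add_pow (R Quot \<mm>) (0::nat) (\<one>\<^bsub>R Quot \<mm>\<^esub>) = \<zero>\<^bsub>R Quot \<mm>\<^esub>"
      by (rule Q.add.nat_pow_0)
    then show ?case by (simp add: FactRing_def M.a_rcos_const)
  next
    case (Suc k)
    have "add_pow (R Quot \<mm>) (Suc k) (\<one>\<^bsub>R Quot \<mm>\<^esub>)
        = add_pow (R Quot \<mm>) k (\<one>\<^bsub>R Quot \<mm>\<^esub>) \<oplus>\<^bsub>R Quot \<mm>\<^esub> \<one>\<^bsub>R Quot \<mm>\<^esub>"
      by (rule Q.add.nat_pow_Suc)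
    also have "\<dots> = (\<mm> +> nat_embed k) \<oplus>\<^bsub>R Quot \<mm>\<^esub> (\<mm> +> \<one>)"
      unfolding Suc by (simp add: FactRing_def)
    also have "\<dots> = \<mm> +> (nat_embed k \<oplus> \<one>)"
      by (simp add: FactRing_def M.a_rcos_sum)
    finally show ?case by (simp add: nat_embed_Suc a_comm)
  qed
  assume "nat_embed n \<notin> Units R"
  then have "nat_embed n \<in> \<mm>" using Units_iff_notin_max by simp
  then have "add_pow (R Quot \<mm>) n (\<one>\<^bsub>R Quot \<mm>\<^esub>) = \<zero>\<^bsub>R Quot \<mm>\<^esub>"
    unfolding add by (simp add: FactRing_def M.a_rcos_const)
  then show False using assms unfolding char_zero_def residue_field_def by blast
qed

theorem theorem3p2:
  fixes R :: "('a, 'r) ring_scheme" and I :: "'a set" and n :: nat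
  assumes "gorenstein_local_ring TYPE('m) R"
    and "krull_dim R = 1"
    and "char_zero (residue_field R)"
    and "ideal I R"
    and "ideal_height R I > 0"
    and "n > 0"
  shows "((\<forall>J J'. minimal_reduction R J I \<and> minimal_reduction R J' I \<longrightarrow>
             ideal_colon R (ideal_power R J (n + 1)) (ideal_power R I n) =
             ideal_colon R (ideal_power R J' (n + 1)) (ideal_power R I n))
          \<longleftrightarrow> (\<exists>J. minimal_reduction R J I \<and>
             core R I = ideal_colon R (ideal_power R J (n + 1)) (ideal_power R I n)))
       \<and> ((\<exists>J. minimal_reduction R J I \<and>
             core R I = ideal_colon R (ideal_power R J (n + 1)) (ideal_power R I n))
          \<longleftrightarrow> n \<ge> reduction_number R I)"
proof -
  interpret noetherian_local_ring R
    using assms(1) by (simp add: gorenstein_local_ring_def)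
  interpret one_dim_local_ring R
    by unfold_locales (rule assms(2))
  show ?thesis
  proof (cases "\<one>\<^bsub>R\<^esub> \<in> I")
    case False
    obtain e and E :: "nat \<Rightarrow> ('a, 'm) module" and d N
      where res: "injective_resolution R (regular_module R) e E d"
        and bounded: "\<forall>i>N. carrier (E i) = {\<zero>\<^bsub>E i\<^esub>}"
      using assms(1) unfolding gorenstein_local_ring_def finite_injective_dim_def by blast
    interpret bounded_injective_resolution R e E d N
      by unfold_locales (use res bounded in auto)
    interpret gorenstein_one_dim_local_ring R e E d N ..
    interpret gorenstein_one_dim_ideal R e E d N I
    proof unfold_locales
      show "nat_embed k \<in> Units R" if "k > 0" for k
        by (rule nat_embed_Unit_if_char_zero[OF assms(3) that])
      show "max_primary I" by (rule max_primary_if_height_pos[OF assms(4,5)])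
      show "\<one>\<^bsub>R\<^esub> \<notin> I" by (rule False)
    qed
    show ?thesis by (rule equivalence_proper)
  next
    case True
    then have I: "I = carrier R" using ideal_eq_carrier_iff[OF assms(4)] by blast
    have pow: "ideal_power R (carrier R) k = carrier R" for k
      by (induction k) (simp_all add: ideal_power_0 ideal_power_Suc ideal_prod_one oneideal)
    have min: "minimal_reduction R J I \<longleftrightarrow> J = carrier R" for J
      unfolding I minimal_reduction_def reduction_carrier_iff by auto
    have core: "core R I = carrier R"
      unfolding I core_def reduction_carrier_iff by simp
    have "ideal_power R I (0 + 1) = carrier R \<cdot>\<^bsub>R\<^esub> ideal_power R I 0"
      unfolding I pow by (simp add: ideal_prod_one oneideal)
    then have "reduction_number_wrt R (carrier R) I \<le> 0"
      unfolding reduction_number_wrt_def by (rule Least_le)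
    then have "reduction_number R I = 0"
      unfolding reduction_number_def min by simp
    moreover have "ideal_colon R (carrier R) (carrier R) = carrier R"
      by (auto simp: ideal_colon_def)
    ultimately show ?thesis
      unfolding min core by (simp add: I pow)
  qed
qed

end
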